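(* Let $G$ be a Polish group and let $(\mathcal{X},\mu,G)$ be a boolean $G$-system. Let $\mathcal{D}\subset\mathcal{X}$ be the sub-$\sigma$-algebra generated by the $G$-continuous functions in $L^\infty(\mu)$, and let $\mathcal{A}\subset\mathcal{X}$ be the sub-$\sigma$-algebra generated by the stable sets. Then $\mathcal{D}=\mathcal{A}$. In particular, $(\mathcal{X},\mu,G)$ admits a spatial model if and only if $\mathcal{X}=\mathcal{A}$.
   Context: $(X,\mathcal{X},\mu)$ is a standard Borel space with a probability measure $\mu$; elements of $\mathcal{X}$ are identified modulo $\mu$-null sets (so $\mathcal{X}$ is the measure algebra), and sub-$\sigma$-algebras are understood modulo null sets. $\mathrm{Aut}(X)=\mathrm{Aut}(X,\mathcal{X},\mu)$ is the Polish group of equivalence classes (mod null sets) of invertible measure preserving transformations, with the topology whose neighborhoods of the identity are generated by the sets $N(A,\varepsilon)=\{T:\mu(A\triangle TA)<\varepsilon\}$, $A\in\mathcal{X}$, $\varepsilon>0$. A boolean $G$-system (equivalently, near-action) $(\mathcal{X},\mu,G)$ is a continuous homomorphism $G\to\mathrm{Aut}(X)$. A spatial $G$-action is a Borel map $G\times X\to X$ on a standard Borel probability space with $ex=x$ and $g(hx)=(gh)x$ for all $g,h\in G$ and all $x\in X$, each $g$ preserving the measure. A boolean $G$-system admits a spatial model if it is isomorphic (as an action on a measure algebra) to the boolean system induced by some spatial $G$-action. A function $f\in L^\infty(\mu)$ is $G$-continuous if $f\circ g_n\to f$ in $L^\infty(\mu)$-norm whenever $g_n\to e$ in $G$, where $e$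 is the identity of $G$. Fix a sequence $\{U_m\}_{m\ge1}$ of open neighborhoods of $e$ in $G$ with the following properties: (i) $U_{m+1}^2\subset U_m$ for every $m$; (ii) $U_m^{-1}=U_m$ for every $m$; (iii) $\bigcap_{m=1}^\infty U_m=\{e\}$. For $A\in\mathcal{X}$ and $U\subset G$ open, $UA=\bigcup\{\gamma A:\gamma\in U'\}\in\mathcal{X}$, where $U'$ is any countable dense subset of $U$ (as an element of the measure algebra this does not depend on $U'$). For $\mu(A)>0$ put $\tilde A=\bigcap_{m=1}^\infty U_mA$. A set $A\in\mathcal{X}$ is stable if it is empty (null) or $\tilde A=A$.
   Formalization: The sets U_m are additionally assumed to form a neighborhood base at e; with (i)–(iii) alone the claim fails, e.g. for a mixing flow of R with U_m = {t : t and αt within 2^-m of the integers}, α irrational. *)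

theory Defs
  imports "HOL-Probability.Probability" "HOL-Algebra.Coset"
begin

section \<open>Polish groups and standard Borel spaces\<close>

definition polish_topology :: "'a topology \<Rightarrow> bool" where
  "polish_topology \<tau> \<longleftrightarrow> completely_metrizable_space \<tau> \<and> separable_space \<tau>"

definition polish_group :: "('g, 'r) monoid_scheme \<Rightarrow> 'g topology \<Rightarrow> bool" where
  "polish_group G \<tau> \<longleftrightarrow>
     group G \<and> topspace \<tau> = carrier G \<and> polish_topology \<tau> \<and>
     continuous_map (prod_topology \<tau> \<tau>) \<tau> (\<lambda>(g, h). g \<otimes>\<^bsub>G\<^esub> h) \<and>
     continuous_map \<tau> \<tau> (m_inv G)"

definition borel_measure_of :: "'a topology \<Rightarrow> 'a measure" where
  "borel_measure_of \<tau> = sigma (topspace \<tau>) {V. openin \<tau> V}"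

definition standard_borel :: "'a measure \<Rightarrow> bool" where
  "standard_borel M \<longleftrightarrow>
     (\<exists>\<tau>. polish_topology \<tau> \<and> topspace \<tau> = space M \<and> sets M = sets (borel_measure_of \<tau>))"

section \<open>The measure algebra\<close>

text \<open>
  Elements of the measure algebra of \<open>M\<close> are represented by members of \<^term>\<open>sets M\<close>; equality in
  the measure algebra is the relation \<open>eq_mod_null\<close>. A sub-sigma-algebra of the measure algebra
  is represented by the sub-sigma-algebra of \<^term>\<open>sets M\<close> of all representatives of its elements.
  This one contains \<^term>\<open>null_sets M\<close>, so that equality of sub-sigma-algebras
  modulo null sets becomes plain equality.
\<close>

definition eq_mod_null :: "'a measure \<Rightarrow> 'a set \<Rightarrow> 'a set \<Rightarrow> bool" where
  "eq_mod_null M A B \<longleftrightarrow> A \<in> sets M \<and> B \<in> sets M \<and> sym_diff A B \<in> null_sets M"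

definition generated_mod_null :: "'a measure \<Rightarrow> 'a set set \<Rightarrow> 'a set set" where
  "generated_mod_null M E = sigma_sets (space M) (E \<union> null_sets M)"

section \<open>The group of automorphisms of a probability space\<close>

definition inv_mpt :: "'a measure \<Rightarrow> ('a \<Rightarrow> 'a) set" where
  "inv_mpt M = {T. T \<in> M \<rightarrow>\<^sub>M M \<and> bij_betw T (space M) (space M) \<and>
                   the_inv_into (space M) T \<in> M \<rightarrow>\<^sub>M M \<and> distr M M T = M}"

definition aut_class :: "'a measure \<Rightarrow> ('a \<Rightarrow> 'a) \<Rightarrow> ('a \<Rightarrow> 'a) set" where
  "aut_class M T = {S \<in> inv_mpt M. AE x in M. S x = T x}"

definition Aut :: "'a measure \<Rightarrow> ('a \<Rightarrow> 'a) set monoid" where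
  "Aut M = \<lparr>carrier = aut_class M ` inv_mpt M,
            mult = (\<lambda>c d. {R \<in> inv_mpt M. \<exists>S\<in>c. \<exists>T\<in>d. AE x in M. R x = S (T x)}),
            one = aut_class M (\<lambda>x. x)\<rparr>"

definition aut_rep :: "('a \<Rightarrow> 'a) set \<Rightarrow> 'a \<Rightarrow> 'a" where
  "aut_rep c = (SOME T. T \<in> c)"

text \<open>
  The action of a class \<open>c\<close> on sets. The choice of the representative affects
  the resulting set by a null set only.
\<close>

definition aut_image :: "('a \<Rightarrow> 'a) set \<Rightarrow> 'a set \<Rightarrow> 'a set" where
  "aut_image c A = aut_rep c ` A"

text \<open>
  The set of all \<open>d\<close> with \<open>\<mu> (c A \<triangle> d A) < \<epsilon>\<close> is the left translate by \<open>c\<close> of the basic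
  identity neighbourhood \<open>N(A, \<epsilon>)\<close>.
\<close>

definition aut_topology :: "'a measure \<Rightarrow> ('a \<Rightarrow> 'a) set topology" where
  "aut_topology M = topology_generated_by
     {{d \<in> carrier (Aut M). measure M (sym_diff (aut_image c A) (aut_image d A)) < \<epsilon>} | c A \<epsilon>.
        c \<in> carrier (Aut M) \<and> A \<in> sets M \<and> \<epsilon> > 0}"

section \<open>Boolean systems and spatial models\<close>

definition boolean_system ::
  "('g, 'r) monoid_scheme \<Rightarrow> 'g topology \<Rightarrow> 'a measure \<Rightarrow> ('g \<Rightarrow> ('a \<Rightarrow> 'a) set) \<Rightarrow> bool" where
  "boolean_system G \<tau> M \<phi> \<longleftrightarrow> \<phi> \<in> hom G (Aut M) \<and> continuous_map \<tau> (aut_topology M) \<phi>"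

definition spatial_action ::
  "('g, 'r) monoid_scheme \<Rightarrow> 'g topology \<Rightarrow> 'a measure \<Rightarrow> ('g \<Rightarrow> 'a \<Rightarrow> 'a) \<Rightarrow> bool" where
  "spatial_action G \<tau> N a \<longleftrightarrow>
     standard_borel N \<and> prob_space N \<and>
     (\<lambda>(g, x). a g x) \<in> (borel_measure_of \<tau> \<Otimes>\<^sub>M N) \<rightarrow>\<^sub>M N \<and>
     (\<forall>x\<in>space N. a \<one>\<^bsub>G\<^esub> x = x) \<and>
     (\<forall>g\<in>carrier G. \<forall>h\<in>carrier G. \<forall>x\<in>space N. a g (a h x) = a (g \<otimes>\<^bsub>G\<^esub> h) x) \<and>
     (\<forall>g\<in>carrier G. distr N N (a g) = N)"

text \<open>
  An isomorphism of measure algebras, given on representatives.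
\<close>

definition measure_algebra_iso :: "'a measure \<Rightarrow> 'b measure \<Rightarrow> ('a set \<Rightarrow> 'b set) \<Rightarrow> bool" where
  "measure_algebra_iso M N \<Phi> \<longleftrightarrow>
     \<Phi> \<in> sets M \<rightarrow> sets N \<and>
     (\<forall>A\<in>sets M. \<forall>B\<in>sets M. eq_mod_null N (\<Phi> A) (\<Phi> B) \<longleftrightarrow> eq_mod_null M A B) \<and>
     (\<forall>B\<in>sets N. \<exists>A\<in>sets M. eq_mod_null N (\<Phi> A) B) \<and>
     (\<forall>A\<in>sets M. eq_mod_null N (\<Phi> (space M - A)) (space N - \<Phi> A)) \<and>
     (\<forall>A::nat \<Rightarrow> 'a set. range A \<subseteq> sets M \<longrightarrow> eq_mod_null N (\<Phi> (\<Union>n. A n)) (\<Union>n. \<Phi> (A n))) \<and>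
     (\<forall>A\<in>sets M. emeasure N (\<Phi> A) = emeasure M A)"

definition boolean_isomorphic ::
  "('g, 'r) monoid_scheme \<Rightarrow> 'a measure \<Rightarrow> ('g \<Rightarrow> ('a \<Rightarrow> 'a) set) \<Rightarrow>
     'b measure \<Rightarrow> ('g \<Rightarrow> ('b \<Rightarrow> 'b) set) \<Rightarrow> bool" where
  "boolean_isomorphic G M \<phi> N \<psi> \<longleftrightarrow>
     (\<exists>\<Phi>. measure_algebra_iso M N \<Phi> \<and>
       (\<forall>g\<in>carrier G. \<forall>A\<in>sets M.
          eq_mod_null N (\<Phi> (aut_image (\<phi> g) A)) (aut_image (\<psi> g) (\<Phi> A))))"

text \<open>
  HOL cannot quantify existentially over the type of the points of the model. The type
  \<open>nat \<Rightarrow> real\<close> loses no generality: every Polish space is homeomorphic to a subset of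
  \<open>\<real>\<^sup>\<nat>\<close>, so every standard Borel space is isomorphic to one whose points form a set of
  that type.
\<close>

definition admits_spatial_model ::
  "('g, 'r) monoid_scheme \<Rightarrow> 'g topology \<Rightarrow> 'a measure \<Rightarrow> ('g \<Rightarrow> ('a \<Rightarrow> 'a) set) \<Rightarrow> bool" where
  "admits_spatial_model G \<tau> M \<phi> \<longleftrightarrow>
     (\<exists>(N :: (nat \<Rightarrow> real) measure) a.
        spatial_action G \<tau> N a \<and> boolean_isomorphic G M \<phi> N (\<lambda>g. aut_class N (a g)))"

section \<open>Continuous functions\<close>

definition Linf :: "'a measure \<Rightarrow> ('a \<Rightarrow> real) set" where
  "Linf M = {f \<in> borel_measurable M. esssup M (\<lambda>x. ereal \<bar>f x\<bar>) < \<infinity>}"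

definition G_continuous ::
  "('g, 'r) monoid_scheme \<Rightarrow> 'g topology \<Rightarrow> 'a measure \<Rightarrow> ('g \<Rightarrow> ('a \<Rightarrow> 'a) set) \<Rightarrow> ('a \<Rightarrow> real) \<Rightarrow> bool"
  where
  "G_continuous G \<tau> M \<phi> f \<longleftrightarrow> f \<in> Linf M \<and>
     (\<forall>g :: nat \<Rightarrow> 'g. range g \<subseteq> carrier G \<longrightarrow> limitin \<tau> g \<one>\<^bsub>G\<^esub> sequentially \<longrightarrow>
        (\<lambda>n. esssup M (\<lambda>x. ereal \<bar>f (aut_rep (\<phi> (g n)) x) - f x\<bar>)) \<longlonglongrightarrow> 0)"

definition continuous_algebra ::
  "('g, 'r) monoid_scheme \<Rightarrow> 'g topology \<Rightarrow> 'a measure \<Rightarrow> ('g \<Rightarrow> ('a \<Rightarrow> 'a) set) \<Rightarrow> 'a set set" where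
  "continuous_algebra G \<tau> M \<phi> =
     generated_mod_null M {f -` B \<inter> space M | f B. G_continuous G \<tau> M \<phi> f \<and> B \<in> sets borel}"

section \<open>Stable sets\<close>

text \<open>
  These conditions alone do not make \<open>U\<close> a neighbourhood base at the identity. For the real line
  and irrational \<open>\<alpha>\<close>, the sets of all \<open>t\<close> such that \<open>t\<close> and \<open>\<alpha> t\<close> have distance less than
  \<open>2\<^sup>-\<^sup>m\<close> to the integers satisfy them, but are unbounded; for a mixing flow they admit
  only trivial stable sets.
\<close>

definition nbhd_sequence ::
  "('g, 'r) monoid_scheme \<Rightarrow> 'g topology \<Rightarrow> (nat \<Rightarrow> 'g set) \<Rightarrow> bool" where
  "nbhd_sequence G \<tau> U \<longleftrightarrow>
     (\<forall>m\<ge>1. openin \<tau> (U m) \<and> \<one>\<^bsub>G\<^esub> \<in> U m) \<and>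
     (\<forall>m\<ge>1. U (Suc m) <#>\<^bsub>G\<^esub> U (Suc m) \<subseteq> U m) \<and>
     (\<forall>m\<ge>1. m_inv G ` U m = U m) \<and>
     (\<Inter>m\<in>{1..}. U m) = {\<one>\<^bsub>G\<^esub>}"

definition countable_dense_subset :: "'g topology \<Rightarrow> 'g set \<Rightarrow> 'g set" where
  "countable_dense_subset \<tau> V = (SOME D. countable D \<and> D \<subseteq> V \<and> V \<subseteq> \<tau> closure_of D)"

text \<open>
  The set \<open>V A\<close>. For a boolean system, the chosen dense subset affects it by a null set only.
\<close>

definition translates_union ::
  "'g topology \<Rightarrow> ('g \<Rightarrow> ('a \<Rightarrow> 'a) set) \<Rightarrow> 'g set \<Rightarrow> 'a set \<Rightarrow> 'a set" where
  "translates_union \<tau> \<phi> V A = (\<Union>\<gamma>\<in>countable_dense_subset \<tau> V. aut_image (\<phi> \<gamma>) A)"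

definition stable_hull ::
  "'g topology \<Rightarrow> ('g \<Rightarrow> ('a \<Rightarrow> 'a) set) \<Rightarrow> (nat \<Rightarrow> 'g set) \<Rightarrow> 'a set \<Rightarrow> 'a set" where
  "stable_hull \<tau> \<phi> U A = (\<Inter>m\<in>{1..}. translates_union \<tau> \<phi> (U m) A)"

definition stable ::
  "'g topology \<Rightarrow> 'a measure \<Rightarrow> ('g \<Rightarrow> ('a \<Rightarrow> 'a) set) \<Rightarrow> (nat \<Rightarrow> 'g set) \<Rightarrow> 'a set \<Rightarrow> bool" where
  "stable \<tau> M \<phi> U A \<longleftrightarrow> A \<in> sets M \<and> (A \<in> null_sets M \<or> eq_mod_null M (stable_hull \<tau> \<phi> U A) A)"

definition stable_algebra ::
  "'g topology \<Rightarrow> 'a measure \<Rightarrow> ('g \<Rightarrow> ('a \<Rightarrow> 'a) set) \<Rightarrow> (nat \<Rightarrow> 'g set) \<Rightarrow> 'a set set" where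
  "stable_algebra \<tau> M \<phi> U = generated_mod_null M {A. stable \<tau> M \<phi> U A}"

end

theory Submission
  imports Defs
begin

text \<open>
  An element \<open>g\<close> of the group acts on points through a representative \<open>T g\<close> of the class
  \<open>\<phi> g\<close>; identities such as \<open>T (gh) = T g \<circ> T h\<close> hold almost everywhere, and all relations
  between sets below are meant up to null sets. The hull of \<open>A\<close> is \<open>\<Inter>\<^sub>m U\<^sub>m A\<close>. Since
  \<open>U\<^sub>m\<^sub>+\<^sub>1 U\<^sub>m\<^sub>+\<^sub>1 \<subseteq> U\<^sub>m\<close>, the hull of any set is stable (\<open>hull_stable\<close>), so stable sets are the
  same thing as hulls.

  \<^bold>\<open>The two algebras agree.\<close> If \<open>f\<close> is \<open>G\<close>-continuous, then a translation by an element of a small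
  \<open>U\<^sub>m\<close> changes \<open>f\<close> by little, so the hull of \<open>{f \<ge> r}\<close> lies in \<open>{f \<ge> r - \<epsilon>}\<close> for every \<open>\<epsilon>\<close>, and
  \<open>{f \<ge> r}\<close> is stable. Conversely a stable \<open>A\<close> is the zero set of a \<open>G\<close>-continuous function, a
  distance to \<open>A\<close> measured in the group: as in the Birkhoff--Kakutani metrization theorem, moving a point
  through neighbourhoods \<open>V\<^sub>m\<^sub>1, \<dots>, V\<^sub>m\<^sub>n\<close> costs \<open>2\<^sup>-\<^sup>m\<^sup>1 + \<dots> + 2\<^sup>-\<^sup>m\<^sup>n\<close>, and the distance of \<open>x\<close> is the
  infimum of the costs of reaching \<open>x\<close> from \<open>A\<close>. The chain estimate \<open>chain_nbhd_subset_sparse\<close> says that a chain of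
  cost below \<open>2\<^sup>-\<^sup>k\<close> stays inside \<open>V\<^sub>k\<close>; here
  \<open>V\<^sub>k = U\<^sub>2\<^sub>k\<^sub>+\<^sub>1\<close>. Hence distance zero means membership in the hull.

  \<^bold>\<open>Generation implies a model.\<close> If the continuous functions generate, then countably many of them do,
  say \<open>f\<^sub>n\<close>. The function \<open>\<rho>\<^sub>n g = \<parallel>f\<^sub>n \<circ> T g - f\<^sub>n\<parallel>\<^sub>\<infinity>\<close> is a continuous pseudo-norm on the group. For
  almost every \<open>x\<close> the map \<open>k \<mapsto> f\<^sub>n (T k x)\<close>, restricted to a countable dense set of \<open>k\<close>, is
  1-Lipschitz for \<open>\<rho>\<^sub>n (k l\<^sup>-\<^sup>1)\<close>, so it extends to the group. Right translation acts
  everywhere, and in a jointly Borel way, on the closed set of all such families of Lipschitz functions,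
  and sending \<open>x\<close> to its family of functions transports the measure and the action there. The formula of
  McShane for the extension of Lipschitz functions makes the action explicit as a countable infimum.

  \<^bold>\<open>A model implies generation.\<close> In a model, the Vaught transform of a Borel set \<open>B\<close> and an open
  set \<open>V\<close> of the group consists of the points \<open>x\<close> such that \<open>{g \<in> V. g x \<in> B}\<close> is not meager. It is
  a Borel set, its translate by \<open>h\<close> is the transform for \<open>V h\<^sup>-\<^sup>1\<close>, and it is countably additive in
  \<open>V\<close>; covering \<open>V\<close> by small \<open>V\<^sub>i\<close> with \<open>V\<^sub>i U\<^sub>m \<subseteq> V\<close> exhibits it as a countable union of hulls.
  By the Baire category theorem countably many of these transforms separate the points of the model, and
  a countable family of Borel sets that separates points generates all Borel sets up to null sets, because
  on compact sets of almost full measure the separating map is a homeomorphism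
  (\<open>separating_family_generates\<close>).
\<close>

section \<open>Polish spaces and their Borel sets\<close>

lemma zero_less_one_over_Suc: "0 < 1 / real (Suc n)" by simp

lemma polish_countable_base:
  assumes "polish_topology \<tau>"
  obtains B :: "nat \<Rightarrow> 'a set" where "\<And>n. openin \<tau> (B n)"
    "\<And>W x. openin \<tau> W \<Longrightarrow> x \<in> W \<Longrightarrow> \<exists>n. x \<in> B n \<and> B n \<subseteq> W"
proof -
  obtain S d where S: "Metric_space S d" and \<tau>: "\<tau> = Metric_space.mtopology S d"
    using assms unfolding polish_topology_def completely_metrizable_space_def by auto
  interpret Metric_space S d by fact
  obtain C where C: "countable C" "C \<subseteq> S" "mtopology closure_of C = S"
    using assms unfolding polish_topology_def separable_space_def \<tau> by auto
  define BB where "BB = insert {} ((\<lambda>(s, n::nat). mball s (1 / real (Suc n))) ` (C \<times> UNIV))"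
  have cBB: "countable BB" "BB \<noteq> {}" unfolding BB_def using C(1) by auto
  have op: "openin \<tau> V" if "V \<in> BB" for V
    using that unfolding BB_def \<tau> by auto
  have base: "\<exists>V\<in>BB. x \<in> V \<and> V \<subseteq> W" if W: "openin \<tau> W" "x \<in> W" for W x
  proof -
    obtain r where r: "r > 0" "mball x r \<subseteq> W"
      using W unfolding \<tau> openin_mtopology by auto
    have xS: "x \<in> S" using W openin_subset[OF W(1)] unfolding \<tau> by auto
    obtain n :: nat where n: "1 / real (Suc n) < r / 2"
      using r(1) by (metis half_gt_zero nat_approx_posE of_nat_Suc)
    have "x \<in> mtopology closure_of C" using C xS by auto
    then obtain s where s: "s \<in> C" "s \<in> mball x (1 / real (Suc n))"
      unfolding metric_closure_of using zero_less_one_over_Suc[of n] by blast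
    have "x \<in> mball s (1 / real (Suc n))" using s by (auto simp: commute)
    moreover have "mball s (1 / real (Suc n)) \<subseteq> mball x r"
    proof
      fix y assume y: "y \<in> mball s (1 / real (Suc n))"
      have "d x y \<le> d x s + d s y" using y s xS by (intro triangle) auto
      also have "\<dots> < r" using y s n by auto
      finally show "y \<in> mball x r" using y xS by auto
    qed
    moreover have "mball s (1 / real (Suc n)) \<in> BB"
      using s(1) unfolding BB_def by (intro insertI2 image_eqI[of _ _ "(s, n)"]) auto
    ultimately show ?thesis using r by (meson subset_trans)
  qed
  show ?thesis
  proof (rule that[of "from_nat_into BB"])
    show "openin \<tau> (from_nat_into BB n)" for n using op from_nat_into[OF cBB(2)] by auto
    show "\<exists>n. x \<in> from_nat_into BB n \<and> from_nat_into BB n \<subseteq> W" if "openin \<tau> W" "x \<in> W" for W x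
      using base[OF that] from_nat_into_surj[OF cBB(1)] by metis
  qed
qed

lemma space_borel_measure_of [simp]: "space (borel_measure_of \<tau>) = topspace \<tau>"
  unfolding borel_measure_of_def by (simp add: space_measure_of_conv)

lemma sets_borel_measure_of: "sets (borel_measure_of \<tau>) = sigma_sets (topspace \<tau>) {V. openin \<tau> V}"
  unfolding borel_measure_of_def by (rule sets_measure_of) (auto dest: openin_subset)

lemma open_in_borel_measure_of: "openin \<tau> V \<Longrightarrow> V \<in> sets (borel_measure_of \<tau>)"
  unfolding sets_borel_measure_of by auto

lemma closed_in_borel_measure_of:
  assumes "closedin \<tau> V" shows "V \<in> sets (borel_measure_of \<tau>)"
proof -
  have "topspace \<tau> - (topspace \<tau> - V) \<in> sets (borel_measure_of \<tau>)"
    by (metis assms closedin_def open_in_borel_measure_of sets.compl_sets space_borel_measure_of)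
  then show ?thesis using closedin_subset[OF assms] by (simp add: double_diff)
qed

lemma borel_measure_of_countable_base:
  assumes B: "\<And>n::nat. openin \<tau> (B n)"
    and base: "\<And>W x. openin \<tau> W \<Longrightarrow> x \<in> W \<Longrightarrow> \<exists>n. x \<in> B n \<and> B n \<subseteq> W"
  shows "sets (borel_measure_of \<tau>) = sigma_sets (topspace \<tau>) (range B)"
proof
  show "sigma_sets (topspace \<tau>) (range B) \<subseteq> sets (borel_measure_of \<tau>)"
    unfolding sets_borel_measure_of by (rule sigma_sets_mono') (use B in auto)
  show "sets (borel_measure_of \<tau>) \<subseteq> sigma_sets (topspace \<tau>) (range B)"
    unfolding sets_borel_measure_of
  proof (rule sigma_sets_mono, rule subsetI)
    fix W assume "W \<in> {V. openin \<tau> V}"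
    then have W: "openin \<tau> W" by auto
    have "W = (\<Union>V\<in>{V\<in>range B. V \<subseteq> W}. V)"
      using base[OF W] by fast
    also have "\<dots> \<in> sigma_sets (topspace \<tau>) (range B)"
      by (rule sigma_sets_UNION) auto
    finally show "W \<in> sigma_sets (topspace \<tau>) (range B)" .
  qed
qed


lemma countable_dense_subset_of_open:
  assumes \<tau>: "polish_topology \<tau>" and V: "openin \<tau> V"
  shows "countable (countable_dense_subset \<tau> V)" "countable_dense_subset \<tau> V \<subseteq> V"
    "V \<subseteq> \<tau> closure_of countable_dense_subset \<tau> V"
proof -
  obtain B :: "nat \<Rightarrow> 'a set" where B: "\<And>n. openin \<tau> (B n)"
    and base: "\<And>W x. openin \<tau> W \<Longrightarrow> x \<in> W \<Longrightarrow> \<exists>n. x \<in> B n \<and> B n \<subseteq> W"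
    using polish_countable_base[OF \<tau>] by blast
  define D where "D = (\<lambda>n. SOME x. x \<in> B n \<inter> V) ` {n. B n \<inter> V \<noteq> {}}"
  have some: "(SOME x. x \<in> B n \<inter> V) \<in> B n \<inter> V" if "B n \<inter> V \<noteq> {}" for n
    using that some_in_eq[of "B n \<inter> V"] by simp
  have "countable D" unfolding D_def by auto
  moreover have "D \<subseteq> V" unfolding D_def using some by auto
  moreover have "V \<subseteq> \<tau> closure_of D"
  proof
    fix x assume x: "x \<in> V"
    have "\<exists>y\<in>D. y \<in> W" if W: "openin \<tau> W" "x \<in> W" for W
    proof -
      obtain n where n: "x \<in> B n" "B n \<subseteq> W" using base[OF W] by auto
      then have "B n \<inter> V \<noteq> {}" using x by auto
      then have "(SOME x. x \<in> B n \<inter> V) \<in> D" "(SOME x. x \<in> B n \<inter> V) \<in> W" 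
        using some[of n] n unfolding D_def by auto
      then show ?thesis by auto
    qed
    then show "x \<in> \<tau> closure_of D" using x openin_subset[OF V] unfolding in_closure_of by auto
  qed
  ultimately have "\<exists>D. countable D \<and> D \<subseteq> V \<and> V \<subseteq> \<tau> closure_of D" by blast
  then have "countable (countable_dense_subset \<tau> V) \<and> countable_dense_subset \<tau> V \<subseteq> V \<and>
    V \<subseteq> \<tau> closure_of countable_dense_subset \<tau> V"
    unfolding countable_dense_subset_def by (rule someI_ex)
  then show "countable (countable_dense_subset \<tau> V)" "countable_dense_subset \<tau> V \<subseteq> V"
    "V \<subseteq> \<tau> closure_of countable_dense_subset \<tau> V" by auto
qed


lemma second_countable_euclidean: "second_countable (euclidean :: 'a::second_countable_topology topology)"
proof -
  obtain B :: "'a set set" where B: "countable B" "topological_basis B" using ex_countable_basis by auto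
  show ?thesis unfolding second_countable_def
  proof (intro exI[of _ B] conjI allI impI ballI)
    show "openin euclidean V" if "V \<in> B" for V using topological_basis_open[OF B(2) that] by simp
    show "\<exists>V\<in>B. x \<in> V \<and> V \<subseteq> W" if "openin euclidean W \<and> x \<in> W" for W x
      using topological_basisE[OF B(2), of W x] that by (metis open_openin)
  qed (rule B(1))
qed

lemma closed_subset_standard_borel:
  fixes Y :: "'a::polish_space set"
  assumes Y: "closed Y" and N: "space N = Y" "sets N = sets (restrict_space borel Y)"
  shows "standard_borel N"
  unfolding standard_borel_def
proof (intro exI conjI)
  show "polish_topology (top_of_set Y)"
    unfolding polish_topology_def
    using completely_metrizable_space_closedin[OF completely_metrizable_space_euclidean] Y
      second_countable_imp_separable_space[OF second_countable_subtopology[OF second_countable_euclidean]]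
    by auto
  show "topspace (top_of_set Y) = space N" using N by simp
  have "sets N = sigma_sets Y ((\<lambda>A. A \<inter> Y) ` {S. open S})"
  proof -
    have b: "sets (borel :: 'a measure) = sigma_sets UNIV {S. open S}" unfolding borel_def by simp
    have "Y \<in> sigma_sets UNIV {S. open S}" using Y borel_closed b by blast
    from sigma_sets_Int[OF this] show ?thesis
      unfolding N(2) sets_restrict_space b by (simp add: Int_commute)
  qed
  moreover have "(\<lambda>A. A \<inter> Y) ` {S. open S} = {V. openin (top_of_set Y) V}"
    by (auto simp: openin_open)
  ultimately show "sets N = sets (borel_measure_of (top_of_set Y))"
    unfolding sets_borel_measure_of by simp
qed


section \<open>Inner regularity and separating families\<close>

lemma (in finite_measure) measure_UN_geometric:
  assumes "\<And>i::nat. A i \<in> sets M" and "\<And>i. measure M (A i) \<le> \<epsilon> * (1/2) ^ Suc i"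
  shows "measure M (\<Union>i. A i) \<le> \<epsilon>"
proof -
  have s: "(\<lambda>i. \<epsilon> * (1/2) ^ Suc i) sums (\<epsilon> * 1)"
    by (intro sums_mult power_half_series)
  have sm: "summable (\<lambda>i. measure M (A i))"
    by (rule summable_comparison_test'[of "\<lambda>i. \<epsilon> * (1/2) ^ Suc i" 0])
       (use s assms(2) in \<open>auto simp: sums_iff\<close>)
  have "measure M (\<Union>i. A i) \<le> (\<Sum>i. measure M (A i))"
    by (rule finite_measure_subadditive_countably) (use assms sm in auto)
  also have "\<dots> \<le> (\<Sum>i. \<epsilon> * (1/2) ^ Suc i)"
    by (rule suminf_le) (use assms sm s in \<open>auto simp: sums_iff\<close>)
  also have "\<dots> = \<epsilon>" using s by (simp add: sums_iff)
  finally show ?thesis .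
qed

text \<open>
  Ulam's theorem: for each \<open>n\<close> finitely many closed balls of radius \<open>1 / (n + 1)\<close> cover all but
  \<open>\<epsilon> 2\<^sup>-\<^sup>n\<^sup>-\<^sup>1\<close> of the mass, and the intersection of these finite unions is complete and totally bounded.
\<close>

lemma polish_tight:
  assumes fin: "finite_measure M" and \<tau>: "polish_topology \<tau>"
    and sp: "topspace \<tau> = space M" and sM: "sets M = sets (borel_measure_of \<tau>)" and e: "\<epsilon> > 0"
  shows "\<exists>K. compactin \<tau> K \<and> measure M (space M - K) \<le> \<epsilon>"
proof -
  interpret finite_measure M by fact
  obtain S d where S: "Metric_space S d" and comp: "Metric_space.mcomplete S d"
    and \<tau>d: "\<tau> = Metric_space.mtopology S d"
    using \<tau> unfolding polish_topology_def completely_metrizable_space_def by auto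
  interpret Metric_space S d by fact
  have Ssp: "S = space M" using sp unfolding \<tau>d by simp
  obtain C where C: "countable C" "C \<subseteq> S" "mtopology closure_of C = S"
    using \<tau> unfolding polish_topology_def separable_space_def \<tau>d by auto
  show ?thesis
  proof (cases "S = {}")
    case True
    then show ?thesis using Ssp e by (intro exI[of _ "{}"]) auto
  next
    case False
    then have "C \<noteq> {}" using C by auto
    define s where "s = from_nat_into C"
    have rs: "range s = C" unfolding s_def using C \<open>C \<noteq> {}\<close> by simp
    then have sS: "s i \<in> S" for i using C by auto
    define L where "L n k = (\<Union>i\<le>k. mcball (s i) (1 / real (Suc n)))" for n k :: nat
    have Lcl: "closedin \<tau> (L n k)" for n k
      unfolding L_def \<tau>d by (intro closedin_Union) auto
    then have Lm[measurable]: "L n k \<in> sets M" for n k unfolding sM by (rule closed_in_borel_measure_of)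
    have cover: "(\<Union>k. L n k) = space M" for n
    proof -
      have "x \<in> (\<Union>k. L n k)" if "x \<in> S" for x
      proof -
        have "x \<in> mtopology closure_of C" using C that by auto
        then obtain c where "c \<in> C" "c \<in> mball x (1 / real (Suc n))"
          unfolding metric_closure_of using zero_less_one_over_Suc[of n] by blast
        then obtain i where "x \<in> mball (s i) (1 / real (Suc n))"
          using rs commute by (metis in_mball rangeE)
        then have "x \<in> mcball (s i) (1 / real (Suc n))" by auto
        then show ?thesis unfolding L_def by blast
      qed
      moreover have "L n k \<subseteq> S" for k unfolding L_def by auto
      ultimately show ?thesis using Ssp by auto
    qed
    have "\<exists>k. measure M (space M - L n k) < \<epsilon> * (1/2) ^ Suc n" for n
    proof -
      have "(\<lambda>k. measure M (L n k)) \<longlonglongrightarrow> measure M (\<Union>k. L n k)"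
        using Lm by (intro finite_Lim_measure_incseq) (auto simp: incseq_def L_def intro: order_trans)
      then have "(\<lambda>k. measure M (space M) - measure M (L n k)) \<longlonglongrightarrow> 0"
        unfolding cover by (auto intro: tendsto_eq_intros)
      then have "(\<lambda>k. measure M (space M - L n k)) \<longlonglongrightarrow> 0"
        by (simp add: finite_measure_compl)
      moreover have "0 < \<epsilon> * (1/2) ^ Suc n" using e by simp
      ultimately have "eventually (\<lambda>k. measure M (space M - L n k) < \<epsilon> * (1/2) ^ Suc n) sequentially"
        by (rule order_tendstoD)
      then show ?thesis by (rule eventually_happens'[rotated]) simp
    qed
    then obtain k where k: "\<And>n. measure M (space M - L n (k n)) < \<epsilon> * (1/2) ^ Suc n" by metis
    define K where "K = (\<Inter>n. L n (k n))"
    have Kcl: "closedin mtopology K" unfolding K_def using Lcl \<tau>d by auto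
    have KS: "K \<subseteq> S" using closedin_subset[OF Kcl] by simp
    interpret K: Submetric S d K by unfold_locales fact
    have "K.sub.mcomplete" using K.closedin_mcomplete_imp_mcomplete Kcl comp by auto
    moreover have "mtotally_bounded K"
      unfolding mtotally_bounded_sequentially
    proof (intro conjI allI impI)
      show "K \<subseteq> S" by fact
      fix \<sigma> :: "nat \<Rightarrow> 'a" assume "range \<sigma> \<subseteq> K"
      have tb: "mtotally_bounded (range \<sigma>)"
        unfolding mtotally_bounded_def
      proof (intro allI impI)
        fix e :: real assume "e > 0"
        obtain n :: nat where n: "1 / real (Suc n) < e / 2"
          using \<open>e > 0\<close> by (metis half_gt_zero nat_approx_posE of_nat_Suc)
        (* Each of the finitely many balls that meet the sequence is recentred at a point of the sequence,
           which at most doubles its radius. *)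
        define I where "I = {i. i \<le> k n \<and> range \<sigma> \<inter> mcball (s i) (1 / real (Suc n)) \<noteq> {}}"
        obtain p where p: "\<And>i. i \<in> I \<Longrightarrow> p i \<in> range \<sigma> \<inter> mcball (s i) (1 / real (Suc n))"
        proof -
          have "\<forall>i\<in>I. \<exists>q. q \<in> range \<sigma> \<inter> mcball (s i) (1 / real (Suc n))" unfolding I_def by blast
          then show ?thesis using that by (metis bchoice)
        qed
        have "y \<in> (\<Union>x\<in>p ` I. mball x e)" if y: "y \<in> range \<sigma>" for y
        proof -
          have "y \<in> L n (k n)" using y \<open>range \<sigma> \<subseteq> K\<close> unfolding K_def by auto
          then obtain i where i: "i \<le> k n" "y \<in> mcball (s i) (1 / real (Suc n))" unfolding L_def by auto
          then have "i \<in> I" unfolding I_def using y by auto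
          have "d (p i) y \<le> d (p i) (s i) + d (s i) y" using p[OF \<open>i \<in> I\<close>] i by (intro triangle) auto
          also have "\<dots> < e" using p[OF \<open>i \<in> I\<close>] i n by (auto simp: commute)
          finally show ?thesis using \<open>i \<in> I\<close> p[OF \<open>i \<in> I\<close>] i by auto
        qed
        moreover have "finite I" unfolding I_def by auto
        ultimately show "\<exists>K. finite K \<and> K \<subseteq> range \<sigma> \<and> range \<sigma> \<subseteq> (\<Union>x\<in>K. mball x e)"
          using p by (intro exI[of _ "p ` I"]) blast
      qed
      show "\<exists>r::nat \<Rightarrow> nat. strict_mono r \<and> MCauchy (\<sigma> \<circ> r)"
        using tb unfolding mtotally_bounded_sequentially by auto
    qed
    then have "K.sub.mtotally_bounded K"
      by (simp add: mtotally_bounded_absolute)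
    ultimately have "compactin mtopology K"
      using K.sub.compact_space_eq_mcomplete_mtotally_bounded KS
      by (simp add: compactin_subspace K.mtopology_submetric)
    moreover have "measure M (space M - K) \<le> \<epsilon>"
    proof -
      have "space M - K = (\<Union>n. space M - L n (k n))" unfolding K_def by auto
      moreover have "measure M (\<Union>n. space M - L n (k n)) \<le> \<epsilon>"
        by (rule measure_UN_geometric) (use k in \<open>auto intro: less_imp_le\<close>)
      ultimately show ?thesis by simp
    qed
    ultimately show ?thesis unfolding \<tau>d by auto
  qed
qed

lemma (in finite_measure) measure_cover_le:
  assumes "A \<in> sets M" "B \<in> sets M" "C \<in> sets M" "A \<subseteq> B \<union> C"
  shows "measure M A \<le> measure M B + measure M C"
proof -
  have "measure M A \<le> measure M (B \<union> C)" using assms by (intro finite_measure_mono) auto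
  also have "\<dots> \<le> measure M B + measure M C" by (rule measure_Un_le) (use assms in auto)
  finally show ?thesis .
qed

lemma (in finite_measure) measure_residual_UN_less:
  assumes K: "\<And>n::nat. K n \<in> sets M" and e: "0 < \<epsilon>"
  shows "\<exists>N. measure M ((\<Union>n. K n) - (\<Union>n\<le>N. K n)) < \<epsilon>"
proof -
  have "(\<lambda>N. measure M (\<Union>n\<le>N. K n)) \<longlonglongrightarrow> measure M (\<Union>N. \<Union>n\<le>N. K n)"
    using K by (intro finite_Lim_measure_incseq) (auto simp: incseq_def intro: order_trans)
  moreover have "(\<Union>N. \<Union>n\<le>N. K n) = (\<Union>n. K n)" by auto
  ultimately have "(\<lambda>N. measure M (\<Union>n. K n) - measure M (\<Union>n\<le>N. K n)) \<longlonglongrightarrow> 0"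
    by (auto intro: tendsto_eq_intros)
  moreover have "measure M (\<Union>n. K n) - measure M (\<Union>n\<le>N. K n) = measure M ((\<Union>n. K n) - (\<Union>n\<le>N. K n))" for N
    using K by (subst finite_measure_Diff) auto
  ultimately have "(\<lambda>N. measure M ((\<Union>n. K n) - (\<Union>n\<le>N. K n))) \<longlonglongrightarrow> 0" by simp
  then have "eventually (\<lambda>N. measure M ((\<Union>n. K n) - (\<Union>n\<le>N. K n)) < \<epsilon>) sequentially"
    using e by (rule order_tendstoD)
  then show ?thesis by (rule eventually_happens'[rotated]) simp
qed

text \<open>
  The sets that are approximable from inside by compact sets, together with their complements, form a
  sigma-algebra. It contains the open sets: these are countable unions of closed sets, and tightness cuts
  a closed set down to a compact one.
\<close>

lemma (in finite_measure) compact_inner_regular: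
  assumes \<tau>: "polish_topology \<tau>"
    and sp: "topspace \<tau> = space M" and sM: "sets M = sets (borel_measure_of \<tau>)"
    and A: "A \<in> sets M" and e: "\<epsilon> > 0"
  shows "\<exists>K. compactin \<tau> K \<and> K \<subseteq> A \<and> measure M (A - K) \<le> \<epsilon>"
proof -
  obtain S d where S: "Metric_space S d" and \<tau>d: "\<tau> = Metric_space.mtopology S d"
    using \<tau> unfolding polish_topology_def completely_metrizable_space_def by auto
  interpret Metric_space S d by fact
  have haus: "Hausdorff_space \<tau>" unfolding \<tau>d by (rule Hausdorff_space_mtopology)
  have cm: "K \<in> sets M" if "compactin \<tau> K" for K
    unfolding sM by (rule closed_in_borel_measure_of) (use compactin_imp_closedin haus that in auto)
  define inner where "inner A \<longleftrightarrow> (\<forall>\<epsilon>>0. \<exists>K. compactin \<tau> K \<and> K \<subseteq> A \<and> measure M (A - K) \<le> \<epsilon>)" for A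
  have closed: "inner F" if F: "closedin \<tau> F" for F
    unfolding inner_def
  proof (intro allI impI)
    fix \<epsilon> :: real assume "\<epsilon> > 0"
    then obtain K where K: "compactin \<tau> K" "measure M (space M - K) \<le> \<epsilon>"
      using polish_tight[OF finite_measure_axioms \<tau> sp sM] by blast
    have FM: "F \<in> sets M" unfolding sM by (rule closed_in_borel_measure_of[OF F])
    have "measure M (F - F \<inter> K) \<le> measure M (space M - K)"
      using cm[OF K(1)] sets.sets_into_space[OF FM] by (intro finite_measure_mono) auto
    then show "\<exists>K. compactin \<tau> K \<and> K \<subseteq> F \<and> measure M (F - K) \<le> \<epsilon>"
      using K F by (intro exI[of _ "F \<inter> K"]) (auto intro: closed_Int_compactin)
  qed
  have union: "inner (\<Union>n. A n)" if A: "\<And>n::nat. A n \<in> sets M" "\<And>n. inner (A n)" for A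
    unfolding inner_def
  proof (intro allI impI)
    fix \<epsilon> :: real assume e: "\<epsilon> > 0"
    have "\<exists>K. compactin \<tau> K \<and> K \<subseteq> A n \<and> measure M (A n - K) \<le> (\<epsilon>/2) * (1/2) ^ Suc n" for n
    proof -
      have "0 < (\<epsilon>/2) * (1/2) ^ Suc n" using e by simp
      then show ?thesis using A(2)[of n] unfolding inner_def by blast
    qed
    then obtain K where K: "\<And>n. compactin \<tau> (K n)" "\<And>n. K n \<subseteq> A n"
      "\<And>n. measure M (A n - K n) \<le> (\<epsilon>/2) * (1/2) ^ Suc n" by metis
    note KM = cm[OF K(1)]
    obtain N where N: "measure M ((\<Union>n. K n) - (\<Union>n\<le>N. K n)) < \<epsilon>/2"
      using measure_residual_UN_less[of K "\<epsilon>/2"] KM e by auto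
    have "measure M ((\<Union>n. A n) - (\<Union>n\<le>N. K n)) \<le> measure M (\<Union>n. A n - K n) + measure M ((\<Union>n. K n) - (\<Union>n\<le>N. K n))"
      using KM A(1) by (intro measure_cover_le) auto
    also have "measure M (\<Union>n. A n - K n) \<le> \<epsilon>/2"
      by (rule measure_UN_geometric) (use KM A K(3) in auto)
    finally have "measure M ((\<Union>n. A n) - (\<Union>n\<le>N. K n)) \<le> \<epsilon>" using N by simp
    then show "\<exists>K. compactin \<tau> K \<and> K \<subseteq> (\<Union>n. A n) \<and> measure M ((\<Union>n. A n) - K) \<le> \<epsilon>"
      using K by (intro exI[of _ "\<Union>n\<le>N. K n"]) (auto intro!: compactin_Union)
  qed
  have inter: "inner (\<Inter>n. A n)" if A: "\<And>n::nat. A n \<in> sets M" "\<And>n. inner (A n)" for A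
    unfolding inner_def
  proof (intro allI impI)
    fix \<epsilon> :: real assume e: "\<epsilon> > 0"
    have "\<exists>K. compactin \<tau> K \<and> K \<subseteq> A n \<and> measure M (A n - K) \<le> \<epsilon> * (1/2) ^ Suc n" for n
    proof -
      have "0 < \<epsilon> * (1/2) ^ Suc n" using e by simp
      then show ?thesis using A(2)[of n] unfolding inner_def by blast
    qed
    then obtain K where K: "\<And>n. compactin \<tau> (K n)" "\<And>n. K n \<subseteq> A n"
      "\<And>n. measure M (A n - K n) \<le> \<epsilon> * (1/2) ^ Suc n" by metis
    note KM = cm[OF K(1)]
    have "measure M ((\<Inter>n. A n) - (\<Inter>n. K n)) \<le> measure M (\<Union>n. A n - K n)"
      using KM A(1) by (intro finite_measure_mono) auto
    also have "\<dots> \<le> \<epsilon>"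
      by (rule measure_UN_geometric) (use KM A K(3) in auto)
    finally have "measure M ((\<Inter>n. A n) - (\<Inter>n. K n)) \<le> \<epsilon>" .
    moreover have "compactin \<tau> (\<Inter>n. K n)"
    proof -
      have cl: "closedin \<tau> (\<Inter>n. K n)" using compactin_imp_closedin haus K(1) by (intro closedin_Inter) auto
      have "(\<Inter>n. K n) = (\<Inter>n. K n) \<inter> K 0" by auto
      then show ?thesis using closed_Int_compactin[OF cl K(1)[of 0]] by simp
    qed
    ultimately show "\<exists>K. compactin \<tau> K \<and> K \<subseteq> (\<Inter>n. A n) \<and> measure M ((\<Inter>n. A n) - K) \<le> \<epsilon>"
      using INF_mono'[of K A UNIV, OF K(2)] by (intro exI[of _ "\<Inter>n. K n"]) blast
  qed
  have "inner A \<and> inner (topspace \<tau> - A)"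
    using A unfolding sM sets_borel_measure_of
  proof (induction rule: sigma_sets.induct)
    case (Basic a)
    then have a: "openin \<tau> a" by auto
    have "fsigma_in \<tau> a" using a open_imp_fsigma_in metrizable_space_mtopology \<tau>d by auto
    then obtain C :: "nat \<Rightarrow> 'a set" where C: "\<And>n. closedin \<tau> (C n)" "(\<Union>n. C n) = a"
      unfolding fsigma_in_ascending by auto
    have "inner (\<Union>n. C n)"
      by (rule union) (auto simp: sM intro: closed_in_borel_measure_of C(1) closed[OF C(1)])
    then show ?case using C(2) closed[of "topspace \<tau> - a"] a by auto
  next
    case Empty
    then show ?case using closed[of "{}"] closed[of "topspace \<tau>"] by auto
  next
    case (Compl a)
    have "a \<subseteq> topspace \<tau>" using sigma_sets_into_sp[OF _ Compl.hyps] openin_subset by fastforce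
    then show ?case using Compl.IH by (simp add: double_diff)
  next
    case (Union a)
    have aM: "a n \<in> sets M" for n using Union.hyps unfolding sM sets_borel_measure_of by auto
    have "topspace \<tau> - (\<Union>n. a n) = (\<Inter>n. topspace \<tau> - a n)" by auto
    then show ?case using Union.IH union[of a] inter[of "\<lambda>n. topspace \<tau> - a n"] aM sp by auto
  qed
  then show ?thesis using e unfolding inner_def by blast
qed

text \<open>
  A form of Blackwell's theorem modulo null sets. The map sending a point to the sequence of its memberships in the
  \<open>E n\<close> is injective. By inner regularity there is a compact \<open>K\<close> of almost full measure on which every
  \<open>E n\<close> is relatively clopen. There the map is continuous, hence a homeomorphism onto its image, and
  each compact subset of \<open>K\<close> is the preimage of a compact set of 0-1 sequences; in particular it belongs to the
  sigma-algebra generated by the \<open>E n\<close>. Compact sets exhaust all others up to null sets.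
\<close>

lemma separating_family_generates:
  assumes sb: "standard_borel M" and fin: "finite_measure M"
    and E: "\<And>n::nat. E n \<in> sets M"
    and sep: "\<And>x y. x \<in> space M \<Longrightarrow> y \<in> space M \<Longrightarrow> (\<And>n. x \<in> E n \<longleftrightarrow> y \<in> E n) \<Longrightarrow> x = y"
  shows "sets M \<subseteq> generated_mod_null M (range E)"
proof
  interpret finite_measure M by fact
  obtain \<tau> where \<tau>: "polish_topology \<tau>" and sp: "topspace \<tau> = space M"
    and sM: "sets M = sets (borel_measure_of \<tau>)"
    using sb unfolding standard_borel_def by auto
  have haus: "Hausdorff_space \<tau>"
    using \<tau> unfolding polish_topology_def
    by (simp add: completely_metrizable_imp_metrizable_space metrizable_imp_Hausdorff_space)
  have cm: "K \<in> sets M" if "compactin \<tau> K" for K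
    unfolding sM by (rule closed_in_borel_measure_of) (use compactin_imp_closedin haus that in auto)
  note reg = compact_inner_regular[OF \<tau> sp sM]
  let ?S = "sigma_sets (space M) (range E)"
  have Esub: "range E \<subseteq> Pow (space M)" using E sets.sets_into_space by blast
  interpret S: sigma_algebra "space M" ?S by (rule sigma_algebra_sigma_sets[OF Esub])
  have SM: "?S \<subseteq> sets M" by (rule sets.sigma_sets_subset) (use E in auto)
  \<comment> \<open>\<open>?S\<close> omits the null sets, so that it consists of genuine preimages of sets of 0-1 sequences.\<close>
  define D where "D n i = (if i then E n else space M - E n)" for n i
  have DM: "D n i \<in> sets M" for n i using E unfolding D_def by auto
  have DS: "D n i \<in> ?S" for n i unfolding D_def by auto
  have large: "\<exists>K. compactin \<tau> K \<and> measure M (space M - K) \<le> \<epsilon> \<and>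
      (\<forall>C. compactin \<tau> C \<longrightarrow> C \<subseteq> K \<longrightarrow> C \<in> ?S)" if e: "\<epsilon> > 0" for \<epsilon>
  proof -
    have "\<exists>K. compactin \<tau> K \<and> K \<subseteq> D n i \<and> measure M (D n i - K) \<le> (\<epsilon>/2) * (1/2) ^ Suc n" for n i
      by (rule reg[OF DM]) (use e in auto)
    then obtain k where k: "\<And>n i. compactin \<tau> (k n i)" "\<And>n i. k n i \<subseteq> D n i"
      "\<And>n i. measure M (D n i - k n i) \<le> (\<epsilon>/2) * (1/2) ^ Suc n" by metis
    note kM = cm[OF k(1)]
    define K where "K = (\<Inter>n. k n True \<union> k n False)"
    have Kcomp: "compactin \<tau> K"
    proof -
      have c: "compactin \<tau> (k n True \<union> k n False)" for n using k(1) by (intro compactin_Un) auto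
      have cl: "closedin \<tau> K" unfolding K_def using compactin_imp_closedin haus c by (intro closedin_Inter) auto
      have "K = K \<inter> (k 0 True \<union> k 0 False)" unfolding K_def by auto
      then show ?thesis using closed_Int_compactin[OF cl c[of 0]] by simp
    qed
    have m: "measure M (space M - K) \<le> \<epsilon>"
    proof -
      have "measure M (space M - K) \<le> measure M (\<Union>n. (D n True - k n True) \<union> (D n False - k n False))"
      proof (rule finite_measure_mono)
        show "space M - K \<subseteq> (\<Union>n. (D n True - k n True) \<union> (D n False - k n False))"
          unfolding K_def D_def by auto
        show "(\<Union>n. (D n True - k n True) \<union> (D n False - k n False)) \<in> sets M"
        proof -
          have "(D n True - k n True) \<union> (D n False - k n False) \<in> sets M" for n
            by (intro sets.Un sets.Diff kM DM)
          then show ?thesis by auto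
        qed
      qed
      also have "\<dots> \<le> \<epsilon>"
      proof (rule measure_UN_geometric)
        fix n
        show "(D n True - k n True) \<union> (D n False - k n False) \<in> sets M" using kM DM by auto
        have "measure M ((D n True - k n True) \<union> (D n False - k n False)) \<le>
          measure M (D n True - k n True) + measure M (D n False - k n False)"
          using kM DM by (intro measure_Un_le) auto
        also have "\<dots> \<le> (\<epsilon>/2) * (1/2) ^ Suc n + (\<epsilon>/2) * (1/2) ^ Suc n" by (intro add_mono k(3))
        finally show "measure M ((D n True - k n True) \<union> (D n False - k n False)) \<le> \<epsilon> * (1/2) ^ Suc n"
          by simp
      qed
      finally show ?thesis .
    qed
    have "C \<in> ?S" if C: "compactin \<tau> C" "C \<subseteq> K" for C
    proof -
      \<comment> \<open>\<open>N s\<close> is the cylinder of all points with initial memberships \<open>s\<close>, and \<open>L\<close> is the tree of those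
        \<open>s\<close> whose cylinder meets \<open>C\<close>. The branches of this tree are the membership sequences of points of
        \<open>C\<close>: along a branch the sets \<open>F l\<close> below are compact, nonempty and decreasing.\<close>
      define N where "N s = (\<Inter>n\<in>{..<length s}. D n (s ! n))" for s :: "bool list"
      define L where "L = {s. N s \<inter> C \<noteq> {}}"
      have Csp: "C \<subseteq> space M" using compactin_subset_topspace[OF C(1)] sp by auto
      have NS: "N s \<inter> space M \<in> ?S" for s
      proof (cases "s = []")
        case True then show ?thesis unfolding N_def by auto
      next
        case False
        then have "N s \<in> ?S" unfolding N_def using DS by (intro S.finite_INT) auto
        then show ?thesis using S.Int S.top by blast
      qed
      have "C = (\<Inter>l. (\<Union>s\<in>{s\<in>L. length s = l}. N s \<inter> space M))"
      proof (intro subset_antisym subsetI)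
        fix x assume x: "x \<in> C"
        have "x \<in> (\<Union>s\<in>{s\<in>L. length s = l}. N s \<inter> space M)" for l
        proof -
          define s where "s = map (\<lambda>n. x \<in> E n) [0..<l]"
          have "x \<in> N s" unfolding N_def s_def D_def using x Csp by auto
          moreover have "length s = l" unfolding s_def by simp
          ultimately show ?thesis using x Csp unfolding L_def by blast
        qed
        then show "x \<in> (\<Inter>l. (\<Union>s\<in>{s\<in>L. length s = l}. N s \<inter> space M))" by blast
      next
        fix x assume x: "x \<in> (\<Inter>l. (\<Union>s\<in>{s\<in>L. length s = l}. N s \<inter> space M))"
        then have xsp: "x \<in> space M" by blast
        define F where "F l = C \<inter> (\<Inter>n\<in>{..<l}. k n (x \<in> E n))" for l
        have Fne: "F l \<noteq> {}" for l
        proof -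
          obtain s where s: "s \<in> L" "length s = l" "x \<in> N s" using x by blast
          obtain c where c: "c \<in> N s" "c \<in> C" using s(1) unfolding L_def by auto
          have "c \<in> k n (x \<in> E n)" if n: "n < l" for n
          proof -
            have "c \<in> D n (s ! n)" "x \<in> D n (s ! n)" using c s n unfolding N_def by auto
            then have "(c \<in> E n) = (x \<in> E n)" unfolding D_def by (auto split: if_splits)
            moreover have "c \<in> k n True \<union> k n False" using c C unfolding K_def by auto
            ultimately show ?thesis using k(2)[of n True] k(2)[of n False] unfolding D_def
              by (cases "x \<in> E n") auto
          qed
          then show ?thesis using c unfolding F_def by auto
        qed
        have "(\<Inter>l. F l) \<noteq> {}"
        proof (rule compact_space_imp_nest[of "subtopology \<tau> C" F])
          show "compact_space (subtopology \<tau> C)" by (rule compact_space_subtopology[OF C(1)])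
          show "closedin (subtopology \<tau> C) (F l)" for l
          proof -
            have "closedin \<tau> C" using compactin_imp_closedin haus C(1) by auto
            then have "closedin \<tau> (F l)" unfolding F_def
              using compactin_imp_closedin[OF haus k(1)] by (cases "l = 0") (auto intro!: closedin_Int closedin_INT)
            then show ?thesis unfolding F_def by (auto intro: closedin_subset_topspace)
          qed
          show "F l \<noteq> {}" for l by (rule Fne)
          show "decseq F" unfolding F_def decseq_def by fastforce
        qed
        then obtain c where c: "\<And>l. c \<in> F l" by auto
        have "c \<in> C" using c[of 0] unfolding F_def by auto
        have "c \<in> E n \<longleftrightarrow> x \<in> E n" for n
        proof -
          have "c \<in> k n (x \<in> E n)" using c[of "Suc n"] unfolding F_def by auto
          then have "c \<in> D n (x \<in> E n)" using k(2) by auto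
          then show ?thesis unfolding D_def by (auto split: if_splits)
        qed
        then have "c = x" using sep[of c x] \<open>c \<in> C\<close> Csp xsp by auto
        then show "x \<in> C" using \<open>c \<in> C\<close> by simp
      qed
      also have "\<dots> \<in> ?S"
      proof -
        have "(\<Union>s\<in>{s\<in>L. length s = l}. N s \<inter> space M) \<in> ?S" for l
          by (intro S.countable_UN'' countableI_type NS)
        then show ?thesis by (intro S.countable_INT) auto
      qed
      finally show ?thesis .
    qed
    then show ?thesis using Kcomp m by blast
  qed
  fix A assume A: "A \<in> sets M"
  have "\<exists>C. C \<in> ?S \<and> C \<subseteq> A \<and> measure M (A - C) \<le> \<epsilon>" if e: "\<epsilon> > 0" for \<epsilon>
  proof -
    obtain K where K: "compactin \<tau> K" "measure M (space M - K) \<le> \<epsilon>/2"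
      "\<And>C. compactin \<tau> C \<Longrightarrow> C \<subseteq> K \<Longrightarrow> C \<in> ?S" using large[of "\<epsilon>/2"] e by auto
    obtain C where C: "compactin \<tau> C" "C \<subseteq> A" "measure M (A - C) \<le> \<epsilon>/2"
      using reg[OF A, of "\<epsilon>/2"] e by auto
    have "measure M (A - C \<inter> K) \<le> measure M (A - C) + measure M (space M - K)"
      using A cm[OF C(1)] cm[OF K(1)] sets.sets_into_space[OF A] by (intro measure_cover_le) auto
    also have "\<dots> \<le> \<epsilon>" using C(3) K(2) by simp
    finally have "measure M (A - C \<inter> K) \<le> \<epsilon>" .
    moreover have "compactin \<tau> (C \<inter> K)" using compactin_imp_closedin[OF haus C(1)] K(1) by (rule closed_Int_compactin)
    ultimately show ?thesis using K(3)[of "C \<inter> K"] C(2) by (intro exI[of _ "C \<inter> K"]) auto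
  qed
  then have "\<forall>n::nat. \<exists>C. C \<in> ?S \<and> C \<subseteq> A \<and> measure M (A - C) \<le> 1 / real (Suc n)" by simp
  then obtain C where C: "\<And>n::nat. C n \<in> ?S" "\<And>n. C n \<subseteq> A" "\<And>n. measure M (A - C n) \<le> 1 / real (Suc n)" by metis
  have CM: "C n \<in> sets M" for n using C(1) SM by auto
  have null: "A - (\<Union>n. C n) \<in> null_sets M"
  proof -
    have "measure M (A - (\<Union>n. C n)) \<le> 1 / real (Suc n)" for n
    proof -
      have "measure M (A - (\<Union>n. C n)) \<le> measure M (A - C n)" using A CM by (intro finite_measure_mono) auto
      then show ?thesis using C(3)[of n] by simp
    qed
    then have "measure M (A - (\<Union>n. C n)) \<le> 0"
      by (metis nat_approx_posE not_le of_nat_Suc order.strict_trans1 less_irrefl)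
    then have "measure M (A - (\<Union>n. C n)) = 0" using measure_nonneg by (metis antisym)
    then show ?thesis using A CM by (auto simp: null_sets_def emeasure_eq_measure)
  qed
  have sub: "range E \<union> null_sets M \<subseteq> Pow (space M)" using Esub sets.sets_into_space by blast
  interpret G: sigma_algebra "space M" "generated_mod_null M (range E)"
    unfolding generated_mod_null_def by (rule sigma_algebra_sigma_sets[OF sub])
  have "C n \<in> generated_mod_null M (range E)" for n
    using C(1)[of n] sigma_sets_mono'[of "range E" "range E \<union> null_sets M" "space M"]
    unfolding generated_mod_null_def by auto
  moreover have "A - (\<Union>n. C n) \<in> generated_mod_null M (range E)"
    unfolding generated_mod_null_def using null by auto
  ultimately have "(\<Union>n. C n) \<union> (A - (\<Union>n. C n)) \<in> generated_mod_null M (range E)"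
    by (intro G.Un G.countable_UN) auto
  moreover have "(\<Union>n. C n) \<union> (A - (\<Union>n. C n)) = A" using C(2) by auto
  ultimately show "A \<in> generated_mod_null M (range E)" by simp
qed

section \<open>Baire category and Borel sections\<close>

text \<open>
  Nowhere dense sets are represented by their closures, which keeps the sets in the covering sequence
  closed and lets the Baire category theorem apply verbatim.
\<close>

definition meager_in :: "'a topology \<Rightarrow> 'a set \<Rightarrow> bool" where
  "meager_in \<tau> S \<longleftrightarrow>
     (\<exists>F::nat \<Rightarrow> 'a set. (\<forall>n. closedin \<tau> (F n) \<and> \<tau> interior_of F n = {}) \<and> S \<subseteq> (\<Union>n. F n))"

lemma meager_in_subset: "meager_in \<tau> S \<Longrightarrow> R \<subseteq> S \<Longrightarrow> meager_in \<tau> R"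
  unfolding meager_in_def by (meson subset_trans)

lemma meager_in_nowhere_dense: "closedin \<tau> F \<Longrightarrow> \<tau> interior_of F = {} \<Longrightarrow> meager_in \<tau> F"
  unfolding meager_in_def by (intro exI[of _ "\<lambda>_. F"]) auto

lemma meager_in_empty [simp]: "meager_in \<tau> {}"
  by (rule meager_in_nowhere_dense) auto

lemma meager_in_UN:
  fixes S :: "nat \<Rightarrow> 'a set"
  assumes "\<And>n. meager_in \<tau> (S n)" shows "meager_in \<tau> (\<Union>n. S n)"
proof -
  obtain F :: "nat \<Rightarrow> nat \<Rightarrow> 'a set"
    where F: "\<And>n m. closedin \<tau> (F n m) \<and> \<tau> interior_of F n m = {}" "\<And>n. S n \<subseteq> (\<Union>m. F n m)"
    using assms unfolding meager_in_def by metis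
  have "(\<Union>n. S n) \<subseteq> (\<Union>k. case prod_decode k of (n, m) \<Rightarrow> F n m)"
  proof
    fix x assume "x \<in> (\<Union>n. S n)"
    then obtain n m where "x \<in> F n m" using F(2) by blast
    then show "x \<in> (\<Union>k. case prod_decode k of (n, m) \<Rightarrow> F n m)"
      by (intro UN_I[of "prod_encode (n, m)"]) auto
  qed
  then show ?thesis
    unfolding meager_in_def using F(1)
    by (intro exI[of _ "\<lambda>k. case prod_decode k of (n, m) \<Rightarrow> F n m"]) (auto split: prod.split)
qed

lemma meager_in_Un:
  assumes "meager_in \<tau> S" "meager_in \<tau> R" shows "meager_in \<tau> (S \<union> R)"
proof -
  have "meager_in \<tau> (\<Union>n::nat. if n = 0 then S else R)"
    by (rule meager_in_UN) (use assms in auto)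
  then show ?thesis by (rule meager_in_subset) force
qed

lemma meager_in_homeomorphic_image:
  assumes f: "homeomorphic_map \<tau> \<tau> f" and S: "meager_in \<tau> S"
  shows "meager_in \<tau> (f ` S)"
proof -
  obtain F :: "nat \<Rightarrow> 'a set" where F: "\<And>n. closedin \<tau> (F n)" "\<And>n. \<tau> interior_of F n = {}" "S \<subseteq> (\<Union>n. F n)"
    using S unfolding meager_in_def by auto
  have "closedin \<tau> (f ` F n)" for n
    using homeomorphic_map_closedness[OF f closedin_subset[OF F(1)]] F(1) by simp
  moreover have "\<tau> interior_of (f ` F n) = {}" for n
    using homeomorphic_map_interior_of[OF f closedin_subset[OF F(1)]] F(2) by simp
  moreover have "f ` S \<subseteq> (\<Union>n. f ` F n)" using image_mono[OF F(3), of f] by (simp add: image_UN)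
  ultimately show ?thesis
    unfolding meager_in_def by (intro exI[of _ "\<lambda>n. f ` F n"]) auto
qed

lemma not_meager_in_open:
  assumes "polish_topology \<tau>" "openin \<tau> V" "V \<noteq> {}" shows "\<not> meager_in \<tau> V"
proof
  assume "meager_in \<tau> V"
  then obtain F :: "nat \<Rightarrow> 'a set" where F: "\<And>n. closedin \<tau> (F n)" "\<And>n. \<tau> interior_of F n = {}" "V \<subseteq> (\<Union>n. F n)"
    unfolding meager_in_def by auto
  have "\<tau> interior_of \<Union>(range F) = {}"
    by (rule Baire_category_alt) (use assms F in \<open>auto simp: polish_topology_def\<close>)
  moreover have "V \<subseteq> \<tau> interior_of \<Union>(range F)"
    using F(3) assms(2) by (simp add: interior_of_maximal_eq)
  ultimately show False using assms(3) by auto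
qed

definition baire_property :: "'a topology \<Rightarrow> 'a set \<Rightarrow> bool" where
  "baire_property \<tau> S \<longleftrightarrow> (\<exists>W. openin \<tau> W \<and> meager_in \<tau> (sym_diff S W))"

text \<open>
  For complements: the boundary of an open set is closed and nowhere dense, so the complement of a set
  close to \<open>W\<close> is close to the exterior of \<open>W\<close>.
\<close>

lemma borel_baire_property:
  assumes "S \<in> sets (borel_measure_of \<tau>)" shows "baire_property \<tau> S"
  using assms unfolding sets_borel_measure_of
proof (induction rule: sigma_sets.induct)
  case (Basic a)
  then show ?case unfolding baire_property_def by (intro exI[of _ a]) auto
next
  case Empty
  then show ?case unfolding baire_property_def by (intro exI[of _ "{}"]) auto
next
  case (Compl a)
  then obtain W where W: "openin \<tau> W" "meager_in \<tau> (sym_diff a W)"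
    unfolding baire_property_def by auto
  have "meager_in \<tau> (\<tau> closure_of W - W)"
  proof (rule meager_in_nowhere_dense)
    show "closedin \<tau> (\<tau> closure_of W - W)" using W(1) by (simp add: closedin_diff)
    have "\<tau> interior_of (\<tau> closure_of W - W) \<inter> W = {}"
      using interior_of_subset by fastforce
    then have "\<tau> interior_of (\<tau> closure_of W - W) \<inter> \<tau> closure_of W = {}"
      using openin_Int_closure_of_eq_empty[of \<tau> "\<tau> interior_of (\<tau> closure_of W - W)" W] by simp
    then show "\<tau> interior_of (\<tau> closure_of W - W) = {}"
      using interior_of_subset[of \<tau> "\<tau> closure_of W - W"] by blast
  qed
  with W(2) have "meager_in \<tau> (sym_diff a W \<union> (\<tau> closure_of W - W))" by (rule meager_in_Un)
  then have "meager_in \<tau> (sym_diff (topspace \<tau> - a) (topspace \<tau> - \<tau> closure_of W))"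
    by (rule meager_in_subset) (use closure_of_subset[OF openin_subset[OF W(1)]] in auto)
  then show ?case unfolding baire_property_def
    by (intro exI[of _ "topspace \<tau> - \<tau> closure_of W"]) auto
next
  case (Union a)
  then obtain W where W: "\<And>i. openin \<tau> (W i)" "\<And>i. meager_in \<tau> (sym_diff (a i) (W i))"
    unfolding baire_property_def by metis
  have "meager_in \<tau> (sym_diff (\<Union>i. a i) (\<Union>i. W i))"
    by (rule meager_in_subset[OF meager_in_UN[OF W(2)]]) auto
  then show ?case unfolding baire_property_def using W(1) by (intro exI[of _ "\<Union>i. W i"]) auto
qed

text \<open>
  Localization: a set with the Baire property that is not meager is comeager in some basic open set. This
  converts a statement about non-meagerness into an existential one over a countable base.
\<close>

lemma nonmeager_comeager_in_basic:
  assumes S: "S \<in> sets (borel_measure_of \<tau>)" and V: "openin \<tau> V"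
    and base: "\<And>W x. openin \<tau> W \<Longrightarrow> x \<in> W \<Longrightarrow> \<exists>n::nat. x \<in> B n \<and> B n \<subseteq> W"
    and nm: "\<not> meager_in \<tau> (V \<inter> S)"
  shows "\<exists>n. B n \<noteq> {} \<and> B n \<subseteq> V \<and> meager_in \<tau> (B n - S)"
proof -
  obtain W where W: "openin \<tau> W" "meager_in \<tau> (sym_diff S W)"
    using borel_baire_property[OF S] unfolding baire_property_def by auto
  have "V \<inter> W \<noteq> {}"
  proof
    assume "V \<inter> W = {}"
    then have "V \<inter> S \<subseteq> sym_diff S W" by auto
    then show False using nm W(2) meager_in_subset by blast
  qed
  then obtain x where "x \<in> V \<inter> W" by auto
  then obtain n where n: "x \<in> B n" "B n \<subseteq> V \<inter> W"
    using base[of "V \<inter> W" x] V W(1) by auto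
  then have "B n - S \<subseteq> sym_diff S W" by auto
  then show ?thesis using n W(2) meager_in_subset by blast
qed

text \<open>
  Induction over the product sigma-algebra, for all open \<open>V\<close> at once. The step for complements is the
  one that needs the localization above: a section of the complement is not meager in \<open>V\<close> if and only if the
  section of the set itself is meager in some nonempty basic open subset of \<open>V\<close>.
\<close>

lemma nonmeager_sections_measurable:
  assumes \<tau>: "polish_topology \<tau>" and E: "E \<in> sets (borel_measure_of \<tau> \<Otimes>\<^sub>M N)" and V: "openin \<tau> V"
  shows "{x \<in> space N. \<not> meager_in \<tau> (V \<inter> {g. (g, x) \<in> E})} \<in> sets N"
proof -
  obtain B :: "nat \<Rightarrow> 'a set" where B: "\<And>n. openin \<tau> (B n)"
    and base: "\<And>W x. openin \<tau> W \<Longrightarrow> x \<in> W \<Longrightarrow> \<exists>n. x \<in> B n \<and> B n \<subseteq> W"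
    using polish_countable_base[OF \<tau>] by blast
  let ?P = "borel_measure_of \<tau>"
  have "\<forall>V. openin \<tau> V \<longrightarrow> {x \<in> space N. \<not> meager_in \<tau> (V \<inter> {g. (g, x) \<in> E})} \<in> sets N"
    using E unfolding sets_pair_measure
  proof (induction rule: sigma_sets.induct)
    case (Basic e)
    then obtain a b where e: "e = a \<times> b" "a \<in> sets ?P" "b \<in> sets N" by auto
    have "{x \<in> space N. \<not> meager_in \<tau> (V \<inter> {g. (g, x) \<in> e})} = (if meager_in \<tau> (V \<inter> a) then {} else b)" for V
    proof -
      have "V \<inter> {g. (g, x) \<in> e} = (if x \<in> b then V \<inter> a else {})" for x unfolding e(1) by auto
      then show ?thesis using sets.sets_into_space[OF e(3)] by auto
    qed
    then show ?case using e(3) by auto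
  next
    case Empty
    then show ?case by simp
  next
    case (Compl e)
    have eM: "e \<in> sets (?P \<Otimes>\<^sub>M N)" using Compl.hyps unfolding sets_pair_measure .
    show ?case
    proof (intro allI impI)
      fix V assume V: "openin \<tau> V"
      have *: "(\<not> meager_in \<tau> (V \<inter> {g. (g, x) \<in> space ?P \<times> space N - e})) \<longleftrightarrow>
             (\<exists>n. (B n \<noteq> {} \<and> B n \<subseteq> V) \<and> \<not> (\<not> meager_in \<tau> (B n \<inter> {g. (g, x) \<in> e})))"
        if x: "x \<in> space N" for x
      proof -
        define S where "S = {g. (g, x) \<in> space ?P \<times> space N - e}"
        have S': "S = space ?P - (\<lambda>g. (g, x)) -` e" unfolding S_def using x by auto
        have SM: "S \<in> sets ?P" unfolding S' by (intro sets.Diff sets.top sets_Pair2[OF eM])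
        have Be: "B n \<inter> {g. (g, x) \<in> e} = B n - S" for n
          unfolding S' using openin_subset[OF B, of n] by auto
        show ?thesis
        proof
          assume "\<not> meager_in \<tau> (V \<inter> {g. (g, x) \<in> space ?P \<times> space N - e})"
          then show "\<exists>n. (B n \<noteq> {} \<and> B n \<subseteq> V) \<and> \<not> (\<not> meager_in \<tau> (B n \<inter> {g. (g, x) \<in> e}))"
            using nonmeager_comeager_in_basic[OF SM V base] unfolding Be S_def[symmetric] by auto
        next
          assume "\<exists>n. (B n \<noteq> {} \<and> B n \<subseteq> V) \<and> \<not> (\<not> meager_in \<tau> (B n \<inter> {g. (g, x) \<in> e}))"
          then obtain n where n: "B n \<noteq> {}" "B n \<subseteq> V" "meager_in \<tau> (B n - S)" unfolding Be by auto
          show "\<not> meager_in \<tau> (V \<inter> {g. (g, x) \<in> space ?P \<times> space N - e})"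
            unfolding S_def[symmetric]
          proof
            assume "meager_in \<tau> (V \<inter> S)"
            then have "meager_in \<tau> ((V \<inter> S) \<union> (B n - S))" using n(3) by (rule meager_in_Un)
            then have "meager_in \<tau> (B n)" by (rule meager_in_subset) (use n in auto)
            then show False using not_meager_in_open[OF \<tau> B n(1)] by auto
          qed
        qed
      qed
      have "{x \<in> space N. \<not> meager_in \<tau> (V \<inter> {g. (g, x) \<in> space ?P \<times> space N - e})} =
        {x \<in> space N. \<exists>n. (B n \<noteq> {} \<and> B n \<subseteq> V) \<and> \<not> (\<not> meager_in \<tau> (B n \<inter> {g. (g, x) \<in> e}))}"
        by (intro Collect_cong conj_cong refl *)
      also have "\<dots> =
        (\<Union>n\<in>{n. B n \<noteq> {} \<and> B n \<subseteq> V}. space N - {x \<in> space N. \<not> meager_in \<tau> (B n \<inter> {g. (g, x) \<in> e})})"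
        by blast
      also have "\<dots> \<in> sets N" using Compl.IH B by (intro sets.countable_UN') auto
      finally show "{x \<in> space N. \<not> meager_in \<tau> (V \<inter> {g. (g, x) \<in> space ?P \<times> space N - e})} \<in> sets N" .
    qed
  next
    case (Union e)
    have "(\<not> meager_in \<tau> (V \<inter> {g. (g, x) \<in> (\<Union>i. e i)})) \<longleftrightarrow> (\<exists>i. \<not> meager_in \<tau> (V \<inter> {g. (g, x) \<in> e i}))" for V x
    proof -
      have eq: "V \<inter> {g. (g, x) \<in> (\<Union>i. e i)} = (\<Union>i. V \<inter> {g. (g, x) \<in> e i})" by auto
      show ?thesis
        unfolding eq
        by (metis (no_types, lifting) UN_upper UNIV_I meager_in_UN meager_in_subset)
    qed
    then have "{x \<in> space N. \<not> meager_in \<tau> (V \<inter> {g. (g, x) \<in> (\<Union>i. e i)})} =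
        (\<Union>i. {x \<in> space N. \<not> meager_in \<tau> (V \<inter> {g. (g, x) \<in> e i})})" for V by auto
    then show ?case using Union by auto
  qed
  then show ?thesis using V by auto
qed

section \<open>Sigma-algebras modulo null sets\<close>

lemma eq_mod_null_iff:
  "eq_mod_null M A B \<longleftrightarrow> A \<in> sets M \<and> B \<in> sets M \<and> (AE x in M. x \<in> A \<longleftrightarrow> x \<in> B)"
proof -
  have "(AE x in M. x \<in> A \<longleftrightarrow> x \<in> B) \<longleftrightarrow> sym_diff A B \<in> null_sets M" if "A \<in> sets M" "B \<in> sets M"
  proof -
    have "{x \<in> space M. \<not> (x \<in> A \<longleftrightarrow> x \<in> B)} = sym_diff A B"
      using sets.sets_into_space[OF that(1)] sets.sets_into_space[OF that(2)] by auto
    moreover have "sym_diff A B \<in> sets M" using that by auto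
    ultimately show ?thesis using AE_iff_null[of M "\<lambda>x. x \<in> A \<longleftrightarrow> x \<in> B"] by auto
  qed
  then show ?thesis unfolding eq_mod_null_def by auto
qed

lemma sigma_algebra_generated_mod_null:
  assumes "E \<subseteq> sets M" shows "sigma_algebra (space M) (generated_mod_null M E)"
  unfolding generated_mod_null_def
  by (rule sigma_algebra_sigma_sets) (use assms sets.sets_into_space in blast)

lemma generated_mod_null_subset_sets:
  assumes "E \<subseteq> sets M" shows "generated_mod_null M E \<subseteq> sets M"
  unfolding generated_mod_null_def by (rule sets.sigma_sets_subset) (use assms in auto)

lemma generated_mod_null_mono:
  assumes "E \<subseteq> generated_mod_null M F" shows "generated_mod_null M E \<subseteq> generated_mod_null M F"
  using assms unfolding generated_mod_null_def by (intro sigma_sets_mono) auto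

lemma generated_mod_null_cong:
  assumes E: "E \<subseteq> sets M" and A: "A \<in> generated_mod_null M E" and B: "B \<in> sets M"
    and eq: "AE x in M. x \<in> A \<longleftrightarrow> x \<in> B"
  shows "B \<in> generated_mod_null M E"
proof -
  interpret S: sigma_algebra "space M" "generated_mod_null M E"
    by (rule sigma_algebra_generated_mod_null[OF E])
  have AM: "A \<in> sets M" using generated_mod_null_subset_sets[OF E] A by auto
  have null: "sym_diff A B \<in> null_sets M"
    using eq AM B eq_mod_null_iff[of M A B] unfolding eq_mod_null_def by auto
  have n: "N \<in> generated_mod_null M E" if "N \<in> null_sets M" for N
    using that unfolding generated_mod_null_def by auto
  have "A - B \<in> null_sets M" "B - A \<in> null_sets M"
    using null_sets_subset[OF null] AM B by auto
  then have "(A - (A - B)) \<union> (B - A) \<in> generated_mod_null M E" using A n by auto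
  moreover have "(A - (A - B)) \<union> (B - A) = B" by auto
  ultimately show ?thesis by simp
qed


lemma sigma_sets_countable_subfamily:
  assumes "A \<in> sigma_sets \<Omega> E"
  shows "\<exists>E'\<subseteq>E. countable E' \<and> A \<in> sigma_sets \<Omega> E'"
  using assms
proof (induction rule: sigma_sets.induct)
  case (Basic a)
  then show ?case by (intro exI[of _ "{a}"]) auto
next
  case Empty
  then show ?case by (intro exI[of _ "{}"]) (auto intro: sigma_sets.Empty)
next
  case (Compl a)
  then show ?case by (blast intro: sigma_sets.Compl)
next
  case (Union a)
  then obtain E' where E': "\<And>i. E' i \<subseteq> E" "\<And>i. countable (E' i)" "\<And>i. a i \<in> sigma_sets \<Omega> (E' i)" by metis
  have "a i \<in> sigma_sets \<Omega> (\<Union>i. E' i)" for i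
    using E'(3)[of i] sigma_sets_mono'[of "E' i" "\<Union>i. E' i"] by auto
  then have "(\<Union>i. a i) \<in> sigma_sets \<Omega> (\<Union>i. E' i)" by (rule sigma_sets.Union)
  then show ?case using E' by (intro exI[of _ "\<Union>i. E' i"]) auto
qed

lemma standard_borel_countably_generated:
  assumes "standard_borel M"
  obtains B :: "nat \<Rightarrow> 'a set" where "range B \<subseteq> sets M" "sets M = sigma_sets (space M) (range B)"
proof -
  obtain \<tau> where \<tau>: "polish_topology \<tau>" "topspace \<tau> = space M" "sets M = sets (borel_measure_of \<tau>)"
    using assms unfolding standard_borel_def by auto
  obtain B :: "nat \<Rightarrow> 'a set" where B: "\<And>n. openin \<tau> (B n)"
    and base: "\<And>W x. openin \<tau> W \<Longrightarrow> x \<in> W \<Longrightarrow> \<exists>n. x \<in> B n \<and> B n \<subseteq> W"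
    using polish_countable_base[OF \<tau>(1)] by blast
  show ?thesis
    by (rule that[of B]) (use borel_measure_of_countable_base[OF B base] \<tau> B open_in_borel_measure_of in auto)
qed


section \<open>Polish groups and near-actions\<close>

lemma inv_mpt_image_sets:
  assumes S: "S \<in> inv_mpt M" and A: "A \<in> sets M" shows "S ` A \<in> sets M"
proof -
  have Asp: "A \<subseteq> space M" by (rule sets.sets_into_space[OF A])
  have b: "bij_betw S (space M) (space M)" and im: "the_inv_into (space M) S \<in> M \<rightarrow>\<^sub>M M"
    using S unfolding inv_mpt_def by auto
  have "S ` A = the_inv_into (space M) S -` A \<inter> space M"
  proof (intro subset_antisym subsetI)
    fix y assume "y \<in> S ` A"
    then show "y \<in> the_inv_into (space M) S -` A \<inter> space M"
      using Asp b bij_betw_apply[OF b] by (auto simp: the_inv_into_f_f bij_betw_imp_inj_on)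
  next
    fix y assume y: "y \<in> the_inv_into (space M) S -` A \<inter> space M"
    then have "S (the_inv_into (space M) S y) = y"
      using b by (intro f_the_inv_into_f) (auto simp: bij_betw_def)
    then show "y \<in> S ` A" using y by (metis IntD1 image_eqI vimageD)
  qed
  also have "\<dots> \<in> sets M" by (rule measurable_sets[OF im A])
  finally show ?thesis .
qed

locale polish_topological_group = group G
  for G :: "('g, 'r) monoid_scheme" (structure) +
  fixes \<tau> :: "'g topology"
  assumes polish_grp: "polish_group G \<tau>"
begin

lemma polish: "polish_topology \<tau>" and topspace_eq [simp]: "topspace \<tau> = carrier G"
  and continuous_mult: "continuous_map (prod_topology \<tau> \<tau>) \<tau> (\<lambda>(g, h). g \<otimes> h)"
  and continuous_inv: "continuous_map \<tau> \<tau> (m_inv G)"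
  using polish_grp unfolding polish_group_def by auto

lemma right_translation_continuous:
  assumes "s \<in> carrier G" shows "continuous_map \<tau> \<tau> (\<lambda>g. g \<otimes> s)"
proof -
  have "continuous_map \<tau> (prod_topology \<tau> \<tau>) (\<lambda>g. (g, s))"
    using assms by (auto simp: continuous_map_paired)
  from continuous_map_compose[OF this continuous_mult] show ?thesis by (simp add: o_def)
qed

lemma left_translation_continuous:
  assumes "s \<in> carrier G" shows "continuous_map \<tau> \<tau> (\<lambda>g. s \<otimes> g)"
proof -
  have "continuous_map \<tau> (prod_topology \<tau> \<tau>) (\<lambda>g. (s, g))"
    using assms by (auto simp: continuous_map_paired)
  from continuous_map_compose[OF this continuous_mult] show ?thesis by (simp add: o_def)
qed

lemma openin_set_mult:
  assumes V: "openin \<tau> V" and S: "S \<subseteq> carrier G" shows "openin \<tau> (V <#> S)"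
proof -
  have Vc: "V \<subseteq> carrier G" using openin_subset[OF V] by simp
  have "V <#> S = (\<Union>s\<in>S. {g \<in> topspace \<tau>. g \<otimes> inv s \<in> V})"
  proof (intro subset_antisym subsetI)
    fix g assume "g \<in> V <#> S"
    then obtain v s where vs: "v \<in> V" "s \<in> S" "g = v \<otimes> s" unfolding set_mult_def by auto
    then have "v \<in> carrier G" "s \<in> carrier G" using Vc S by auto
    then have "g \<in> carrier G" "g \<otimes> inv s = v" using vs by (auto simp: m_assoc)
    then show "g \<in> (\<Union>s\<in>S. {g \<in> topspace \<tau>. g \<otimes> inv s \<in> V})" using vs(1,2) by (intro UN_I[of s]) auto
  next
    fix g assume "g \<in> (\<Union>s\<in>S. {g \<in> topspace \<tau>. g \<otimes> inv s \<in> V})"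
    then obtain s where s: "s \<in> S" "g \<in> carrier G" "g \<otimes> inv s \<in> V" by auto
    then have "g = (g \<otimes> inv s) \<otimes> s" using S by (auto simp: m_assoc)
    then show "g \<in> V <#> S" using s unfolding set_mult_def by blast
  qed
  moreover have "openin \<tau> {g \<in> topspace \<tau>. g \<otimes> inv s \<in> V}" if "s \<in> S" for s
    using right_translation_continuous[of "inv s"] S that V by (intro openin_continuous_map_preimage) auto
  ultimately show ?thesis by auto
qed

lemma right_translation_homeomorphic:
  assumes h: "h \<in> carrier G" shows "homeomorphic_map \<tau> \<tau> (\<lambda>g. g \<otimes> h)"
  by (rule homeomorphic_maps_imp_map[of _ _ _ "\<lambda>g. g \<otimes> inv h"])
     (use right_translation_continuous h in \<open>auto simp: homeomorphic_maps_def m_assoc\<close>)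

end

locale near_action = prob_space M + polish_topological_group G \<tau>
  for M :: "'a measure" and G :: "('g, 'r) monoid_scheme" (structure) and \<tau> +
  fixes \<phi> :: "'g \<Rightarrow> ('a \<Rightarrow> 'a) set"
  assumes system: "boolean_system G \<tau> M \<phi>"
begin

definition T :: "'g \<Rightarrow> 'a \<Rightarrow> 'a" where "T g = aut_rep (\<phi> g)"

lemma T_class:
  assumes "g \<in> carrier G"
  shows "T g \<in> \<phi> g" "T g \<in> inv_mpt M" "S \<in> \<phi> g \<Longrightarrow> AE x in M. S x = T g x"
proof -
  have "\<phi> g \<in> carrier (Aut M)" using system assms unfolding boolean_system_def hom_def by auto
  then obtain R where R: "R \<in> inv_mpt M" "\<phi> g = aut_class M R" unfolding Aut_def by auto
  then have "R \<in> \<phi> g" unfolding aut_class_def by auto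
  then show T: "T g \<in> \<phi> g" unfolding T_def aut_rep_def by (rule someI[of "\<lambda>S. S \<in> \<phi> g"])
  then show "T g \<in> inv_mpt M" using R unfolding aut_class_def by auto
  assume "S \<in> \<phi> g"
  then have "AE x in M. S x = R x" "AE x in M. T g x = R x" using T R unfolding aut_class_def by auto
  then show "AE x in M. S x = T g x" by eventually_elim simp
qed

lemma T_measurable [measurable]: "g \<in> carrier G \<Longrightarrow> T g \<in> M \<rightarrow>\<^sub>M M"
  and T_bij: "g \<in> carrier G \<Longrightarrow> bij_betw (T g) (space M) (space M)"
  and T_distr: "g \<in> carrier G \<Longrightarrow> distr M M (T g) = M"
  using T_class(2) unfolding inv_mpt_def by auto

lemma T_space: "g \<in> carrier G \<Longrightarrow> x \<in> space M \<Longrightarrow> T g x \<in> space M"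
  using T_measurable measurable_space by metis

lemma AE_T: 
  assumes "g \<in> carrier G" "AE x in M. P x" shows "AE x in M. P (T g x)"
proof (rule AE_distrD[OF T_measurable[OF assms(1)]])
  show "AE x in distr M M (T g). P x" unfolding T_distr[OF assms(1)] by (rule assms(2))
qed

lemma T_mult:
  assumes g: "g \<in> carrier G" and h: "h \<in> carrier G"
  shows "AE x in M. T (g \<otimes> h) x = T g (T h x)"
proof -
  have "\<phi> (g \<otimes> h) = \<phi> g \<otimes>\<^bsub>Aut M\<^esub> \<phi> h"
    using system g h unfolding boolean_system_def hom_def by auto
  then have "T (g \<otimes> h) \<in> {R \<in> inv_mpt M. \<exists>S\<in>\<phi> g. \<exists>T\<in>\<phi> h. AE x in M. R x = S (T x)}"
    using T_class(1)[of "g \<otimes> h"] g h unfolding Aut_def by auto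
  then obtain S R where SR: "S \<in> \<phi> g" "R \<in> \<phi> h" "AE x in M. T (g \<otimes> h) x = S (R x)" by auto
  have "AE x in M. S (T h x) = T g (T h x)" using AE_T[OF h T_class(3)[OF g SR(1)]] .
  with SR(3) T_class(3)[OF h SR(2)] show ?thesis by eventually_elim simp
qed

lemma T_one: "AE x in M. T \<one> x = x"
  using T_mult[OF one_closed one_closed] AE_space
proof eventually_elim
  case (elim x)
  then have "T \<one> x = T \<one> (T \<one> x)" by simp
  then show "T \<one> x = x"
    using bij_betw_imp_inj_on[OF T_bij[OF one_closed]] T_space[OF one_closed] elim(2)
    unfolding inj_on_def by metis
qed

lemma T_inv: "g \<in> carrier G \<Longrightarrow> AE x in M. T g (T (inv g) x) = x"
proof -
  assume "g \<in> carrier G"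
  then have "AE x in M. T \<one> x = T g (T (inv g) x)" using T_mult[of g "inv g"] by simp
  with T_one show "AE x in M. T g (T (inv g) x) = x" by eventually_elim simp
qed

lemma image_T_sets [measurable]:
  assumes g: "g \<in> carrier G" and A: "A \<in> sets M" shows "aut_image (\<phi> g) A \<in> sets M"
  using inv_mpt_image_sets[OF T_class(2)[OF g] A] unfolding aut_image_def T_def .

text \<open>
  Images under representatives are only determined up to null sets; expressing them as preimages under
  the inverse element makes the homomorphism property usable pointwise.
\<close>

lemma AE_image_T:
  assumes g: "g \<in> carrier G" and A: "A \<in> sets M"
  shows "AE x in M. x \<in> aut_image (\<phi> g) A \<longleftrightarrow> T (inv g) x \<in> A"
  using T_inv[OF g] AE_space
proof eventually_elim
  case (elim x)
  have "T (inv g) x \<in> space M" using elim g T_space by auto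
  then have "T g (T (inv g) x) \<in> T g ` A \<longleftrightarrow> T (inv g) x \<in> A"
    using bij_betw_imp_inj_on[OF T_bij[OF g]] sets.sets_into_space[OF A]
    by (auto dest: inj_onD)
  then show ?case using elim unfolding aut_image_def T_def by simp
qed

lemma AE_image_mono:
  assumes g: "g \<in> carrier G" and A: "A \<in> sets M" and B: "B \<in> sets M"
    and AB: "AE x in M. x \<in> A \<longrightarrow> x \<in> B"
  shows "AE x in M. x \<in> aut_image (\<phi> g) A \<longrightarrow> x \<in> aut_image (\<phi> g) B"
  using AE_image_T[OF g A] AE_image_T[OF g B] AE_T[OF inv_closed[OF g] AB] by eventually_elim auto

text \<open>
  This is the continuity of the homomorphism into the automorphism group, read on a single set
  \<open>A\<close>.
\<close>

lemma open_neighbourhood_translates: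
  assumes g: "g \<in> carrier G" and A: "A \<in> sets M" and e: "\<epsilon> > 0"
  shows "openin \<tau> {h \<in> carrier G. measure M (sym_diff (aut_image (\<phi> g) A) (aut_image (\<phi> h) A)) < \<epsilon>}"
proof -
  let ?N = "{d \<in> carrier (Aut M). measure M (sym_diff (aut_image (\<phi> g) A) (aut_image d A)) < \<epsilon>}"
  have hom: "\<phi> h \<in> carrier (Aut M)" if "h \<in> carrier G" for h
    using system that unfolding boolean_system_def hom_def by auto
  have "openin (aut_topology M) ?N"
    unfolding aut_topology_def by (rule topology_generated_by_Basis) (use hom[OF g] A e in blast)
  then have "openin \<tau> {h \<in> topspace \<tau>. \<phi> h \<in> ?N}"
    using system unfolding boolean_system_def by (intro openin_continuous_map_preimage) auto
  moreover have "{h \<in> topspace \<tau>. \<phi> h \<in> ?N} = {h \<in> carrier G. measure M (sym_diff (aut_image (\<phi> g) A) (aut_image (\<phi> h) A)) < \<epsilon>}"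
    using hom by auto
  ultimately show ?thesis by simp
qed

abbreviation translates :: "'g set \<Rightarrow> 'a set \<Rightarrow> 'a set" where
  "translates V A \<equiv> translates_union \<tau> \<phi> V A"

lemma dense_in_carrier:
  assumes "openin \<tau> V" "\<gamma> \<in> countable_dense_subset \<tau> V" shows "\<gamma> \<in> V" "\<gamma> \<in> carrier G"
  using countable_dense_subset_of_open(2)[OF polish assms(1)] assms(2) openin_subset[OF assms(1)] by auto

lemma translates_sets [measurable]:
  assumes V: "openin \<tau> V" and A: "A \<in> sets M" shows "translates V A \<in> sets M"
  unfolding translates_union_def
  by (rule sets.countable_UN'[OF countable_dense_subset_of_open(1)[OF polish V]])
     (use dense_in_carrier[OF V] A in \<open>auto intro: image_T_sets\<close>)

text \<open>
  The union defining \<open>V A\<close> runs over a countable dense subset of \<open>V\<close> only. It nevertheless absorbs every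
  \<open>\<gamma> A\<close> with \<open>\<gamma> \<in> V\<close>, because elements \<open>h\<close> of the dense subset make \<open>\<gamma> A \<triangle> h A\<close>
  arbitrarily small.
\<close>

lemma translate_subset_translates:
  assumes V: "openin \<tau> V" and A: "A \<in> sets M" and g: "\<gamma> \<in> V"
  shows "AE x in M. x \<in> aut_image (\<phi> \<gamma>) A \<longrightarrow> x \<in> translates V A"
proof -
  have gG: "\<gamma> \<in> carrier G" using g openin_subset[OF V] by auto
  let ?R = "aut_image (\<phi> \<gamma>) A - translates V A"
  have R: "?R \<in> sets M" using image_T_sets[OF gG A] translates_sets[OF V A] by auto
  have "measure M ?R \<le> \<epsilon>" if e: "\<epsilon> > 0" for \<epsilon>
  proof -
    have "\<gamma> \<in> \<tau> closure_of countable_dense_subset \<tau> V"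
      using countable_dense_subset_of_open(3)[OF polish V] g by auto
    then obtain h where h: "h \<in> countable_dense_subset \<tau> V"
      "measure M (sym_diff (aut_image (\<phi> \<gamma>) A) (aut_image (\<phi> h) A)) < \<epsilon>"
    proof -
      let ?N = "{h \<in> carrier G. measure M (sym_diff (aut_image (\<phi> \<gamma>) A) (aut_image (\<phi> h) A)) < \<epsilon>}"
      have "\<gamma> \<in> ?N" using gG e by simp
      then obtain h where "h \<in> countable_dense_subset \<tau> V" "h \<in> ?N"
        using \<open>\<gamma> \<in> \<tau> closure_of _\<close> open_neighbourhood_translates[OF gG A e] unfolding in_closure_of by meson
      then show ?thesis using that by simp
    qed
    have "measure M ?R \<le> measure M (sym_diff (aut_image (\<phi> \<gamma>) A) (aut_image (\<phi> h) A))"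
      using image_T_sets[OF gG A] image_T_sets[OF dense_in_carrier(2)[OF V h(1)] A] h(1)
      by (intro finite_measure_mono) (auto simp: translates_union_def)
    then show ?thesis using h(2) by simp
  qed
  then have "measure M ?R = 0" using measure_nonneg[of M ?R] by (metis field_le_epsilon add_0 antisym)
  then have "?R \<in> null_sets M" using R by (auto simp: null_sets_def emeasure_eq_measure)
  then have "AE x in M. x \<notin> ?R" by (rule AE_not_in)
  then show ?thesis by eventually_elim auto
qed

lemma translates_least:
  assumes V: "openin \<tau> V" and AB: "\<And>\<gamma>. \<gamma> \<in> V \<Longrightarrow> AE x in M. x \<in> aut_image (\<phi> \<gamma>) A \<longrightarrow> x \<in> B"
  shows "AE x in M. x \<in> translates V A \<longrightarrow> x \<in> B"
proof -
  have "AE x in M. \<forall>\<gamma>\<in>countable_dense_subset \<tau> V. x \<in> aut_image (\<phi> \<gamma>) A \<longrightarrow> x \<in> B"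
    unfolding AE_ball_countable[OF countable_dense_subset_of_open(1)[OF polish V]]
    using AB dense_in_carrier(1)[OF V] by auto
  then show ?thesis by eventually_elim (auto simp: translates_union_def)
qed

lemma translates_mono:
  assumes V: "openin \<tau> V" and W: "openin \<tau> W" and VW: "V \<subseteq> W"
    and A: "A \<in> sets M" and B: "B \<in> sets M" and AB: "AE x in M. x \<in> A \<longrightarrow> x \<in> B"
  shows "AE x in M. x \<in> translates V A \<longrightarrow> x \<in> translates W B"
proof (rule translates_least[OF V])
  fix \<gamma> assume \<gamma>: "\<gamma> \<in> V"
  then have gG: "\<gamma> \<in> carrier G" using openin_subset[OF V] by auto
  show "AE x in M. x \<in> aut_image (\<phi> \<gamma>) A \<longrightarrow> x \<in> translates W B"
    using AE_image_mono[OF gG A B AB] translate_subset_translates[OF W B subsetD[OF VW \<gamma>]]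
    by eventually_elim auto
qed

lemma image_translates:
  assumes g: "g \<in> carrier G" and V: "openin \<tau> V" and W: "openin \<tau> W"
    and VW: "\<And>v. v \<in> V \<Longrightarrow> g \<otimes> v \<in> W" and A: "A \<in> sets M"
  shows "AE x in M. x \<in> aut_image (\<phi> g) (translates V A) \<longrightarrow> x \<in> translates W A"
proof -
  let ?D = "countable_dense_subset \<tau> V"
  note D = dense_in_carrier[OF V]
  note cD = countable_dense_subset_of_open(1)[OF polish V]
  have *: "AE x in M. \<forall>v\<in>?D. T (inv g) x \<in> aut_image (\<phi> v) A \<longrightarrow> x \<in> translates W A"
    unfolding AE_ball_countable[OF cD]
  proof
    fix v assume v: "v \<in> ?D"
    have vG: "v \<in> carrier G" using D[OF v] by auto
    have "AE x in M. T (inv g) x \<in> aut_image (\<phi> v) A \<longleftrightarrow> T (inv v) (T (inv g) x) \<in> A"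
      by (rule AE_T[OF inv_closed[OF g] AE_image_T[OF vG A]])
    moreover have "AE x in M. T (inv (g \<otimes> v)) x = T (inv v) (T (inv g) x)"
      using T_mult[of "inv v" "inv g"] g vG by (simp add: inv_mult_group)
    moreover have "AE x in M. x \<in> aut_image (\<phi> (g \<otimes> v)) A \<longleftrightarrow> T (inv (g \<otimes> v)) x \<in> A"
      using AE_image_T[of "g \<otimes> v"] g vG A by auto
    moreover have "AE x in M. x \<in> aut_image (\<phi> (g \<otimes> v)) A \<longrightarrow> x \<in> translates W A"
      by (rule translate_subset_translates[OF W A VW]) (use D[OF v] in auto)
    ultimately show "AE x in M. T (inv g) x \<in> aut_image (\<phi> v) A \<longrightarrow> x \<in> translates W A"
      by eventually_elim auto
  qed
  show ?thesis
    using AE_image_T[OF g translates_sets[OF V A]] *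
    by eventually_elim (auto simp: translates_union_def)
qed

lemma subset_translates:
  assumes V: "openin \<tau> V" and A: "A \<in> sets M" and one: "\<one> \<in> V"
  shows "AE x in M. x \<in> A \<longrightarrow> x \<in> translates V A"
proof -
  have "AE x in M. x \<in> aut_image (\<phi> \<one>) A \<longleftrightarrow> T \<one> x \<in> A" using AE_image_T[OF one_closed A] by simp
  with T_one translate_subset_translates[OF V A one] show ?thesis by eventually_elim auto
qed

end

section \<open>Stable sets and continuous functions\<close>

lemma Linf_iff: "f \<in> Linf M \<longleftrightarrow> f \<in> borel_measurable M \<and> (\<exists>c::real. AE x in M. \<bar>f x\<bar> \<le> c)"
proof (intro iffI conjI)
  assume f: "f \<in> Linf M"
  then show fm: "f \<in> borel_measurable M" unfolding Linf_def by auto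
  have "esssup M (\<lambda>x. ereal \<bar>f x\<bar>) < \<infinity>" using f unfolding Linf_def by auto
  then obtain c :: real where c: "esssup M (\<lambda>x. ereal \<bar>f x\<bar>) \<le> ereal c"
    by (cases "esssup M (\<lambda>x. ereal \<bar>f x\<bar>)") auto
  have "AE x in M. ereal \<bar>f x\<bar> \<le> esssup M (\<lambda>x. ereal \<bar>f x\<bar>)" by (rule esssup_AE)
  then have "AE x in M. \<bar>f x\<bar> \<le> c"
  proof eventually_elim
    case (elim x)
    then have "ereal \<bar>f x\<bar> \<le> ereal c" using c by (rule order_trans)
    then show ?case by simp
  qed
  then show "\<exists>c::real. AE x in M. \<bar>f x\<bar> \<le> c" by auto
next
  assume f: "f \<in> borel_measurable M \<and> (\<exists>c::real. AE x in M. \<bar>f x\<bar> \<le> c)"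
  then have fm[measurable]: "f \<in> borel_measurable M" by auto
  obtain c :: real where "AE x in M. \<bar>f x\<bar> \<le> c" using f by auto
  then have "esssup M (\<lambda>x. ereal \<bar>f x\<bar>) \<le> ereal c" by (intro esssup_I) auto
  then have "esssup M (\<lambda>x. ereal \<bar>f x\<bar>) < \<infinity>" by (rule order.strict_trans1) auto
  then show "f \<in> Linf M" unfolding Linf_def by auto
qed

context near_action begin

lemma AE_T_image:
  assumes g: "g \<in> carrier G" and A: "A \<in> sets M"
  shows "AE x in M. T g x \<in> aut_image (\<phi> g) A \<longleftrightarrow> x \<in> A"
  using AE_space
proof eventually_elim
  case (elim x)
  then show ?case
    using bij_betw_imp_inj_on[OF T_bij[OF g]] sets.sets_into_space[OF A]
    unfolding aut_image_def T_def by (auto dest: inj_onD)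
qed

end

locale near_action_nbhd = near_action M G \<tau> \<phi>
  for M :: "'a measure" and G :: "('g, 'r) monoid_scheme" (structure) and \<tau> \<phi> +
  fixes U :: "nat \<Rightarrow> 'g set"
  assumes nbhd: "nbhd_sequence G \<tau> U"
    and nbhd_base: "\<And>W. openin \<tau> W \<Longrightarrow> \<one> \<in> W \<Longrightarrow> \<exists>m\<ge>1. U m \<subseteq> W"
begin

lemma U_open: "m \<ge> 1 \<Longrightarrow> openin \<tau> (U m)" and U_one: "m \<ge> 1 \<Longrightarrow> \<one> \<in> U m"
  using nbhd unfolding nbhd_sequence_def by auto

lemma U_carrier: "m \<ge> 1 \<Longrightarrow> g \<in> U m \<Longrightarrow> g \<in> carrier G"
  using openin_subset[OF U_open] by auto

lemma U_mult: "m \<ge> 1 \<Longrightarrow> g \<in> U (Suc m) \<Longrightarrow> h \<in> U (Suc m) \<Longrightarrow> g \<otimes> h \<in> U m"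
  using nbhd unfolding nbhd_sequence_def set_mult_def by blast

lemma U_inv: "m \<ge> 1 \<Longrightarrow> g \<in> U m \<Longrightarrow> inv g \<in> U m"
  using nbhd unfolding nbhd_sequence_def by blast

lemma U_Suc: "m \<ge> 1 \<Longrightarrow> U (Suc m) \<subseteq> U m"
  using U_mult[of m _ \<one>] U_one[of "Suc m"] U_carrier[of "Suc m"] by fastforce

lemma U_antimono: "1 \<le> m \<Longrightarrow> m \<le> n \<Longrightarrow> U n \<subseteq> U m"
proof (induction n)
  case (Suc n)
  then show ?case using U_Suc[of n] by (cases "m = Suc n") auto
qed auto

abbreviation stab :: "'a set \<Rightarrow> 'a set" where "stab A \<equiv> stable_hull \<tau> \<phi> U A"

lemma hull_sets [measurable]: "A \<in> sets M \<Longrightarrow> stab A \<in> sets M"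
  unfolding stable_hull_def using translates_sets[OF U_open] by (intro sets.countable_INT) auto

lemma subset_hull:
  assumes A: "A \<in> sets M" shows "AE x in M. x \<in> A \<longrightarrow> x \<in> stab A"
proof -
  have "AE x in M. \<forall>m\<in>{1..}. x \<in> A \<longrightarrow> x \<in> translates (U m) A"
    unfolding AE_ball_countable[OF countableI_type] using subset_translates[OF U_open A U_one] by auto
  then show ?thesis by eventually_elim (auto simp: stable_hull_def)
qed

lemma translates_hull:
  assumes m: "m \<ge> 1" and A: "A \<in> sets M"
  shows "AE x in M. x \<in> translates (U (Suc m)) (stab A) \<longrightarrow> x \<in> translates (U m) A"
proof (rule translates_least)
  show o: "openin \<tau> (U (Suc m))" by (rule U_open) simp
  fix \<gamma> assume \<gamma>: "\<gamma> \<in> U (Suc m)"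
  have gG: "\<gamma> \<in> carrier G" using U_carrier[of "Suc m"] \<gamma> by auto
  have sub: "AE x in M. x \<in> stab A \<longrightarrow> x \<in> translates (U (Suc m)) A" 
    unfolding stable_hull_def by auto
  have *: "AE x in M. x \<in> aut_image (\<phi> \<gamma>) (translates (U (Suc m)) A) \<longrightarrow> x \<in> translates (U m) A"
    by (rule image_translates[OF gG o U_open[OF m] _ A]) (rule U_mult[OF m \<gamma>])
  from * AE_image_mono[OF gG hull_sets[OF A] translates_sets[OF o A] sub]
  show "AE x in M. x \<in> aut_image (\<phi> \<gamma>) (stab A) \<longrightarrow> x \<in> translates (U m) A"
    by eventually_elim auto
qed

text \<open>
  Applying \<open>U\<^sub>m\<^sub>+\<^sub>1\<close> to the hull of \<open>A\<close> stays inside \<open>U\<^sub>m\<^sub>+\<^sub>1 U\<^sub>m\<^sub>+\<^sub>1 A\<close>, hence inside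
  \<open>U\<^sub>m A\<close>; intersect over \<open>m\<close>.
\<close>

lemma hull_stable:
  assumes A: "A \<in> sets M" shows "stable \<tau> M \<phi> U (stab A)"
proof -
  have "AE x in M. \<forall>m\<in>{1..}. x \<in> translates (U (Suc m)) (stab A) \<longrightarrow> x \<in> translates (U m) A"
    unfolding AE_ball_countable[OF countableI_type] using translates_hull[OF _ A] by auto
  with subset_hull[OF hull_sets[OF A]] have "AE x in M. x \<in> stab (stab A) \<longleftrightarrow> x \<in> stab A"
    by eventually_elim (auto simp: stable_hull_def)
  then show ?thesis unfolding stable_def eq_mod_null_iff using A hull_sets by auto
qed

lemma stableI:
  assumes A: "A \<in> sets M" and "AE x in M. x \<in> stab A \<longrightarrow> x \<in> A" shows "stable \<tau> M \<phi> U A"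
proof -
  have "AE x in M. x \<in> stab A \<longleftrightarrow> x \<in> A" using assms(2) subset_hull[OF A] by eventually_elim auto
  then show ?thesis unfolding stable_def eq_mod_null_iff using A hull_sets by auto
qed

lemma stable_sets: "{A. stable \<tau> M \<phi> U A} \<subseteq> sets M" unfolding stable_def by auto

lemma stable_in_algebra: "stable \<tau> M \<phi> U A \<Longrightarrow> A \<in> stable_algebra \<tau> M \<phi> U"
  unfolding stable_algebra_def generated_mod_null_def by auto

text \<open>
  The \<open>U m\<close> form a decreasing neighbourhood base, so sequential continuity at the identity is
  equivalent to a uniform statement on some \<open>U m\<close>. All later arguments use this form instead of essential suprema.
\<close>

lemma G_continuous_iff:
  "G_continuous G \<tau> M \<phi> f \<longleftrightarrow> f \<in> borel_measurable M \<and> (\<exists>c::real. AE x in M. \<bar>f x\<bar> \<le> c) \<and>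
    (\<forall>\<epsilon>>0. \<exists>m\<ge>1. \<forall>g\<in>U m. AE x in M. \<bar>f (T g x) - f x\<bar> \<le> \<epsilon>)"
proof (intro iffI conjI allI impI)
  assume f: "G_continuous G \<tau> M \<phi> f"
  then have L: "f \<in> Linf M" unfolding G_continuous_def by auto
  then show "f \<in> borel_measurable M" "\<exists>c::real. AE x in M. \<bar>f x\<bar> \<le> c" using Linf_iff by auto
  fix \<epsilon> :: real assume e: "\<epsilon> > 0"
  show "\<exists>m\<ge>1. \<forall>g\<in>U m. AE x in M. \<bar>f (T g x) - f x\<bar> \<le> \<epsilon>"
  proof (rule ccontr)
    assume "\<not> ?thesis"
    then have "\<forall>n. \<exists>g\<in>U (Suc n). \<not> (AE x in M. \<bar>f (T g x) - f x\<bar> \<le> \<epsilon>)" by (metis le_add1 plus_1_eq_Suc)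
    then obtain g where g: "\<And>n. g n \<in> U (Suc n)" "\<And>n. \<not> (AE x in M. \<bar>f (T (g n) x) - f x\<bar> \<le> \<epsilon>)" by metis
    have "range g \<subseteq> carrier G" using g(1) U_carrier by fastforce
    moreover have "limitin \<tau> g \<one> sequentially"
      unfolding limitin_sequentially
    proof (intro conjI allI impI)
      show "\<one> \<in> topspace \<tau>" by simp
      fix W assume "openin \<tau> W \<and> \<one> \<in> W"
      then obtain m where m: "m \<ge> 1" "U m \<subseteq> W" using nbhd_base by auto
      have "g n \<in> W" if "n \<ge> m" for n
        using g(1)[of n] U_antimono[of m "Suc n"] m that by auto
      then show "\<exists>N. \<forall>n\<ge>N. g n \<in> W" by auto
    qed
    ultimately have "(\<lambda>n. esssup M (\<lambda>x. ereal \<bar>f (T (g n) x) - f x\<bar>)) \<longlonglongrightarrow> 0"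
      using f unfolding G_continuous_def T_def by auto
    then have "eventually (\<lambda>n. esssup M (\<lambda>x. ereal \<bar>f (T (g n) x) - f x\<bar>) < ereal \<epsilon>) sequentially"
      by (rule order_tendstoD) (use e in auto)
    then obtain n where n: "esssup M (\<lambda>x. ereal \<bar>f (T (g n) x) - f x\<bar>) < ereal \<epsilon>"
      using eventually_happens' sequentially_bot by blast
    have "AE x in M. ereal \<bar>f (T (g n) x) - f x\<bar> \<le> esssup M (\<lambda>x. ereal \<bar>f (T (g n) x) - f x\<bar>)" by (rule esssup_AE)
    then have "AE x in M. \<bar>f (T (g n) x) - f x\<bar> \<le> \<epsilon>"
    proof eventually_elim
      case (elim x)
      then have "ereal \<bar>f (T (g n) x) - f x\<bar> < ereal \<epsilon>" using n by (rule order.strict_trans1)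
      then show ?case by simp
    qed
    then show False using g(2) by auto
  qed
next
  assume f: "f \<in> borel_measurable M \<and> (\<exists>c::real. AE x in M. \<bar>f x\<bar> \<le> c) \<and>
    (\<forall>\<epsilon>>0. \<exists>m\<ge>1. \<forall>g\<in>U m. AE x in M. \<bar>f (T g x) - f x\<bar> \<le> \<epsilon>)"
  then have fm[measurable]: "f \<in> borel_measurable M" by auto
  show "G_continuous G \<tau> M \<phi> f"
    unfolding G_continuous_def T_def[symmetric]
  proof (intro conjI allI impI)
    show "f \<in> Linf M" unfolding Linf_iff using f by blast
    fix g :: "nat \<Rightarrow> 'g" assume gG: "range g \<subseteq> carrier G" and lim: "limitin \<tau> g \<one> sequentially"
    have [measurable]: "T (g n) \<in> M \<rightarrow>\<^sub>M M" for n using gG by (intro T_measurable) auto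
    show "(\<lambda>n. esssup M (\<lambda>x. ereal \<bar>f (T (g n) x) - f x\<bar>)) \<longlonglongrightarrow> 0"
    proof (rule order_tendstoI)
      fix a :: ereal assume a: "a < 0"
      have "0 \<le> esssup M (\<lambda>x. ereal \<bar>f (T (g n) x) - f x\<bar>)" for n
      proof -
        have "esssup M (\<lambda>x. 0) \<le> esssup M (\<lambda>x. ereal \<bar>f (T (g n) x) - f x\<bar>)" by (rule esssup_mono) auto
        then show ?thesis by (simp add: esssup_const emeasure_space_1)
      qed
      then show "eventually (\<lambda>n. a < esssup M (\<lambda>x. ereal \<bar>f (T (g n) x) - f x\<bar>)) sequentially"
        using a by (auto intro: always_eventually order.strict_trans2)
    next
      fix a :: ereal assume a: "0 < a"
      then obtain e where e: "0 < ereal e" "ereal e < a" using ereal_dense2 by blast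
      then obtain m where m: "m \<ge> 1" "\<And>h. h \<in> U m \<Longrightarrow> AE x in M. \<bar>f (T h x) - f x\<bar> \<le> e" using f by auto
      have "eventually (\<lambda>n. g n \<in> U m) sequentially"
        using lim U_open[OF m(1)] U_one[OF m(1)] unfolding limitin_def by auto
      then show "eventually (\<lambda>n. esssup M (\<lambda>x. ereal \<bar>f (T (g n) x) - f x\<bar>) < a) sequentially"
      proof eventually_elim
        case (elim n)
        have "esssup M (\<lambda>x. ereal \<bar>f (T (g n) x) - f x\<bar>) \<le> ereal e" using m(2)[OF elim] by (intro esssup_I) auto
        then show ?case using e(2) by (rule order.strict_trans1)
      qed
    qed
  qed
qed

lemma G_continuous_superlevel_stable:
  assumes f: "G_continuous G \<tau> M \<phi> f" shows "stable \<tau> M \<phi> U {x \<in> space M. r \<le> f x}"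
proof (rule stableI)
  let ?A = "{x \<in> space M. r \<le> f x}"
  have fm[measurable]: "f \<in> borel_measurable M" using f G_continuous_iff by auto
  show AM: "?A \<in> sets M" by measurable
  have "AE x in M. \<forall>n::nat. x \<in> stab ?A \<longrightarrow> r - 1 / real (Suc n) \<le> f x"
    unfolding AE_all_countable
  proof
    fix n :: nat
    obtain m where m: "m \<ge> 1" "\<And>g. g \<in> U m \<Longrightarrow> AE x in M. \<bar>f (T g x) - f x\<bar> \<le> 1 / real (Suc n)"
      using f[unfolded G_continuous_iff] zero_less_one_over_Suc[of n] by blast
    have "AE x in M. x \<in> translates (U m) ?A \<longrightarrow> x \<in> {x. r - 1 / real (Suc n) \<le> f x}"
    proof (rule translates_least[OF U_open[OF m(1)]])
      fix \<gamma> assume \<gamma>: "\<gamma> \<in> U m"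
      from AE_image_T[OF U_carrier[OF m(1) \<gamma>] AM] m(2)[OF U_inv[OF m(1) \<gamma>]]
      show "AE x in M. x \<in> aut_image (\<phi> \<gamma>) ?A \<longrightarrow> x \<in> {x. r - 1 / real (Suc n) \<le> f x}"
        by eventually_elim auto
    qed
    then show "AE x in M. x \<in> stab ?A \<longrightarrow> r - 1 / real (Suc n) \<le> f x"
      by eventually_elim (use m(1) in \<open>auto simp: stable_hull_def\<close>)
  qed
  then show "AE x in M. x \<in> stab ?A \<longrightarrow> x \<in> ?A"
    using AE_space
  proof eventually_elim
    case (elim x)
    have "r \<le> f x" if h: "x \<in> stab ?A"
    proof (rule field_le_epsilon)
      fix e :: real assume "e > 0"
      then obtain n :: nat where "1 / real (Suc n) < e" by (metis nat_approx_posE of_nat_Suc)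
      then show "r \<le> f x + e" using elim h by (metis add_le_cancel_left diff_le_eq less_eq_real_def order_trans)
    qed
    then show ?case using elim by auto
  qed
qed

lemma continuous_subset_stable_algebra: "continuous_algebra G \<tau> M \<phi> \<subseteq> stable_algebra \<tau> M \<phi> U"
  unfolding continuous_algebra_def stable_algebra_def
proof (rule generated_mod_null_mono, safe)
  fix f :: "'a \<Rightarrow> real" and B :: "real set"
  assume f: "G_continuous G \<tau> M \<phi> f" and B: "B \<in> sets borel"
  let ?S = "generated_mod_null M {A. stable \<tau> M \<phi> U A}"
  interpret S: sigma_algebra "space M" ?S by (rule sigma_algebra_generated_mod_null[OF stable_sets])
  let ?N = "measure_of (space M) ?S (\<lambda>_. 0)"
  have sN: "sets ?N = ?S" using S.sets_measure_of_eq by simp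
  have "f \<in> borel_measurable ?N"
    unfolding borel_measurable_iff_ge using stable_in_algebra[OF G_continuous_superlevel_stable[OF f]]
    unfolding sN by (simp add: stable_algebra_def space_measure_of_conv)
  from measurable_sets[OF this B] show "f -` B \<inter> space M \<in> ?S"
    unfolding sN by (simp add: space_measure_of_conv)
qed

end

section \<open>Chains of neighbourhoods and the distance to a set\<close>

definition dyadic_weight :: "nat list \<Rightarrow> real" where
  "dyadic_weight ms = (\<Sum>m\<leftarrow>ms. (1/2) ^ m)"

lemma dyadic_weight_simps [simp]:
  "dyadic_weight [] = 0" "dyadic_weight (m # ms) = (1/2) ^ m + dyadic_weight ms"
  "dyadic_weight (as @ bs) = dyadic_weight as + dyadic_weight bs"
  unfolding dyadic_weight_def by auto

lemma dyadic_weight_nonneg [simp]: "0 \<le> dyadic_weight ms"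
  by (induction ms) auto

text \<open>
  The letter \<open>b\<close> at which the partial weights first exceed \<open>t\<close>.
\<close>

lemma dyadic_weight_split:
  assumes "0 \<le> t" "t < dyadic_weight ms"
  shows "\<exists>as b cs. ms = as @ b # cs \<and> dyadic_weight as \<le> t \<and> t < dyadic_weight as + (1/2) ^ b"
  using assms
proof (induction ms arbitrary: t)
  case (Cons m ms)
  show ?case
  proof (cases "t < (1/2) ^ m")
    case True
    then show ?thesis using Cons.prems by (intro exI[of _ "[]"]) auto
  next
    case False
    then obtain as b cs where "ms = as @ b # cs" "dyadic_weight as \<le> t - (1/2) ^ m"
        "t - (1/2) ^ m < dyadic_weight as + (1/2) ^ b"
      using Cons.IH[of "t - (1/2) ^ m"] Cons.prems by auto
    then show ?thesis by (intro exI[of _ "m # as"] exI[of _ b] exI[of _ cs]) auto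
  qed
qed simp

context near_action_nbhd begin

text \<open>
  Taking every second \<open>U\<^sub>m\<close>, starting with \<open>U\<^sub>1\<close>, upgrades \<open>U\<^sub>m\<^sub>+\<^sub>1\<^sup>2 \<subseteq> U\<^sub>m\<close> to the inclusion
  \<open>V\<^sub>k\<^sub>+\<^sub>1\<^sup>3 \<subseteq> V\<^sub>k\<close> that the chain estimate requires.
\<close>

definition sparse :: "nat \<Rightarrow> 'g set" where "sparse k = U (Suc (2 * k))"

lemma sparse_open: "openin \<tau> (sparse k)" and sparse_one: "\<one> \<in> sparse k" and sparse_carrier: "g \<in> sparse k \<Longrightarrow> g \<in> carrier G"
  and sparse_inv: "g \<in> sparse k \<Longrightarrow> inv g \<in> sparse k"
  unfolding sparse_def using U_open[of "Suc (2 * k)"] U_one[of "Suc (2 * k)"] U_carrier[of "Suc (2 * k)" g] U_inv[of "Suc (2 * k)" g] by auto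

lemma sparse_antimono: "j \<le> k \<Longrightarrow> sparse k \<subseteq> sparse j"
  unfolding sparse_def by (rule U_antimono) auto

lemma sparse_cube:
  assumes "a \<in> sparse (Suc k)" "b \<in> sparse (Suc k)" "c \<in> sparse (Suc k)" shows "a \<otimes> (b \<otimes> c) \<in> sparse k"
proof -
  have "b \<otimes> c \<in> U (Suc (Suc (2 * k)))" "a \<in> U (Suc (Suc (2 * k)))"
    using assms U_mult[of "Suc (Suc (2 * k))" b c] U_Suc[of "Suc (Suc (2 * k))"] unfolding sparse_def by auto
  then show ?thesis using U_mult[of "Suc (2 * k)" a "b \<otimes> c"] unfolding sparse_def by auto
qed

primrec chain_nbhd :: "nat list \<Rightarrow> 'g set" where
  "chain_nbhd [] = {\<one>}"
| "chain_nbhd (m # ms) = sparse m <#> chain_nbhd ms"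

lemma chain_nbhd_carrier: "chain_nbhd ms \<subseteq> carrier G"
proof (induction ms)
  case (Cons m ms)
  then show ?case using sparse_carrier by (auto simp: set_mult_def)
qed simp

lemma chain_nbhd_open: "ms \<noteq> [] \<Longrightarrow> openin \<tau> (chain_nbhd ms)"
  using openin_set_mult[OF sparse_open chain_nbhd_carrier] by (cases ms) auto

lemma chain_nbhd_append: "g \<in> chain_nbhd (as @ bs) \<Longrightarrow> \<exists>a\<in>chain_nbhd as. \<exists>b\<in>chain_nbhd bs. g = a \<otimes> b"
proof (induction as arbitrary: g)
  case Nil
  then have "g \<in> chain_nbhd bs" "g = \<one> \<otimes> g" using chain_nbhd_carrier[of bs] by auto
  then show ?case by auto
next
  case (Cons m as)
  then obtain v h where vh: "v \<in> sparse m" "h \<in> chain_nbhd (as @ bs)" "g = v \<otimes> h" by (auto simp: set_mult_def)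
  obtain a b where ab: "a \<in> chain_nbhd as" "b \<in> chain_nbhd bs" "h = a \<otimes> b" using Cons.IH[OF vh(2)] by auto
  have "v \<otimes> a \<in> chain_nbhd (m # as)" using vh(1) ab(1) by (auto simp: set_mult_def)
  moreover have "g = (v \<otimes> a) \<otimes> b" using vh ab chain_nbhd_carrier sparse_carrier[OF vh(1)] by (auto simp: m_assoc subset_iff)
  ultimately show ?case using ab(2) by blast
qed

text \<open>
  The chain estimate of Birkhoff and Kakutani. Cut the chain at the letter \<open>b\<close> where half of the total
  weight is passed. The pieces before and after it have at most half the weight, so by induction both lie in
  \<open>V\<^sub>k\<^sub>+\<^sub>1\<close>; so does the letter itself, since its weight is less than \<open>2\<^sup>-\<^sup>k\<close>. A product of three such
  elements lies in \<open>V\<^sub>k\<close>.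
\<close>

lemma chain_nbhd_subset_sparse: "dyadic_weight ms < (1/2) ^ k \<Longrightarrow> chain_nbhd ms \<subseteq> sparse k"
proof (induction ms arbitrary: k rule: length_induct)
  case (1 ms)
  show ?case
  proof (cases ms)
    case Nil
    then show ?thesis using sparse_one by auto
  next
    case (Cons m' ms')
    define s where "s = dyadic_weight ms"
    have s: "0 < s" unfolding s_def Cons by (simp add: add_pos_nonneg)
    then have "0 \<le> s / 2" "s / 2 < dyadic_weight ms" unfolding s_def by auto
    from dyadic_weight_split[OF this] obtain as b cs where sp: "ms = as @ b # cs"
      "dyadic_weight as \<le> s / 2" "s / 2 < dyadic_weight as + (1/2) ^ b" by auto
    have sk: "s < (1/2) ^ k" unfolding s_def by (rule 1)
    have sum: "s = dyadic_weight as + (1/2) ^ b + dyadic_weight cs" unfolding s_def sp(1) by simp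
    have as: "chain_nbhd as \<subseteq> sparse (Suc k)"
      using 1(1)[rule_format, of as "Suc k"] sp sk by auto
    have cs: "chain_nbhd cs \<subseteq> sparse (Suc k)"
      using 1(1)[rule_format, of cs "Suc k"] sp sk sum by auto
    have "(1/2::real) ^ b \<le> s" using sum by (simp add: add_nonneg_nonneg)
    then have "(1/2::real) ^ b < (1/2) ^ k" using sk by (rule order.strict_trans1)
    then have "k < b" using power_decreasing[of b k "1/2::real"] by (cases "b \<le> k") auto
    then have b: "sparse b \<subseteq> sparse (Suc k)" by (intro sparse_antimono) simp
    show ?thesis
    proof
      fix g assume "g \<in> chain_nbhd ms"
      then obtain a h where "a \<in> chain_nbhd as" "h \<in> chain_nbhd (b # cs)" "g = a \<otimes> h" unfolding sp(1) using chain_nbhd_append by blast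
      moreover from this obtain v c where "v \<in> sparse b" "c \<in> chain_nbhd cs" "h = v \<otimes> c" by (auto simp: set_mult_def)
      ultimately show "g \<in> sparse k" using as b cs sparse_cube[of a k v c] by auto
    qed
  qed
qed

definition chain_term :: "'a set \<Rightarrow> nat list \<Rightarrow> 'a \<Rightarrow> real" where
  "chain_term A ms x = (if x \<in> translates (chain_nbhd ms) A then min 1 (dyadic_weight ms) else 1)"

text \<open>
  The empty chain is left out because its neighbourhood \<open>{\<one>}\<close> need not be open. The cut-off at 1 makes the
  function bounded.
\<close>

definition chain_distance :: "'a set \<Rightarrow> 'a \<Rightarrow> real" where
  "chain_distance A x = (INF ms\<in>{ms. ms \<noteq> []}. chain_term A ms x)"

lemma chain_term_bounds: "0 \<le> chain_term A ms x" "chain_term A ms x \<le> 1"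
  unfolding chain_term_def by auto

lemma chain_term_bdd: "bdd_below ((\<lambda>ms. chain_term A ms x) ` S)"
  using chain_term_bounds by (intro bdd_belowI2[of _ 0]) auto

lemma chain_distance_le: "ms \<noteq> [] \<Longrightarrow> chain_distance A x \<le> chain_term A ms x"
  unfolding chain_distance_def by (intro cINF_lower chain_term_bdd) auto

lemma chain_distance_ge: "(\<And>ms. ms \<noteq> [] \<Longrightarrow> c \<le> chain_term A ms x) \<Longrightarrow> c \<le> chain_distance A x"
  unfolding chain_distance_def by (rule cINF_greatest) auto

lemma chain_distance_bounds: "0 \<le> chain_distance A x" "chain_distance A x \<le> 1"
  using chain_distance_ge[of 0] chain_term_bounds chain_distance_le[of "[0]" A x] order_trans
  by (auto, blast)

lemma chain_distance_measurable [measurable]: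
  assumes [measurable]: "A \<in> sets M" shows "chain_distance A \<in> borel_measurable M"
proof -
  have "(\<lambda>x. INF ms\<in>{ms. ms \<noteq> []}. chain_term A ms x) \<in> borel_measurable M"
  proof (rule borel_measurable_cINF)
    fix ms :: "nat list" assume "ms \<in> {ms. ms \<noteq> []}"
    then have [measurable]: "translates (chain_nbhd ms) A \<in> sets M" using chain_nbhd_open translates_sets assms by auto
    show "chain_term A ms \<in> borel_measurable M" unfolding chain_term_def by measurable
  qed (auto intro: chain_term_bdd)
  then show ?thesis unfolding chain_distance_def .
qed

text \<open>
  Prepending the letter \<open>m\<close> to a chain that reaches \<open>x\<close> gives a chain that reaches \<open>T g x\<close>.
\<close>

lemma chain_distance_translate_le:
  assumes A: "A \<in> sets M" and g: "g \<in> sparse m"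
  shows "AE x in M. chain_distance A (T g x) \<le> chain_distance A x + (1/2) ^ m"
proof -
  have gG: "g \<in> carrier G" using sparse_carrier g by auto
  have "AE x in M. \<forall>ms\<in>{ms. ms \<noteq> []}. x \<in> translates (chain_nbhd ms) A \<longrightarrow> T g x \<in> translates (chain_nbhd (m # ms)) A"
    unfolding AE_ball_countable[OF countableI_type]
  proof
    fix ms :: "nat list" assume "ms \<in> {ms. ms \<noteq> []}"
    then have o: "openin \<tau> (chain_nbhd ms)" by (auto intro: chain_nbhd_open)
    have "AE x in M. x \<in> aut_image (\<phi> g) (translates (chain_nbhd ms) A) \<longrightarrow> x \<in> translates (chain_nbhd (m # ms)) A"
      by (rule image_translates[OF gG o chain_nbhd_open _ A]) (use g in \<open>auto simp: set_mult_def\<close>)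
    from AE_T[OF gG this] AE_T_image[OF gG translates_sets[OF o A]]
    show "AE x in M. x \<in> translates (chain_nbhd ms) A \<longrightarrow> T g x \<in> translates (chain_nbhd (m # ms)) A"
      by eventually_elim auto
  qed
  then show ?thesis
  proof eventually_elim
    case (elim x)
    have "chain_distance A (T g x) - (1/2) ^ m \<le> chain_term A ms x" if ms: "ms \<noteq> []" for ms
    proof (cases "x \<in> translates (chain_nbhd ms) A")
      case True
      then have "T g x \<in> translates (chain_nbhd (m # ms)) A" using elim ms by auto
      then have "chain_distance A (T g x) \<le> min 1 ((1/2) ^ m + dyadic_weight ms)"
        using chain_distance_le[of "m # ms" A "T g x"] unfolding chain_term_def[of A "m # ms"] by simp
      moreover have "min 1 (p + w) \<le> min 1 w + p" if "0 \<le> p" for p w :: real using that by (simp add: min_def)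
      from this[of "(1/2) ^ m" "dyadic_weight ms"]
      have "min 1 ((1/2) ^ m + dyadic_weight ms) \<le> min 1 (dyadic_weight ms) + (1/2) ^ m" by simp
      ultimately have "chain_distance A (T g x) \<le> min 1 (dyadic_weight ms) + (1/2) ^ m" by (rule order_trans)
      then show ?thesis using True unfolding chain_term_def by (simp only: if_True diff_le_eq)
    next
      case False
      then show ?thesis using chain_distance_bounds(2)[of A "T g x"] unfolding chain_term_def
        by (simp add: add_increasing2 diff_le_eq)
    qed
    then have "chain_distance A (T g x) - (1/2) ^ m \<le> chain_distance A x" by (rule chain_distance_ge)
    then show ?case by simp
  qed
qed

lemma chain_distance_G_continuous:
  assumes A: "A \<in> sets M" shows "G_continuous G \<tau> M \<phi> (chain_distance A)"
  unfolding G_continuous_iff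
proof (intro conjI allI impI)
  show "chain_distance A \<in> borel_measurable M" using A by measurable
  show "\<exists>c::real. AE x in M. \<bar>chain_distance A x\<bar> \<le> c"
    using chain_distance_bounds[of A] by (intro exI[of _ 1]) auto
  fix \<epsilon> :: real assume "\<epsilon> > 0"
  then obtain m where m: "(1/2) ^ m < \<epsilon>" using real_arch_pow_inv[of \<epsilon> "1/2"] by auto
  have "AE x in M. \<bar>chain_distance A (T g x) - chain_distance A x\<bar> \<le> \<epsilon>" if g: "g \<in> sparse m" for g
  proof -
    have gG: "g \<in> carrier G" using sparse_carrier g by auto
    have "AE x in M. T (inv g) (T g x) = x" using T_inv[of "inv g"] gG by simp
    with chain_distance_translate_le[OF A g] AE_T[OF gG chain_distance_translate_le[OF A sparse_inv[OF g]]]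
    show ?thesis
    proof eventually_elim
      case (elim x)
      then show ?case using m by (simp add: abs_le_iff)
    qed
  qed
  then show "\<exists>m\<ge>1. \<forall>g\<in>U m. AE x in M. \<bar>chain_distance A (T g x) - chain_distance A x\<bar> \<le> \<epsilon>"
    unfolding sparse_def by (intro exI[of _ "Suc (2 * m)"]) auto
qed

lemma chain_distance_zero_iff:
  assumes A: "A \<in> sets M"
  shows "AE x in M. chain_distance A x = 0 \<longleftrightarrow> x \<in> stab A"
proof -
  have 1: "AE x in M. \<forall>ms\<in>{ms. ms \<noteq> []}. \<forall>k. dyadic_weight ms < (1/2) ^ k \<longrightarrow> x \<in> translates (chain_nbhd ms) A \<longrightarrow> x \<in> translates (sparse k) A"
    unfolding AE_ball_countable[OF countableI_type] AE_all_countable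
  proof (intro ballI allI)
    fix ms k assume ms: "ms \<in> {ms::nat list. ms \<noteq> []}"
    show "AE x in M. dyadic_weight ms < (1/2) ^ k \<longrightarrow> x \<in> translates (chain_nbhd ms) A \<longrightarrow> x \<in> translates (sparse k) A"
    proof (cases "dyadic_weight ms < (1/2) ^ k")
      case True
      have "AE x in M. x \<in> translates (chain_nbhd ms) A \<longrightarrow> x \<in> translates (sparse k) A"
        using chain_nbhd_open ms by (intro translates_mono sparse_open chain_nbhd_subset_sparse True A) auto
      then show ?thesis by eventually_elim auto
    qed simp
  qed
  have 2: "AE x in M. \<forall>j\<in>{1..}. x \<in> translates (sparse j) A \<longrightarrow> x \<in> translates (U j) A"
    unfolding AE_ball_countable[OF countableI_type]
  proof
    fix j :: nat assume j: "j \<in> {1..}"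
    show "AE x in M. x \<in> translates (sparse j) A \<longrightarrow> x \<in> translates (U j) A"
    proof (rule translates_mono[OF sparse_open U_open _ A A])
      show "sparse j \<subseteq> U j" unfolding sparse_def by (rule U_antimono) (use j in auto)
    qed (use j in auto)
  qed
  from 1 2 show ?thesis
  proof eventually_elim
    case (elim x)
    show "chain_distance A x = 0 \<longleftrightarrow> x \<in> stab A"
    proof
      assume z: "chain_distance A x = 0"
      have "x \<in> translates (sparse k) A" for k
      proof -
        have "(0::real) < (1/2) ^ k" by simp
        then have "\<not> (1/2) ^ k \<le> chain_distance A x" unfolding z not_le .
        then obtain ms where ms: "ms \<noteq> []" "chain_term A ms x < (1/2) ^ k"
          using chain_distance_ge[of "(1/2) ^ k" A x] by (meson not_le)
        moreover have "(1/2::real) ^ k \<le> 1" by (simp add: power_le_one)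
        ultimately have "x \<in> translates (chain_nbhd ms) A" "dyadic_weight ms < (1/2) ^ k"
          unfolding chain_term_def by (auto split: if_splits simp: min_def)
        then show ?thesis using elim(1) ms(1) by auto
      qed
      then show "x \<in> stab A" using elim(2) unfolding stable_hull_def by auto
    next
      assume x: "x \<in> stab A"
      have "chain_distance A x \<le> (1/2) ^ m" for m
      proof -
        have "chain_nbhd [m] = sparse m" using sparse_carrier by (auto simp: set_mult_def)
        then have "x \<in> translates (chain_nbhd [m]) A" using x unfolding stable_hull_def sparse_def by auto
        then show ?thesis using chain_distance_le[of "[m]" A x] unfolding chain_term_def by simp
      qed
      then have "\<not> 0 < chain_distance A x"
        using real_arch_pow_inv[of "chain_distance A x" "1/2"] by (auto simp: not_less[symmetric])
      then show "chain_distance A x = 0" using chain_distance_bounds(1)[of A x] by simp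
    qed
  qed
qed

lemma stable_subset_continuous_algebra: "stable_algebra \<tau> M \<phi> U \<subseteq> continuous_algebra G \<tau> M \<phi>"
  unfolding stable_algebra_def continuous_algebra_def
proof (rule generated_mod_null_mono, safe)
  let ?E = "{f -` B \<inter> space M |f B. G_continuous G \<tau> M \<phi> f \<and> B \<in> sets borel}"
  fix A assume st: "stable \<tau> M \<phi> U A"
  then have A: "A \<in> sets M" unfolding stable_def by auto
  show "A \<in> generated_mod_null M ?E"
  proof (cases "A \<in> null_sets M")
    case True
    then show ?thesis unfolding generated_mod_null_def by auto
  next
    case False
    have E: "?E \<subseteq> sets M" using G_continuous_iff by (auto intro: measurable_sets)
    have "chain_distance A -` {0} \<inter> space M \<in> ?E"
    proof (intro CollectI exI conjI)
      show "G_continuous G \<tau> M \<phi> (chain_distance A)" by (rule chain_distance_G_continuous[OF A])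
      show "{0::real} \<in> sets borel" by simp
    qed simp
    then have "chain_distance A -` {0} \<inter> space M \<in> generated_mod_null M ?E"
      unfolding generated_mod_null_def by blast
    then show ?thesis
    proof (rule generated_mod_null_cong[OF E _ A])
      have "AE x in M. x \<in> stab A \<longleftrightarrow> x \<in> A" using st False unfolding stable_def eq_mod_null_iff by auto
      with chain_distance_zero_iff[OF A] AE_space
      show "AE x in M. x \<in> chain_distance A -` {0} \<inter> space M \<longleftrightarrow> x \<in> A"
        by eventually_elim auto
    qed
  qed
qed

theorem continuous_algebra_eq_stable_algebra: "continuous_algebra G \<tau> M \<phi> = stable_algebra \<tau> M \<phi> U"
  using continuous_subset_stable_algebra stable_subset_continuous_algebra by blast

end

section \<open>Spatial actions and Vaught transforms\<close>

locale spatial_system = polish_topological_group G \<tau>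
  for G :: "('g, 'r) monoid_scheme" (structure) and \<tau> +
  fixes N :: "'b measure" and a :: "'g \<Rightarrow> 'b \<Rightarrow> 'b"
  assumes spatial: "spatial_action G \<tau> N a"
begin

lemma N_prob: "prob_space N" and N_standard: "standard_borel N"
  and action_measurable: "(\<lambda>(g, x). a g x) \<in> (borel_measure_of \<tau> \<Otimes>\<^sub>M N) \<rightarrow>\<^sub>M N"
  and a_one: "y \<in> space N \<Longrightarrow> a \<one> y = y"
  and a_mult: "g \<in> carrier G \<Longrightarrow> h \<in> carrier G \<Longrightarrow> y \<in> space N \<Longrightarrow> a g (a h y) = a (g \<otimes> h) y"
  and a_distr: "g \<in> carrier G \<Longrightarrow> distr N N (a g) = N"
  using spatial unfolding spatial_action_def by auto

lemma a_measurable: assumes "g \<in> carrier G" shows "a g \<in> N \<rightarrow>\<^sub>M N"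
proof -
  have "(\<lambda>y. (g, y)) \<in> N \<rightarrow>\<^sub>M borel_measure_of \<tau> \<Otimes>\<^sub>M N" using assms by (intro measurable_Pair1') simp
  from measurable_compose[OF this action_measurable] show ?thesis by simp
qed

lemma a_space: "g \<in> carrier G \<Longrightarrow> y \<in> space N \<Longrightarrow> a g y \<in> space N"
  using a_measurable measurable_space by metis

lemma a_inv:
  assumes "g \<in> carrier G" "y \<in> space N"
  shows "a g (a (inv g) y) = y" "a (inv g) (a g y) = y"
  using assms a_mult[of g "inv g" y] a_mult[of "inv g" g y] a_one by auto

lemma a_inv_mpt:
  assumes g: "g \<in> carrier G" shows "a g \<in> inv_mpt N"
proof -
  have bij: "bij_betw (a g) (space N) (space N)"
    by (rule bij_betw_byWitness[where f' = "a (inv g)"]) (use a_inv[OF g] a_space g in auto)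
  have "the_inv_into (space N) (a g) y = a (inv g) y" if "y \<in> space N" for y
    using bij a_inv(1)[OF g that] a_space[of "inv g" y] g that
    by (metis bij_betw_imp_inj_on inv_closed the_inv_into_f_f)
  then have "the_inv_into (space N) (a g) \<in> N \<rightarrow>\<^sub>M N"
    using a_measurable[of "inv g"] g by (subst measurable_cong[where g = "a (inv g)"]) auto
  then show ?thesis using bij a_measurable[OF g] a_distr[OF g] unfolding inv_mpt_def by auto
qed

lemma AE_a:
  assumes g: "g \<in> carrier G" and P: "AE y in N. P y" shows "AE y in N. P (a g y)"
proof (rule AE_distrD[OF a_measurable[OF g]])
  show "AE y in distr N N (a g). P y" unfolding a_distr[OF g] by (rule P)
qed

lemma image_class:
  assumes g: "g \<in> carrier G" and B: "B \<in> sets N"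
  shows "aut_image (aut_class N (a g)) B \<in> sets N"
    "AE y in N. y \<in> aut_image (aut_class N (a g)) B \<longleftrightarrow> a (inv g) y \<in> B"
proof -
  define S where "S = aut_rep (aut_class N (a g))"
  have "a g \<in> aut_class N (a g)" using a_inv_mpt[OF g] unfolding aut_class_def by auto
  then have "S \<in> aut_class N (a g)"
    unfolding S_def aut_rep_def by (rule someI[of "\<lambda>S. S \<in> aut_class N (a g)"])
  then have S: "S \<in> inv_mpt N" "AE y in N. S y = a g y" unfolding aut_class_def by auto
  show "aut_image (aut_class N (a g)) B \<in> sets N"
    using inv_mpt_image_sets[OF S(1) B] unfolding aut_image_def S_def .
  have inj: "inj_on S (space N)" using S(1) unfolding inv_mpt_def by (auto simp: bij_betw_def)
  have "AE y in N. S (a (inv g) y) = a g (a (inv g) y)" using AE_a[OF inv_closed[OF g] S(2)] .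
  then show "AE y in N. y \<in> aut_image (aut_class N (a g)) B \<longleftrightarrow> a (inv g) y \<in> B"
    using AE_space
  proof eventually_elim
    case (elim y)
    have "a (inv g) y \<in> space N" using a_space g elim by auto
    then have "S (a (inv g) y) \<in> S ` B \<longleftrightarrow> a (inv g) y \<in> B"
      using inj sets.sets_into_space[OF B] by (auto dest: inj_onD)
    then show ?case using elim a_inv[OF g] unfolding aut_image_def S_def by simp
  qed
qed

end

lemma UN_if_zero: "(\<Union>n::nat. if n = 0 then X else X') = X \<union> X'"
  by (auto split: if_splits intro: exI[of _ "Suc 0"])

lemma UN_if_mem: "(\<Union>i. if i \<in> I then X i else {}) = (\<Union>i\<in>I. X i)"
  by (auto split: if_splits)

context spatial_system begin

definition vaught :: "'b set \<Rightarrow> 'g set \<Rightarrow> 'b set" where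
  "vaught B V = {x \<in> space N. \<not> meager_in \<tau> (V \<inter> {g. a g x \<in> B})}"

lemma vaught_sets:
  assumes V: "openin \<tau> V" and B: "B \<in> sets N" shows "vaught B V \<in> sets N"
proof -
  let ?P = "borel_measure_of \<tau> \<Otimes>\<^sub>M N"
  let ?E = "(\<lambda>(g, x). a g x) -` B \<inter> space ?P"
  have "?E \<in> sets ?P" by (rule measurable_sets[OF action_measurable B])
  from nonmeager_sections_measurable[OF polish this V]
  have "{x \<in> space N. \<not> meager_in \<tau> (V \<inter> {g. (g, x) \<in> ?E})} \<in> sets N" .
  moreover have "V \<inter> {g. (g, x) \<in> ?E} = V \<inter> {g. a g x \<in> B}" if "x \<in> space N" for x
    using openin_subset[OF V] that by (auto simp: space_pair_measure)
  then have "vaught B V = {x \<in> space N. \<not> meager_in \<tau> (V \<inter> {g. (g, x) \<in> ?E})}"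
    unfolding vaught_def by (intro Collect_cong conj_cong refl) simp
  ultimately show ?thesis by simp
qed

lemma vaught_mono: "V \<subseteq> W \<Longrightarrow> vaught B V \<subseteq> vaught B W"
  unfolding vaught_def by (auto intro: meager_in_subset)

lemma vaught_UN:
  fixes V :: "nat \<Rightarrow> 'g set"
  shows "vaught B (\<Union>i\<in>I. V i) = (\<Union>i\<in>I. vaught B (V i))"
proof
  show "(\<Union>i\<in>I. vaught B (V i)) \<subseteq> vaught B (\<Union>i\<in>I. V i)"
    using vaught_mono[of _ "\<Union>i\<in>I. V i" B] by blast
  show "vaught B (\<Union>i\<in>I. V i) \<subseteq> (\<Union>i\<in>I. vaught B (V i))"
  proof (rule subsetI, rule ccontr)
    fix x assume x: "x \<in> vaught B (\<Union>i\<in>I. V i)" "x \<notin> (\<Union>i\<in>I. vaught B (V i))"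
    then have xN: "x \<in> space N" unfolding vaught_def by auto
    (* the sets indexed outside I are replaced by the empty set, to obtain a sequence of meager sets *)
    define S where "S i = (if i \<in> I then V i \<inter> {g. a g x \<in> B} else {})" for i
    have "meager_in \<tau> (S i)" for i using x(2) xN unfolding S_def vaught_def by auto
    then have "meager_in \<tau> (\<Union>i. S i)" by (rule meager_in_UN)
    then have "meager_in \<tau> ((\<Union>i\<in>I. V i) \<inter> {g. a g x \<in> B})"
      by (rule meager_in_subset) (auto simp: S_def)
    then show False using x(1) unfolding vaught_def by auto
  qed
qed

text \<open>
  Right multiplication by \<open>h\<close> is a homeomorphism of the group, and it carries the set of \<open>g \<in> V\<close> with
  \<open>g (h x) \<in> B\<close> onto the set of \<open>g \<in> V h\<close> with \<open>g x \<in> B\<close>.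
\<close>

lemma vaught_translate:
  assumes h: "h \<in> carrier G" and x: "x \<in> space N" and V: "V \<subseteq> carrier G"
  shows "a h x \<in> vaught B V \<longleftrightarrow> x \<in> vaught B ((\<lambda>g. g \<otimes> h) ` V)"
proof -
  let ?S = "V \<inter> {g. a g (a h x) \<in> B}"
  have eq: "(\<lambda>g. g \<otimes> h) ` V \<inter> {g. a g x \<in> B} = (\<lambda>g. g \<otimes> h) ` ?S"
    using V a_mult[OF _ h x] by (auto simp: subset_iff)
  have eq': "?S = (\<lambda>g. g \<otimes> inv h) ` ((\<lambda>g. g \<otimes> h) ` ?S)"
  proof -
    have "(g \<otimes> h) \<otimes> inv h = g" if "g \<in> ?S" for g using that V h by (auto simp: m_assoc)
    then show ?thesis unfolding image_image by (simp cong: image_cong_simp)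
  qed
  have "meager_in \<tau> ?S \<longleftrightarrow> meager_in \<tau> ((\<lambda>g. g \<otimes> h) ` ?S)"
  proof
    assume "meager_in \<tau> ?S"
    then show "meager_in \<tau> ((\<lambda>g. g \<otimes> h) ` ?S)"
      by (rule meager_in_homeomorphic_image[OF right_translation_homeomorphic[OF h]])
  next
    assume "meager_in \<tau> ((\<lambda>g. g \<otimes> h) ` ?S)"
    from meager_in_homeomorphic_image[OF right_translation_homeomorphic[OF inv_closed[OF h]] this]
    show "meager_in \<tau> ?S" using eq' by simp
  qed
  then show ?thesis using x a_space[OF h x] by (simp add: vaught_def eq)
qed

text \<open>
  If \<open>x\<close> and \<open>y\<close> have the same transforms, then for each \<open>n\<close> the sets of all \<open>g\<close> with \<open>g x \<in> B n\<close> and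
  with \<open>g y \<in> B n\<close> differ by a meager set: both have the Baire property, and a non-meager difference would be
  comeager in some \<open>C k\<close>. Hence one \<open>g\<close> avoids all these differences, so \<open>g x\<close> and \<open>g y\<close> are in the same sets
  \<open>B n\<close>, which gives \<open>g x = g y\<close> and \<open>x = y\<close>.
\<close>

lemma vaught_separates:
  assumes B: "\<And>n::nat. B n \<in> sets N"
    and sepB: "\<And>x y. x \<in> space N \<Longrightarrow> y \<in> space N \<Longrightarrow> x \<noteq> y \<Longrightarrow> \<exists>n. x \<in> B n \<and> y \<notin> B n"
    and C: "\<And>k::nat. openin \<tau> (C k)"
    and base: "\<And>W g. openin \<tau> W \<Longrightarrow> g \<in> W \<Longrightarrow> \<exists>k. g \<in> C k \<and> C k \<subseteq> W"
    and x: "x \<in> space N" and y: "y \<in> space N"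
    and eq: "\<And>n k. x \<in> vaught (B n) (C k) \<longleftrightarrow> y \<in> vaught (B n) (C k)"
  shows "x = y"
proof -
  have sect: "{g \<in> carrier G. a g z \<in> B n} \<in> sets (borel_measure_of \<tau>)" if z: "z \<in> space N" for z n
  proof -
    have "(\<lambda>g. (g, z)) \<in> borel_measure_of \<tau> \<rightarrow>\<^sub>M borel_measure_of \<tau> \<Otimes>\<^sub>M N" using z by (rule measurable_Pair2')
    from measurable_compose[OF this action_measurable]
    have "(\<lambda>g. a g z) \<in> borel_measure_of \<tau> \<rightarrow>\<^sub>M N" by simp
    from measurable_sets[OF this B[of n]] show ?thesis by (simp add: vimage_def Int_def conj_commute)
  qed
  have diff: "meager_in \<tau> {g \<in> carrier G. a g u \<in> B n \<and> a g v \<notin> B n}"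
    if u: "u \<in> space N" and v: "v \<in> space N" and uv: "\<And>k. u \<in> vaught (B n) (C k) \<Longrightarrow> v \<in> vaught (B n) (C k)" for u v n
  proof (rule ccontr)
    let ?S = "{g \<in> carrier G. a g u \<in> B n \<and> a g v \<notin> B n}"
    assume "\<not> meager_in \<tau> ?S"
    then have nm: "\<not> meager_in \<tau> (carrier G \<inter> ?S)" by (simp add: Int_absorb1 subset_eq)
    have "?S = {g \<in> carrier G. a g u \<in> B n} - {g \<in> carrier G. a g v \<in> B n}" by auto
    then have "?S \<in> sets (borel_measure_of \<tau>)" using sect[OF u] sect[OF v] by auto
    from nonmeager_comeager_in_basic[OF this _ base nm] openin_topspace[of \<tau>]
    obtain k where k: "C k \<noteq> {}" "C k \<subseteq> carrier G" "meager_in \<tau> (C k - ?S)" by auto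
    have "\<not> meager_in \<tau> (C k \<inter> {g. a g u \<in> B n})"
    proof
      assume "meager_in \<tau> (C k \<inter> {g. a g u \<in> B n})"
      from meager_in_Un[OF this k(3)] have "meager_in \<tau> (C k)" by (rule meager_in_subset) auto
      then show False using not_meager_in_open[OF polish C k(1)] by simp
    qed
    then have "v \<in> vaught (B n) (C k)" using uv u unfolding vaught_def by auto
    moreover have "meager_in \<tau> (C k \<inter> {g. a g v \<in> B n})" by (rule meager_in_subset[OF k(3)]) auto
    ultimately show False unfolding vaught_def by auto
  qed
  let ?D = "\<lambda>n. {g \<in> carrier G. a g x \<in> B n \<and> a g y \<notin> B n} \<union> {g \<in> carrier G. a g y \<in> B n \<and> a g x \<notin> B n}"
  have "meager_in \<tau> (\<Union>n. ?D n)" by (intro meager_in_UN meager_in_Un diff x y) (use eq in auto)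
  moreover have "\<not> meager_in \<tau> (carrier G)"
    using not_meager_in_open[OF polish openin_topspace] one_closed by fastforce
  ultimately have "\<not> carrier G \<subseteq> (\<Union>n. ?D n)" using meager_in_subset by blast
  then obtain g where g: "g \<in> carrier G" "g \<notin> (\<Union>n. ?D n)" by blast
  have "a g x = a g y"
  proof (rule ccontr)
    assume "a g x \<noteq> a g y"
    then obtain n where "a g x \<in> B n" "a g y \<notin> B n" using sepB[of "a g x" "a g y"] a_space g x y by auto
    then show False using g by auto
  qed
  then show "x = y" using a_inv(2)[OF g(1)] x y by metis
qed

lemma vaught_generate:
  obtains B :: "nat \<Rightarrow> 'b set" and V :: "nat \<Rightarrow> 'g set"
  where "\<And>n. B n \<in> sets N" "\<And>n. openin \<tau> (V n)"
    "sets N \<subseteq> generated_mod_null N (range (\<lambda>n. vaught (B n) (V n)))"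
proof -
  obtain \<sigma> where \<sigma>: "polish_topology \<sigma>" "topspace \<sigma> = space N" "sets N = sets (borel_measure_of \<sigma>)"
    using N_standard unfolding standard_borel_def by auto
  obtain B :: "nat \<Rightarrow> 'b set" where B: "\<And>n. openin \<sigma> (B n)"
    and baseB: "\<And>W x. openin \<sigma> W \<Longrightarrow> x \<in> W \<Longrightarrow> \<exists>n. x \<in> B n \<and> B n \<subseteq> W"
    using polish_countable_base[OF \<sigma>(1)] by blast
  obtain C :: "nat \<Rightarrow> 'g set" where C: "\<And>k. openin \<tau> (C k)"
    and baseC: "\<And>W g. openin \<tau> W \<Longrightarrow> g \<in> W \<Longrightarrow> \<exists>k. g \<in> C k \<and> C k \<subseteq> W"
    using polish_countable_base[OF polish] by blast
  have BN: "B n \<in> sets N" for n using B open_in_borel_measure_of \<sigma>(3) by auto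
  have haus: "Hausdorff_space \<sigma>"
    using \<sigma>(1) unfolding polish_topology_def
    by (simp add: completely_metrizable_imp_metrizable_space metrizable_imp_Hausdorff_space)
  have sep: "\<exists>n. x \<in> B n \<and> y \<notin> B n" if xy: "x \<in> space N" "y \<in> space N" "x \<noteq> y" for x y
  proof -
    obtain W W' where W: "openin \<sigma> W" "openin \<sigma> W'" "x \<in> W" "y \<in> W'" "disjnt W W'"
      using haus xy \<sigma>(2) unfolding Hausdorff_space_def by metis
    then obtain n where "x \<in> B n" "B n \<subseteq> W" using baseB by blast
    then show ?thesis using W unfolding disjnt_def by blast
  qed
  let ?B = "\<lambda>n. B (fst (prod_decode n))" and ?V = "\<lambda>n. C (snd (prod_decode n))"
  have "sets N \<subseteq> generated_mod_null N (range (\<lambda>n. vaught (?B n) (?V n)))"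
  proof (rule separating_family_generates[OF N_standard])
    show "finite_measure N" using N_prob by (rule prob_space.finite_measure)
    show "vaught (?B n) (?V n) \<in> sets N" for n using vaught_sets[OF C BN] .
    fix x y assume xy: "x \<in> space N" "y \<in> space N"
      and eq: "\<And>n. x \<in> vaught (?B n) (?V n) \<longleftrightarrow> y \<in> vaught (?B n) (?V n)"
    have "x \<in> vaught (B n) (C k) \<longleftrightarrow> y \<in> vaught (B n) (C k)" for n k
      using eq[of "prod_encode (n, k)"] by simp
    then show "x = y" using vaught_separates[of B C x y] BN sep C baseC xy by blast
  qed
  then show ?thesis using BN C by (intro that[of ?B ?V]) auto
qed

end


section \<open>Spatial models force generation by stable sets\<close>

locale spatial_model_iso = near_action_nbhd M G \<tau> \<phi> U + S: spatial_system G \<tau> N a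
  for M :: "'a measure" and G :: "('g, 'r) monoid_scheme" (structure) and \<tau> \<phi> U
    and N :: "'b measure" and a :: "'g \<Rightarrow> 'b \<Rightarrow> 'b" +
  fixes \<Phi> :: "'a set \<Rightarrow> 'b set"
  assumes iso: "measure_algebra_iso M N \<Phi>"
    and equivariant: "g \<in> carrier G \<Longrightarrow> A \<in> sets M \<Longrightarrow>
      eq_mod_null N (\<Phi> (aut_image (\<phi> g) A)) (aut_image (aut_class N (a g)) (\<Phi> A))"
begin

text \<open>
  The isomorphism as a relation between sets of the two spaces, invariant under changes by null
  sets of the model. It is compatible with the set operations and with the group, which transports
  the inclusions proved in the model back to the system.
\<close>

definition represents :: "'a set \<Rightarrow> 'b set \<Rightarrow> bool" where
  "represents A B \<longleftrightarrow> A \<in> sets M \<and> B \<in> sets N \<and> (AE y in N. y \<in> \<Phi> A \<longleftrightarrow> y \<in> B)"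

lemma \<Phi>_sets: "A \<in> sets M \<Longrightarrow> \<Phi> A \<in> sets N"
  using iso unfolding measure_algebra_iso_def by auto

lemma represents_exists: "B \<in> sets N \<Longrightarrow> \<exists>A. represents A B"
  using iso unfolding measure_algebra_iso_def represents_def eq_mod_null_iff by blast

lemma represents_\<Phi>: "A \<in> sets M \<Longrightarrow> represents A (\<Phi> A)"
  unfolding represents_def using \<Phi>_sets by auto

lemma represents_compl: "represents A B \<Longrightarrow> represents (space M - A) (space N - B)"
proof -
  assume R: "represents A B"
  then have A: "A \<in> sets M" and B: "B \<in> sets N" and eq: "AE y in N. y \<in> \<Phi> A \<longleftrightarrow> y \<in> B"
    unfolding represents_def by auto
  have "AE y in N. y \<in> \<Phi> (space M - A) \<longleftrightarrow> y \<in> space N - \<Phi> A"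
    using iso A unfolding measure_algebra_iso_def eq_mod_null_iff by auto
  with eq have "AE y in N. y \<in> \<Phi> (space M - A) \<longleftrightarrow> y \<in> space N - B" by eventually_elim auto
  then show ?thesis unfolding represents_def using A B by auto
qed

lemma represents_UN:
  fixes A :: "nat \<Rightarrow> 'a set"
  assumes R: "\<And>n. represents (A n) (B n)" shows "represents (\<Union>n. A n) (\<Union>n. B n)"
proof -
  have A: "A n \<in> sets M" and B: "B n \<in> sets N" and eq: "AE y in N. y \<in> \<Phi> (A n) \<longleftrightarrow> y \<in> B n" for n
    using R unfolding represents_def by auto
  have "range A \<subseteq> sets M" using A by auto
  then have "AE y in N. y \<in> \<Phi> (\<Union>n. A n) \<longleftrightarrow> y \<in> (\<Union>n. \<Phi> (A n))"
    using iso unfolding measure_algebra_iso_def eq_mod_null_iff by auto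
  moreover have "AE y in N. \<forall>n. y \<in> \<Phi> (A n) \<longleftrightarrow> y \<in> B n" unfolding AE_all_countable using eq by auto
  ultimately have "AE y in N. y \<in> \<Phi> (\<Union>n. A n) \<longleftrightarrow> y \<in> (\<Union>n. B n)" by eventually_elim auto
  then show ?thesis unfolding represents_def using A B by auto
qed

lemma represents_null: assumes "represents A B" shows "A \<in> null_sets M \<longleftrightarrow> B \<in> null_sets N"
proof -
  have A: "A \<in> sets M" and B: "B \<in> sets N" and eq: "AE y in N. y \<in> \<Phi> A \<longleftrightarrow> y \<in> B"
    using assms unfolding represents_def by auto
  have "emeasure N B = emeasure N (\<Phi> A)"
    using eq \<Phi>_sets[OF A] B by (intro emeasure_eq_AE) auto
  also have "\<dots> = emeasure M A" using iso A unfolding measure_algebra_iso_def by auto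
  finally show ?thesis using A B unfolding null_sets_def by auto
qed

lemma represents_empty: "B \<in> null_sets N \<Longrightarrow> represents {} B"
proof -
  assume B: "B \<in> null_sets N"
  have "\<Phi> {} \<in> null_sets N" using represents_null[OF represents_\<Phi>[of "{}"]] by auto
  from AE_not_in[OF this] AE_not_in[OF B] have "AE y in N. y \<in> \<Phi> {} \<longleftrightarrow> y \<in> B" by eventually_elim auto
  then show ?thesis unfolding represents_def using B by auto
qed

lemma represents_Un: "represents A B \<Longrightarrow> represents A' B' \<Longrightarrow> represents (A \<union> A') (B \<union> B')"
proof -
  assume R: "represents A B" "represents A' B'"
  have "represents (\<Union>n::nat. if n = 0 then A else A') (\<Union>n::nat. if n = 0 then B else B')"
    by (rule represents_UN) (use R in auto)
  then show ?thesis by (simp only: UN_if_zero)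
qed

lemma represents_Diff: "represents A B \<Longrightarrow> represents A' B' \<Longrightarrow> represents (A - A') (B - B')"
proof -
  assume R: "represents A B" "represents A' B'"
  have "A \<in> sets M" "A' \<in> sets M" "B \<in> sets N" "B' \<in> sets N" using R unfolding represents_def by auto
  then have "A - A' = space M - ((space M - A) \<union> A')" "B - B' = space N - ((space N - B) \<union> B')"
    using sets.sets_into_space[of A M] sets.sets_into_space[of B N] by auto
  then show ?thesis using represents_compl[OF represents_Un[OF represents_compl[OF R(1)] R(2)]] by simp
qed

lemma represents_mono:
  assumes R: "represents A B" "represents A' B'" and BB': "AE y in N. y \<in> B \<longrightarrow> y \<in> B'"
  shows "AE x in M. x \<in> A \<longrightarrow> x \<in> A'"
proof -
  have "B \<in> sets N" "B' \<in> sets N" using R unfolding represents_def by auto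
  moreover have "AE y in N. y \<notin> B - B'" using BB' by eventually_elim auto
  ultimately have "B - B' \<in> null_sets N" by (subst (asm) AE_iff_null_sets[symmetric]) auto
  then have "A - A' \<in> null_sets M" using represents_null[OF represents_Diff[OF R]] by simp
  from AE_not_in[OF this] show ?thesis by eventually_elim auto
qed

lemma represents_image:
  assumes R: "represents A B" and g: "g \<in> carrier G"
  shows "represents (aut_image (\<phi> g) A) {y \<in> space N. a (inv g) y \<in> B}"
proof -
  have A: "A \<in> sets M" and B: "B \<in> sets N" and eq: "AE y in N. y \<in> \<Phi> A \<longleftrightarrow> y \<in> B"
    using R unfolding represents_def by auto
  have "AE y in N. y \<in> \<Phi> (aut_image (\<phi> g) A) \<longleftrightarrow> y \<in> aut_image (aut_class N (a g)) (\<Phi> A)"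
    using equivariant[OF g A] unfolding eq_mod_null_iff by auto
  with S.image_class(2)[OF g \<Phi>_sets[OF A]] S.AE_a[OF inv_closed[OF g] eq] AE_space
  have "AE y in N. y \<in> \<Phi> (aut_image (\<phi> g) A) \<longleftrightarrow> y \<in> {y \<in> space N. a (inv g) y \<in> B}"
    by eventually_elim auto
  moreover have "{y \<in> space N. a (inv g) y \<in> B} \<in> sets N"
    using measurable_sets[OF S.a_measurable[OF inv_closed[OF g]] B] by (simp add: vimage_def Int_def conj_commute)
  ultimately show ?thesis unfolding represents_def using image_T_sets[OF g A] by auto
qed

text \<open>
  A translate by \<open>\<gamma> \<in> U m\<close> of the transform for \<open>V\<close> is the transform for \<open>V \<gamma>\<^sup>-\<^sup>1\<close>, which is contained in the one for
  \<open>V'\<close>.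
\<close>

lemma stab_vaught:
  assumes A: "represents A (S.vaught B V)" and A': "represents A' (S.vaught B V')"
    and V: "openin \<tau> V" and V': "V \<subseteq> V'" and m: "m \<ge> 1" and VU: "V <#> U m \<subseteq> V'"
  shows "AE x in M. x \<in> stab A \<longrightarrow> x \<in> A'"
proof -
  have "AE x in M. x \<in> translates (U m) A \<longrightarrow> x \<in> A'"
  proof (rule translates_least[OF U_open[OF m]])
    fix \<gamma> assume \<gamma>: "\<gamma> \<in> U m"
    have gG: "\<gamma> \<in> carrier G" using U_carrier[OF m \<gamma>] .
    have Vc: "V \<subseteq> carrier G" using openin_subset[OF V] by simp
    have sub: "(\<lambda>g. g \<otimes> inv \<gamma>) ` V \<subseteq> V'"
      using U_inv[OF m \<gamma>] VU unfolding set_mult_def by auto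
    have "{y \<in> space N. a (inv \<gamma>) y \<in> S.vaught B V} \<subseteq> S.vaught B V'"
      using S.vaught_translate[OF inv_closed[OF gG] _ Vc, of _ B] S.vaught_mono[OF sub, of B] by auto
    then have "AE y in N. y \<in> {y \<in> space N. a (inv \<gamma>) y \<in> S.vaught B V} \<longrightarrow> y \<in> S.vaught B V'"
      by (intro always_eventually) blast
    then show "AE x in M. x \<in> aut_image (\<phi> \<gamma>) A \<longrightarrow> x \<in> A'"
      by (rule represents_mono[OF represents_image[OF A gG] A'])
  qed
  then show ?thesis by eventually_elim (use m in \<open>auto simp: stable_hull_def\<close>)
qed

lemma stable_algebra_sigma: "sigma_algebra (space M) (stable_algebra \<tau> M \<phi> U)"
  unfolding stable_algebra_def by (rule sigma_algebra_generated_mod_null[OF stable_sets])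

lemma stable_algebra_sets: "stable_algebra \<tau> M \<phi> U \<subseteq> sets M"
  unfolding stable_algebra_def by (rule generated_mod_null_subset_sets[OF stable_sets])

lemma stable_algebra_cong:
  "A \<in> stable_algebra \<tau> M \<phi> U \<Longrightarrow> B \<in> sets M \<Longrightarrow> AE x in M. x \<in> A \<longleftrightarrow> x \<in> B \<Longrightarrow> B \<in> stable_algebra \<tau> M \<phi> U"
  unfolding stable_algebra_def by (rule generated_mod_null_cong[OF stable_sets])

text \<open>
  Cover \<open>V\<close> by basic open sets \<open>C i\<close> with \<open>C i U m \<subseteq> V\<close> for some \<open>m\<close>. The transform for \<open>V\<close> is the union of the
  transforms for these \<open>C i\<close>, and the hull of each of them lies between it and the transform for \<open>V\<close>.
\<close>

lemma vaught_in_stable_algebra: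
  assumes V: "openin \<tau> V" and B: "B \<in> sets N" and A: "represents A (S.vaught B V)"
  shows "A \<in> stable_algebra \<tau> M \<phi> U"
proof -
  interpret SA: sigma_algebra "space M" "stable_algebra \<tau> M \<phi> U" by (rule stable_algebra_sigma)
  obtain C :: "nat \<Rightarrow> 'g set" where C: "\<And>k. openin \<tau> (C k)"
    and baseC: "\<And>W g. openin \<tau> W \<Longrightarrow> g \<in> W \<Longrightarrow> \<exists>k. g \<in> C k \<and> C k \<subseteq> W"
    using polish_countable_base[OF polish] by blast
  define I where "I = {i. C i \<subseteq> V \<and> (\<exists>m\<ge>1. C i <#> U m \<subseteq> V)}"
  have "V \<subseteq> (\<Union>i\<in>I. C i)"
  proof
    fix g assume g: "g \<in> V"
    then have gG: "g \<in> carrier G" using openin_subset[OF V] by auto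
    define Z where "Z = {p \<in> topspace (prod_topology \<tau> \<tau>). (\<lambda>(g, h). g \<otimes> h) p \<in> V}"
    have "openin (prod_topology \<tau> \<tau>) Z"
      unfolding Z_def using continuous_mult V by (rule openin_continuous_map_preimage)
    moreover have "(g, \<one>) \<in> Z" unfolding Z_def using g gG by simp
    ultimately obtain W W' where W: "openin \<tau> W" "openin \<tau> W'" "g \<in> W" "\<one> \<in> W'" "W \<times> W' \<subseteq> Z"
      unfolding openin_prod_topology_alt by metis
    obtain m where m: "m \<ge> 1" "U m \<subseteq> W'" using nbhd_base[OF W(2,4)] by auto
    obtain i where i: "g \<in> C i" "C i \<subseteq> W \<inter> V" using baseC[of "W \<inter> V" g] W g V by auto
    have "C i <#> U m \<subseteq> V"
    proof
      fix k assume "k \<in> C i <#> U m"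
      then obtain c u where "c \<in> C i" "u \<in> U m" "k = c \<otimes> u" by (auto simp: set_mult_def)
      then have "(c, u) \<in> W \<times> W'" using i m by auto
      then show "k \<in> V" using W(5) \<open>k = c \<otimes> u\<close> unfolding Z_def by auto
    qed
    then have "i \<in> I" unfolding I_def using m i by auto
    then show "g \<in> (\<Union>i\<in>I. C i)" using i by auto
  qed
  then have VI: "V = (\<Union>i\<in>I. C i)" unfolding I_def by auto
  obtain D where D: "\<And>i. represents (D i) (S.vaught B (C i))"
    using represents_exists[OF S.vaught_sets[OF C B]] by metis
  have DM: "D i \<in> sets M" for i using D unfolding represents_def by auto
  have 1: "AE x in M. x \<in> A \<longleftrightarrow> x \<in> (\<Union>i\<in>I. D i)"
  proof -
    have "represents (\<Union>i. if i \<in> I then D i else {}) (\<Union>i. if i \<in> I then S.vaught B (C i) else {})"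
      by (rule represents_UN) (use D represents_empty[of "{}"] in auto)
    then have R: "represents (\<Union>i\<in>I. D i) (S.vaught B V)"
      by (subst VI) (simp only: S.vaught_UN UN_if_mem)
    have "AE x in M. x \<in> A \<longrightarrow> x \<in> (\<Union>i\<in>I. D i)" "AE x in M. x \<in> (\<Union>i\<in>I. D i) \<longrightarrow> x \<in> A"
      using represents_mono[OF A R] represents_mono[OF R A] by auto
    then show ?thesis by eventually_elim blast
  qed
  have "AE x in M. \<forall>i\<in>I. (x \<in> stab (D i) \<longrightarrow> x \<in> A) \<and> (x \<in> D i \<longrightarrow> x \<in> stab (D i))"
    unfolding AE_ball_countable[OF countableI_type]
  proof
    fix i assume "i \<in> I"
    then obtain m where "m \<ge> 1" "C i <#> U m \<subseteq> V" "C i \<subseteq> V" unfolding I_def by auto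
    from stab_vaught[OF D[of i] A C this(3) this(1,2)] subset_hull[OF DM[of i]]
    show "AE x in M. (x \<in> stab (D i) \<longrightarrow> x \<in> A) \<and> (x \<in> D i \<longrightarrow> x \<in> stab (D i))" by eventually_elim auto
  qed
  with 1 have eq: "AE x in M. x \<in> (\<Union>i\<in>I. stab (D i)) \<longleftrightarrow> x \<in> A" by eventually_elim auto
  have "(\<Union>i\<in>I. stab (D i)) \<in> stable_algebra \<tau> M \<phi> U"
    using stable_in_algebra[OF hull_stable[OF DM]] by (intro SA.countable_UN'' countableI_type) auto
  moreover have "A \<in> sets M" using A unfolding represents_def by simp
  ultimately show ?thesis using eq by (rule stable_algebra_cong)
qed

lemma spatial_model_imp_stable_generation: "sets M = stable_algebra \<tau> M \<phi> U"
proof (intro subset_antisym stable_algebra_sets subsetI)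
  fix A assume A: "A \<in> sets M"
  interpret SA: sigma_algebra "space M" "stable_algebra \<tau> M \<phi> U" by (rule stable_algebra_sigma)
  obtain B :: "nat \<Rightarrow> 'b set" and V where BV: "\<And>n. B n \<in> sets N" "\<And>n. openin \<tau> (V n)"
    "sets N \<subseteq> generated_mod_null N (range (\<lambda>n. S.vaught (B n) (V n)))"
    using S.vaught_generate by blast
  have "\<exists>A\<in>stable_algebra \<tau> M \<phi> U. represents A D"
    if "D \<in> sigma_sets (space N) (range (\<lambda>n. S.vaught (B n) (V n)) \<union> null_sets N)" for D
    using that
  proof (induction rule: sigma_sets.induct)
    case (Basic D)
    then show ?case
    proof
      assume "D \<in> range (\<lambda>n. S.vaught (B n) (V n))"
      then obtain n where n: "D = S.vaught (B n) (V n)" by auto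
      obtain A where "represents A D" using represents_exists[OF S.vaught_sets[OF BV(2,1)]] n by blast
      then show ?thesis using vaught_in_stable_algebra[OF BV(2,1)] n by blast
    next
      assume "D \<in> null_sets N"
      then show ?thesis using represents_empty by (intro bexI[of _ "{}"]) auto
    qed
  next
    case Empty
    then show ?case using represents_empty[of "{}"] by (intro bexI[of _ "{}"]) auto
  next
    case (Compl D)
    then show ?case using represents_compl by blast
  next
    case (Union D)
    then have "\<forall>i. \<exists>A. A \<in> stable_algebra \<tau> M \<phi> U \<and> represents A (D i)" by blast
    from choice[OF this] obtain E where "\<forall>i. E i \<in> stable_algebra \<tau> M \<phi> U \<and> represents (E i) (D i)" ..
    then have E: "\<And>i. E i \<in> stable_algebra \<tau> M \<phi> U" "\<And>i. represents (E i) (D i)" by simp_all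
    have "(\<Union>i. E i) \<in> stable_algebra \<tau> M \<phi> U" using E(1) by (intro SA.countable_UN) auto
    then show ?case using represents_UN[OF E(2)] by (rule bexI[rotated])
  qed
  moreover have "\<Phi> A \<in> sigma_sets (space N) (range (\<lambda>n. S.vaught (B n) (V n)) \<union> null_sets N)"
    using BV(3) \<Phi>_sets[OF A] unfolding generated_mod_null_def by auto
  ultimately obtain A' where A': "A' \<in> stable_algebra \<tau> M \<phi> U" "represents A' (\<Phi> A)" by blast
  note R = represents_\<Phi>[OF A]
  have "AE x in M. x \<in> A' \<longrightarrow> x \<in> A" "AE x in M. x \<in> A \<longrightarrow> x \<in> A'"
    using represents_mono[OF A'(2) R] represents_mono[OF R A'(2)] by auto
  then have "AE x in M. x \<in> A' \<longleftrightarrow> x \<in> A" by eventually_elim auto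
  then show "A \<in> stable_algebra \<tau> M \<phi> U" by (rule stable_algebra_cong[OF A'(1) A])
qed

end

section \<open>A Borel action on a space of Lipschitz functions\<close>

text \<open>
  Abstract form of the model space. Each \<open>\<rho> n\<close> is a pseudo-norm on the group and \<open>d\<close> enumerates a
  set that is dense for all of them. A point of the model is a sequence of functions on the group, the
  \<open>n\<close>-th of which is 1-Lipschitz for \<open>\<rho> n (g h\<^sup>-\<^sup>1)\<close>; such a function is determined by its values at the \<open>d i\<close>,
  so a point is stored as a double sequence of reals.
\<close>

locale lipschitz_model = group G
  for G :: "('g, 'r) monoid_scheme" (structure) +
  fixes \<tau> :: "'g topology" and d :: "nat \<Rightarrow> 'g" and \<rho> :: "nat \<Rightarrow> 'g \<Rightarrow> real"
  assumes d_carrier: "d i \<in> carrier G"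
    and \<rho>_one: "\<rho> n \<one> = 0"
    and \<rho>_inv: "g \<in> carrier G \<Longrightarrow> \<rho> n (inv g) \<le> \<rho> n g"
    and \<rho>_mult: "g \<in> carrier G \<Longrightarrow> h \<in> carrier G \<Longrightarrow> \<rho> n (g \<otimes> h) \<le> \<rho> n g + \<rho> n h"
    and \<rho>_dense: "g \<in> carrier G \<Longrightarrow> \<epsilon> > 0 \<Longrightarrow> \<exists>i. \<rho> n (g \<otimes> inv (d i)) \<le> \<epsilon>"
    and \<rho>_measurable: "h \<in> carrier G \<Longrightarrow> k \<in> carrier G \<Longrightarrow> (\<lambda>g. \<rho> n (h \<otimes> g \<otimes> k)) \<in> borel_measurable (borel_measure_of \<tau>)"
    and topspace_carrier: "topspace \<tau> = carrier G"
begin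

definition Y :: "(nat \<Rightarrow> real) set" where
  "Y = {y. \<forall>n i j. y (prod_encode (n, i)) - y (prod_encode (n, j)) \<le> \<rho> n (d i \<otimes> inv (d j))}"

text \<open>
  McShane's formula for the largest 1-Lipschitz extension. The values are prescribed on a dense set, so the
  extension is unique (\<open>ext_unique\<close>); the formula has the merit of being a countable infimum, from
  which measurability can be read off.
\<close>

definition ext :: "(nat \<Rightarrow> real) \<Rightarrow> nat \<Rightarrow> 'g \<Rightarrow> real" where
  "ext y n k = (INF j. y (prod_encode (n, j)) + \<rho> n (k \<otimes> inv (d j)))"

text \<open>
  Right translation of the functions: the new value at \<open>k\<close> is the old value at \<open>k g\<close>.
\<close>

definition act :: "'g \<Rightarrow> (nat \<Rightarrow> real) \<Rightarrow> nat \<Rightarrow> real" where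
  "act g y = (\<lambda>m. case prod_decode m of (n, i) \<Rightarrow> ext y n (d i \<otimes> g))"

lemma act_apply [simp]: "act g y (prod_encode (n, i)) = ext y n (d i \<otimes> g)"
  unfolding act_def by simp

lemma ext_by_prod_encode: "(\<And>n i. y (prod_encode (n, i)) = z (prod_encode (n, i))) \<Longrightarrow> y = z"
  by (rule ext) (metis prod_decode_inverse surj_pair)

lemma closed_Y: "closed Y"
proof -
  have "closed {y::nat \<Rightarrow> real. y (prod_encode (n, i)) - y (prod_encode (n, j)) \<le> \<rho> n (d i \<otimes> inv (d j))}" for n i j
    by (intro closed_Collect_le continuous_intros continuous_on_product_coordinates)
  then have "closed (\<Inter>n. \<Inter>i. \<Inter>j. {y::nat \<Rightarrow> real. y (prod_encode (n, i)) - y (prod_encode (n, j)) \<le> \<rho> n (d i \<otimes> inv (d j))})"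
    by (intro closed_INT ballI)
  moreover have "(\<Inter>n. \<Inter>i. \<Inter>j. {y::nat \<Rightarrow> real. y (prod_encode (n, i)) - y (prod_encode (n, j)) \<le> \<rho> n (d i \<otimes> inv (d j))}) = Y"
    unfolding Y_def by auto
  ultimately show ?thesis by simp
qed

lemma \<rho>_nonneg: assumes "g \<in> carrier G" shows "0 \<le> \<rho> n g"
  using \<rho>_mult[of g "inv g" n] \<rho>_inv[of g n] \<rho>_one[of n] assms by simp

lemma \<rho>_triangle:
  assumes "g \<in> carrier G" "h \<in> carrier G" "k \<in> carrier G"
  shows "\<rho> n (g \<otimes> inv k) \<le> \<rho> n (g \<otimes> inv h) + \<rho> n (h \<otimes> inv k)"
proof -
  have "inv h \<otimes> (h \<otimes> inv k) = inv k" using assms by (simp add: m_assoc[symmetric])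
  then have "g \<otimes> inv k = (g \<otimes> inv h) \<otimes> (h \<otimes> inv k)" using assms by (simp add: m_assoc)
  then show ?thesis using \<rho>_mult[of "g \<otimes> inv h" "h \<otimes> inv k" n] assms by simp
qed

lemma \<rho>_sym:
  assumes "g \<in> carrier G" "h \<in> carrier G" shows "\<rho> n (g \<otimes> inv h) = \<rho> n (h \<otimes> inv g)"
  using \<rho>_inv[of "g \<otimes> inv h" n] \<rho>_inv[of "h \<otimes> inv g" n] assms by (simp add: inv_mult_group)

lemma \<rho>_translate:
  assumes "g \<in> carrier G" "h \<in> carrier G" "k \<in> carrier G"
  shows "\<rho> n ((g \<otimes> k) \<otimes> inv (h \<otimes> k)) = \<rho> n (g \<otimes> inv h)"
proof -
  have "k \<otimes> (inv k \<otimes> inv h) = inv h" using assms by (simp add: m_assoc[symmetric])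
  then show ?thesis using assms by (simp add: inv_mult_group m_assoc)
qed

lemma ext_bdd:
  assumes y: "y \<in> Y" and k: "k \<in> carrier G"
  shows "bdd_below (range (\<lambda>j. y (prod_encode (n, j)) + \<rho> n (k \<otimes> inv (d j))))"
proof (rule bdd_belowI2[of _ "y (prod_encode (n, 0)) - \<rho> n (d 0 \<otimes> inv k)"])
  fix j
  have "y (prod_encode (n, 0)) - y (prod_encode (n, j)) \<le> \<rho> n (d 0 \<otimes> inv (d j))" using y unfolding Y_def by auto
  also have "\<dots> \<le> \<rho> n (d 0 \<otimes> inv k) + \<rho> n (k \<otimes> inv (d j))" using \<rho>_triangle d_carrier k by auto
  finally show "y (prod_encode (n, 0)) - \<rho> n (d 0 \<otimes> inv k) \<le> y (prod_encode (n, j)) + \<rho> n (k \<otimes> inv (d j))" by simp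
qed

lemma ext_unique:
  assumes k: "k \<in> carrier G"
    and v: "\<And>j. \<bar>v - y (prod_encode (n, j))\<bar> \<le> \<rho> n (k \<otimes> inv (d j))"
  shows "ext y n k = v"
  unfolding ext_def
proof (rule antisym)
  have bdd: "bdd_below (range (\<lambda>j. y (prod_encode (n, j)) + \<rho> n (k \<otimes> inv (d j))))"
    by (rule bdd_belowI2[of _ v]) (use v in \<open>smt (verit)\<close>)
  show "(INF j. y (prod_encode (n, j)) + \<rho> n (k \<otimes> inv (d j))) \<le> v"
  proof (rule field_le_epsilon)
    fix e :: real assume "e > 0"
    then obtain j where j: "\<rho> n (k \<otimes> inv (d j)) \<le> e / 2" using \<rho>_dense[OF k, of "e/2" n] by auto
    have "(INF j. y (prod_encode (n, j)) + \<rho> n (k \<otimes> inv (d j))) \<le> y (prod_encode (n, j)) + \<rho> n (k \<otimes> inv (d j))"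
      by (rule cINF_lower[OF bdd]) simp
    also have "\<dots> \<le> v + e" using v[of j] j by linarith
    finally show "(INF j. y (prod_encode (n, j)) + \<rho> n (k \<otimes> inv (d j))) \<le> v + e" .
  qed
  show "v \<le> (INF j. y (prod_encode (n, j)) + \<rho> n (k \<otimes> inv (d j)))"
  proof (rule cINF_greatest)
    fix j show "v \<le> y (prod_encode (n, j)) + \<rho> n (k \<otimes> inv (d j))" using v[of j] by linarith
  qed simp
qed

lemma ext_dense:
  assumes y: "y \<in> Y" shows "ext y n (d i) = y (prod_encode (n, i))"
proof (rule ext_unique[OF d_carrier])
  fix j
  have "y (prod_encode (n, i)) - y (prod_encode (n, j)) \<le> \<rho> n (d i \<otimes> inv (d j))"
    "y (prod_encode (n, j)) - y (prod_encode (n, i)) \<le> \<rho> n (d j \<otimes> inv (d i))" using y unfolding Y_def by auto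
  then show "\<bar>y (prod_encode (n, i)) - y (prod_encode (n, j))\<bar> \<le> \<rho> n (d i \<otimes> inv (d j))"
    using \<rho>_sym[OF d_carrier d_carrier, of n j i] by simp
qed

lemma ext_lipschitz:
  assumes y: "y \<in> Y" and k: "k \<in> carrier G" and l: "l \<in> carrier G"
  shows "ext y n k - ext y n l \<le> \<rho> n (k \<otimes> inv l)"
proof -
  have "ext y n k - \<rho> n (k \<otimes> inv l) \<le> ext y n l"
    unfolding ext_def[of y n l]
  proof (rule cINF_greatest)
    fix j
    have "ext y n k \<le> y (prod_encode (n, j)) + \<rho> n (k \<otimes> inv (d j))"
      unfolding ext_def by (rule cINF_lower[OF ext_bdd[OF y k]]) simp
    also have "\<dots> \<le> y (prod_encode (n, j)) + (\<rho> n (k \<otimes> inv l) + \<rho> n (l \<otimes> inv (d j)))"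
      using \<rho>_triangle[OF k l d_carrier, of n j] by simp
    finally show "ext y n k - \<rho> n (k \<otimes> inv l) \<le> y (prod_encode (n, j)) + \<rho> n (l \<otimes> inv (d j))" by simp
  qed simp
  then show ?thesis by simp
qed

lemma act_in_Y:
  assumes y: "y \<in> Y" and g: "g \<in> carrier G" shows "act g y \<in> Y"
proof -
  have "ext y n (d i \<otimes> g) - ext y n (d j \<otimes> g) \<le> \<rho> n (d i \<otimes> inv (d j))" for n i j
    using ext_lipschitz[OF y, of "d i \<otimes> g" "d j \<otimes> g" n] \<rho>_translate[OF d_carrier d_carrier g, of n i j] d_carrier g
    by simp
  then show ?thesis unfolding Y_def by simp
qed

text \<open>
  The translated function is Lipschitz and has the prescribed values on the dense set, so it is the
  extension.
\<close>

lemma ext_act: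
  assumes y: "y \<in> Y" and g: "g \<in> carrier G" and k: "k \<in> carrier G"
  shows "ext (act g y) n k = ext y n (k \<otimes> g)"
proof (rule ext_unique[OF k])
  fix j
  have "ext y n (k \<otimes> g) - ext y n (d j \<otimes> g) \<le> \<rho> n (k \<otimes> inv (d j))"
    "ext y n (d j \<otimes> g) - ext y n (k \<otimes> g) \<le> \<rho> n (d j \<otimes> inv k)"
    using ext_lipschitz[OF y, of "k \<otimes> g" "d j \<otimes> g" n] ext_lipschitz[OF y, of "d j \<otimes> g" "k \<otimes> g" n]
      \<rho>_translate[OF k d_carrier g, of n j] \<rho>_translate[OF d_carrier k g, of n j] d_carrier g k by auto
  then show "\<bar>ext y n (k \<otimes> g) - act g y (prod_encode (n, j))\<bar> \<le> \<rho> n (k \<otimes> inv (d j))"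
    using \<rho>_sym[OF d_carrier k, of n j] by simp
qed

lemma act_one: "y \<in> Y \<Longrightarrow> act \<one> y = y"
  by (rule ext_by_prod_encode) (simp add: ext_dense d_carrier)

lemma act_mult:
  assumes "y \<in> Y" "g \<in> carrier G" "h \<in> carrier G" shows "act g (act h y) = act (g \<otimes> h) y"
  by (rule ext_by_prod_encode) (simp add: ext_act assms d_carrier m_assoc)

lemma act_jointly_measurable:
  assumes N: "space N = Y" "sets N = sets (restrict_space borel Y)"
  shows "(\<lambda>(g, y). act g y) \<in> borel_measure_of \<tau> \<Otimes>\<^sub>M N \<rightarrow>\<^sub>M N"
proof -
  let ?P = "borel_measure_of \<tau> \<Otimes>\<^sub>M N"
  have id: "(\<lambda>y. y) \<in> N \<rightarrow>\<^sub>M borel"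
    unfolding measurable_cong_sets[OF N(2) refl] by (rule measurable_restrict_space1) simp
  have coord: "(\<lambda>p. snd p m) \<in> borel_measurable ?P" for m
  proof -
    have "(\<lambda>p. snd p) \<in> ?P \<rightarrow>\<^sub>M borel" by (rule measurable_compose[OF measurable_snd id])
    then show ?thesis by (rule measurable_product_then_coordinatewise)
  qed
  have "(\<lambda>p. act (fst p) (snd p)) \<in> borel_measurable ?P"
  proof (rule measurable_coordinatewise_then_product)
    fix m
    obtain n i where m: "m = prod_encode (n, i)" by (metis prod_decode_inverse surj_pair)
    have "(\<lambda>p. INF j. snd p (prod_encode (n, j)) + \<rho> n (d i \<otimes> fst p \<otimes> inv (d j))) \<in> borel_measurable ?P"
    proof (rule borel_measurable_cINF)
      show "(\<lambda>p. snd p (prod_encode (n, j)) + \<rho> n (d i \<otimes> fst p \<otimes> inv (d j))) \<in> borel_measurable ?P" for j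
        using measurable_compose[OF measurable_fst \<rho>_measurable[OF d_carrier inv_closed[OF d_carrier]]] coord
        by (intro borel_measurable_add)
      show "bdd_below ((\<lambda>j. snd p (prod_encode (n, j)) + \<rho> n (d i \<otimes> fst p \<otimes> inv (d j))) ` UNIV)" if "p \<in> space ?P" for p
        using that N(1) topspace_carrier d_carrier by (intro ext_bdd) (auto simp: space_pair_measure)
    qed simp
    then show "(\<lambda>p. act (fst p) (snd p) m) \<in> borel_measurable ?P" unfolding m act_apply ext_def .
  qed
  moreover have "(\<lambda>p. act (fst p) (snd p)) \<in> space ?P \<rightarrow> Y"
    using act_in_Y N(1) topspace_carrier by (auto simp: space_pair_measure)
  ultimately have "(\<lambda>p. act (fst p) (snd p)) \<in> ?P \<rightarrow>\<^sub>M restrict_space borel Y"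
    by (intro measurable_restrict_space2) auto
  then show ?thesis using measurable_cong_sets[OF refl N(2), of ?P] by (simp add: case_prod_beta')
qed

end

section \<open>Generation by continuous functions yields a spatial model\<close>

context near_action_nbhd begin

text \<open>
  The distance of \<open>f \<circ> T g\<close> and \<open>f\<close> in the supremum norm modulo null sets, as a real number. For a
  \<open>G\<close>-continuous \<open>f\<close> it is a pseudo-norm in \<open>g\<close> that tends to zero at the identity.
\<close>

definition osc :: "('a \<Rightarrow> real) \<Rightarrow> 'g \<Rightarrow> real" where
  "osc f g = Inf {c. 0 \<le> c \<and> (AE x in M. \<bar>f (T g x) - f x\<bar> \<le> c)}"

lemma osc_le: "0 \<le> c \<Longrightarrow> AE x in M. \<bar>f (T g x) - f x\<bar> \<le> c \<Longrightarrow> osc f g \<le> c"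
  unfolding osc_def by (rule cInf_lower) (auto intro: bdd_belowI[of _ 0])

lemma AE_osc:
  assumes f: "G_continuous G \<tau> M \<phi> f" and g: "g \<in> carrier G"
  shows "0 \<le> osc f g" "AE x in M. \<bar>f (T g x) - f x\<bar> \<le> osc f g"
proof -
  let ?C = "{c. 0 \<le> c \<and> (AE x in M. \<bar>f (T g x) - f x\<bar> \<le> c)}"
  obtain c where c: "AE x in M. \<bar>f x\<bar> \<le> c" using f unfolding G_continuous_iff by auto
  from c AE_T[OF g c] have "AE x in M. \<bar>f (T g x) - f x\<bar> \<le> 2 * \<bar>c\<bar>"
    by eventually_elim linarith
  then have ne: "?C \<noteq> {}" by (intro ex_in_conv[THEN iffD1] exI[of _ "2 * \<bar>c\<bar>"]) auto
  show "0 \<le> osc f g" unfolding osc_def using ne by (rule cInf_greatest) auto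
  have "AE x in M. \<forall>n::nat. \<bar>f (T g x) - f x\<bar> \<le> osc f g + 1 / real (Suc n)"
    unfolding AE_all_countable
  proof
    fix n :: nat
    have "Inf ?C < osc f g + 1 / real (Suc n)" unfolding osc_def using zero_less_one_over_Suc[of n] by linarith
    then obtain c where "c \<in> ?C" "c < osc f g + 1 / real (Suc n)" using cInf_lessD[OF ne] by blast
    then have *: "AE x in M. \<bar>f (T g x) - f x\<bar> \<le> c" and c: "c < osc f g + 1 / real (Suc n)" by auto
    from * show "AE x in M. \<bar>f (T g x) - f x\<bar> \<le> osc f g + 1 / real (Suc n)"
      by eventually_elim (use c in linarith)
  qed
  then show "AE x in M. \<bar>f (T g x) - f x\<bar> \<le> osc f g"
  proof eventually_elim
    case (elim x)
    show ?case
    proof (rule field_le_epsilon)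
      fix e :: real assume "e > 0"
      then obtain n :: nat where "1 / real (Suc n) < e" by (metis nat_approx_posE of_nat_Suc)
      then show "\<bar>f (T g x) - f x\<bar> \<le> osc f g + e" using elim[rule_format, of n] by linarith
    qed
  qed
qed

lemma osc_one: assumes f: "G_continuous G \<tau> M \<phi> f" shows "osc f \<one> = 0"
proof -
  have "AE x in M. \<bar>f (T \<one> x) - f x\<bar> \<le> 0" using T_one by eventually_elim simp
  then show ?thesis using osc_le[of 0 f \<one>] AE_osc(1)[OF f one_closed] by simp
qed

lemma osc_inv:
  assumes f: "G_continuous G \<tau> M \<phi> f" and g: "g \<in> carrier G" shows "osc f (inv g) \<le> osc f g"
proof (rule osc_le)
  show "0 \<le> osc f g" by (rule AE_osc(1)[OF f g])
  from AE_T[OF inv_closed[OF g] AE_osc(2)[OF f g]] T_inv[OF g]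
  show "AE x in M. \<bar>f (T (inv g) x) - f x\<bar> \<le> osc f g"
    by eventually_elim (simp add: abs_minus_commute)
qed

lemma osc_mult:
  assumes f: "G_continuous G \<tau> M \<phi> f" and g: "g \<in> carrier G" and h: "h \<in> carrier G"
  shows "osc f (g \<otimes> h) \<le> osc f g + osc f h"
proof (rule osc_le)
  show "0 \<le> osc f g + osc f h" using AE_osc(1)[OF f] g h by (intro add_nonneg_nonneg) auto
  from AE_T[OF h AE_osc(2)[OF f g]] AE_osc(2)[OF f h] T_mult[OF g h]
  show "AE x in M. \<bar>f (T (g \<otimes> h) x) - f x\<bar> \<le> osc f g + osc f h"
    by eventually_elim simp
qed

lemma osc_small:
  assumes f: "G_continuous G \<tau> M \<phi> f" and e: "\<epsilon> > 0"
  obtains m where "m \<ge> 1" "\<And>g. g \<in> U m \<Longrightarrow> osc f g \<le> \<epsilon>"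
proof -
  obtain m where m: "m \<ge> 1" "\<And>g. g \<in> U m \<Longrightarrow> AE x in M. \<bar>f (T g x) - f x\<bar> \<le> \<epsilon>"
    using f e unfolding G_continuous_iff by blast
  then show ?thesis using e by (intro that[of m] osc_le) auto
qed

lemma openin_osc_less:
  assumes f: "G_continuous G \<tau> M \<phi> f" shows "openin \<tau> {g \<in> carrier G. osc f g < r}"
proof (subst openin_subopen, safe)
  fix g assume g: "g \<in> carrier G" "osc f g < r"
  then have "(r - osc f g) / 2 > 0" by simp
  from osc_small[OF f this] obtain m where m: "m \<ge> 1" "\<And>h. h \<in> U m \<Longrightarrow> osc f h \<le> (r - osc f g) / 2" by blast
  let ?O = "{h \<in> topspace \<tau>. inv g \<otimes> h \<in> U m}"
  have "openin \<tau> ?O"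
    using left_translation_continuous[of "inv g"] g U_open[OF m(1)] by (intro openin_continuous_map_preimage) auto
  moreover have "g \<in> ?O" using g U_one[OF m(1)] by simp
  moreover have "?O \<subseteq> {g \<in> carrier G. osc f g < r}"
  proof safe
    fix h assume h: "h \<in> topspace \<tau>" "inv g \<otimes> h \<in> U m"
    then show hG: "h \<in> carrier G" by simp
    have "h = g \<otimes> (inv g \<otimes> h)" using g hG by (simp add: m_assoc[symmetric])
    then have "osc f h \<le> osc f g + osc f (inv g \<otimes> h)"
      using osc_mult[OF f, of g "inv g \<otimes> h"] g hG by simp
    also have "\<dots> \<le> osc f g + (r - osc f g) / 2" using m(2)[OF h(2)] by simp
    also have "\<dots> < r" using g(2) by (simp add: field_simps)
    finally show "osc f h < r" .
  qed
  ultimately show "\<exists>W. openin \<tau> W \<and> g \<in> W \<and> W \<subseteq> {g \<in> carrier G. osc f g < r}" by blast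
qed

lemma osc_measurable:
  assumes f: "G_continuous G \<tau> M \<phi> f" and h: "h \<in> carrier G" and k: "k \<in> carrier G"
  shows "(\<lambda>g. osc f (h \<otimes> g \<otimes> k)) \<in> borel_measurable (borel_measure_of \<tau>)"
  unfolding borel_measurable_iff_less
proof
  fix r
  have "continuous_map \<tau> \<tau> (\<lambda>g. h \<otimes> g \<otimes> k)"
    using continuous_map_compose[OF left_translation_continuous[OF h] right_translation_continuous[OF k]]
    by (simp add: o_def)
  then have "openin \<tau> {g \<in> topspace \<tau>. h \<otimes> g \<otimes> k \<in> {g \<in> carrier G. osc f g < r}}"
    using openin_osc_less[OF f] by (rule openin_continuous_map_preimage)
  moreover have "{g \<in> topspace \<tau>. h \<otimes> g \<otimes> k \<in> {g \<in> carrier G. osc f g < r}} =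
      {g \<in> space (borel_measure_of \<tau>). osc f (h \<otimes> g \<otimes> k) < r}" using h k by auto
  ultimately show "{g \<in> space (borel_measure_of \<tau>). osc f (h \<otimes> g \<otimes> k) < r} \<in> sets (borel_measure_of \<tau>)"
    using open_in_borel_measure_of by metis
qed

text \<open>
  Each of countably many generators of the Borel sets already lies in the sigma-algebra generated by
  countably many sets of the generating family.
\<close>

lemma countably_many_continuous_generators:
  assumes sb: "standard_borel M" and gen: "sets M = continuous_algebra G \<tau> M \<phi>"
  obtains f :: "nat \<Rightarrow> 'a \<Rightarrow> real" where "\<And>n. G_continuous G \<tau> M \<phi> (f n)"
    "sets M \<subseteq> sigma_sets (space M) ({f n -` B \<inter> space M |n B. B \<in> sets borel} \<union> null_sets M)"
proof -
  let ?E = "{f -` B \<inter> space M |f B. G_continuous G \<tau> M \<phi> f \<and> B \<in> sets borel}"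
  obtain B :: "nat \<Rightarrow> 'a set" where B: "range B \<subseteq> sets M" "sets M = sigma_sets (space M) (range B)"
    using standard_borel_countably_generated[OF sb] .
  have "\<forall>n. \<exists>E'. E' \<subseteq> ?E \<union> null_sets M \<and> countable E' \<and> B n \<in> sigma_sets (space M) E'"
    using B(1) sigma_sets_countable_subfamily[of _ "space M" "?E \<union> null_sets M"]
    unfolding gen continuous_algebra_def generated_mod_null_def by auto
  from choice[OF this] obtain E' where "\<forall>n. E' n \<subseteq> ?E \<union> null_sets M \<and> countable (E' n) \<and>
    B n \<in> sigma_sets (space M) (E' n)" ..
  then have E': "\<And>n. E' n \<subseteq> ?E \<union> null_sets M" "\<And>n. countable (E' n)"
    "\<And>n. B n \<in> sigma_sets (space M) (E' n)" by simp_all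
  define C where "C = (\<Union>n. E' n) \<inter> ?E"
  have "countable C" unfolding C_def using E'(2) by auto
  have "\<forall>e\<in>C. \<exists>f. G_continuous G \<tau> M \<phi> f \<and> (\<exists>B\<in>sets borel. e = f -` B \<inter> space M)" unfolding C_def by blast
  then obtain F where F: "\<And>e. e \<in> C \<Longrightarrow> G_continuous G \<tau> M \<phi> (F e)"
    "\<And>e. e \<in> C \<Longrightarrow> \<exists>B\<in>sets borel. e = F e -` B \<inter> space M" by metis
  have zero: "G_continuous G \<tau> M \<phi> (\<lambda>_. 0)" unfolding G_continuous_iff by auto
  define FF where "FF = insert (\<lambda>_. 0) (F ` C)"
  have FFc: "countable FF" "FF \<noteq> {}" unfolding FF_def using \<open>countable C\<close> by auto
  define f where "f = from_nat_into FF"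
  have f: "range f = FF" unfolding f_def using FFc by simp
  have "G_continuous G \<tau> M \<phi> (f n)" for n
  proof -
    have "f n \<in> FF" using f by auto
    then show ?thesis unfolding FF_def using F(1) zero by auto
  qed
  moreover have "sets M \<subseteq> sigma_sets (space M) ({f n -` B \<inter> space M |n B. B \<in> sets borel} \<union> null_sets M)"
  proof -
    let ?S = "{f n -` B \<inter> space M |n B. B \<in> sets borel} \<union> null_sets M"
    have sub: "E' n \<subseteq> ?S" for n
    proof
      fix e assume e: "e \<in> E' n"
      show "e \<in> ?S"
      proof (cases "e \<in> null_sets M")
        case False
        then have "e \<in> C" using e E'(1)[of n] unfolding C_def by blast
        then obtain B where "B \<in> sets borel" "e = F e -` B \<inter> space M" using F(2) by blast
        moreover have "F e \<in> range f" unfolding f FF_def using \<open>e \<in> C\<close> by auto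
        then obtain n where "F e = f n" by auto
        ultimately show ?thesis by (intro UnI1 CollectI exI[of _ n] exI[of _ B]) auto
      qed auto
    qed
    have "B n \<in> sigma_sets (space M) ?S" for n
      using E'(3)[of n] sigma_sets_mono'[OF sub] by blast
    then show ?thesis unfolding B(2) by (intro sigma_sets_mono) auto
  qed
  ultimately show ?thesis by (rule that)
qed

end

text \<open>
  The identity is the first element of the dense sequence: in this way \<open>f n\<close> itself is one of the
  coordinates of the map into the model, and that map generates all measurable sets.
\<close>

locale generated_near_action = near_action_nbhd M G \<tau> \<phi> U
  for M :: "'a measure" and G :: "('g, 'r) monoid_scheme" (structure) and \<tau> \<phi> U +
  fixes f :: "nat \<Rightarrow> 'a \<Rightarrow> real" and d :: "nat \<Rightarrow> 'g"
  assumes f_continuous: "G_continuous G \<tau> M \<phi> (f n)"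
    and f_generate: "sets M \<subseteq> sigma_sets (space M) ({f n -` B \<inter> space M |n B. B \<in> sets borel} \<union> null_sets M)"
    and d_in_carrier: "d i \<in> carrier G" and d_zero: "d 0 = \<one>"
    and d_dense: "openin \<tau> O' \<Longrightarrow> O' \<noteq> {} \<Longrightarrow> \<exists>i. d i \<in> O'"
begin

lemma osc_dense:
  assumes g: "g \<in> carrier G" and e: "\<epsilon> > 0" shows "\<exists>i. osc (f n) (g \<otimes> inv (d i)) \<le> \<epsilon>"
proof -
  obtain m where m: "m \<ge> 1" "\<And>h. h \<in> U m \<Longrightarrow> osc (f n) h \<le> \<epsilon>" using osc_small[OF f_continuous e] by blast
  have "continuous_map \<tau> \<tau> (\<lambda>h. g \<otimes> inv h)"
    using continuous_map_compose[OF continuous_inv left_translation_continuous[OF g]] by (simp add: o_def)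
  then have "openin \<tau> {h \<in> topspace \<tau>. g \<otimes> inv h \<in> U m}"
    using U_open[OF m(1)] by (rule openin_continuous_map_preimage)
  moreover have "g \<in> {h \<in> topspace \<tau>. g \<otimes> inv h \<in> U m}" using g U_one[OF m(1)] by simp
  ultimately obtain i where "d i \<in> {h \<in> topspace \<tau>. g \<otimes> inv h \<in> U m}" using d_dense by blast
  then show ?thesis using m(2) by auto
qed

sublocale L: lipschitz_model G \<tau> d "\<lambda>n. osc (f n)"
  by unfold_locales
    (use osc_one[OF f_continuous] osc_inv[OF f_continuous] osc_mult[OF f_continuous] osc_dense
      osc_measurable[OF f_continuous] d_in_carrier in auto)

lemma f_measurable [measurable]: "f n \<in> borel_measurable M"
  using f_continuous unfolding G_continuous_iff by auto

definition orbit :: "'a \<Rightarrow> nat \<Rightarrow> real" where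
  "orbit x = (\<lambda>m. case prod_decode m of (n, i) \<Rightarrow> f n (T (d i) x))"

lemma orbit_apply [simp]: "orbit x (prod_encode (n, i)) = f n (T (d i) x)"
  unfolding orbit_def by simp

lemma AE_orbit_diff:
  assumes g: "g \<in> carrier G" and h: "h \<in> carrier G"
  shows "AE x in M. \<bar>f n (T g x) - f n (T h x)\<bar> \<le> osc (f n) (g \<otimes> inv h)"
proof -
  have k: "g \<otimes> inv h \<in> carrier G" using g h by simp
  have "AE x in M. T ((g \<otimes> inv h) \<otimes> h) x = T (g \<otimes> inv h) (T h x)" by (rule T_mult[OF k h])
  moreover have "(g \<otimes> inv h) \<otimes> h = g" using g h by (simp add: m_assoc)
  ultimately have "AE x in M. T g x = T (g \<otimes> inv h) (T h x)" by simp
  with AE_T[OF h AE_osc(2)[OF f_continuous k, of n]] show ?thesis by eventually_elim simp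
qed

lemma AE_orbit_in_Y: "AE x in M. orbit x \<in> L.Y"
proof -
  have "AE x in M. \<forall>n i j. \<bar>f n (T (d i) x) - f n (T (d j) x)\<bar> \<le> osc (f n) (d i \<otimes> inv (d j))"
    unfolding AE_all_countable using AE_orbit_diff[OF d_in_carrier d_in_carrier] by auto
  then show ?thesis
  proof eventually_elim
    case (elim x)
    show ?case unfolding L.Y_def
    proof (intro CollectI allI)
      fix n i j
      show "orbit x (prod_encode (n, i)) - orbit x (prod_encode (n, j)) \<le> osc (f n) (d i \<otimes> inv (d j))"
        using elim[rule_format, of n i j] by simp
    qed
  qed
qed

text \<open>
  On the null set where the Lipschitz conditions fail, the value is the zero function, a point of the
  model space.
\<close>

definition \<Theta> :: "'a \<Rightarrow> nat \<Rightarrow> real" where "\<Theta> x = (if orbit x \<in> L.Y then orbit x else (\<lambda>_. 0))"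

abbreviation "YB \<equiv> restrict_space borel L.Y"

definition N :: "(nat \<Rightarrow> real) measure" where "N = distr M YB \<Theta>"

lemma zero_in_Y: "(\<lambda>_. 0) \<in> L.Y"
  unfolding L.Y_def using L.\<rho>_nonneg d_in_carrier by auto

lemma \<Theta>_measurable [measurable]: "\<Theta> \<in> M \<rightarrow>\<^sub>M YB"
proof -
  have [measurable]: "orbit \<in> M \<rightarrow>\<^sub>M borel"
  proof (rule measurable_coordinatewise_then_product)
    fix m
    obtain n i where m: "m = prod_encode (n, i)" by (metis prod_decode_inverse surj_pair)
    have [measurable]: "T (d i) \<in> M \<rightarrow>\<^sub>M M" by (rule T_measurable[OF d_in_carrier])
    show "(\<lambda>x. orbit x m) \<in> borel_measurable M" unfolding m by simp
  qed
  have [measurable]: "L.Y \<in> sets borel" using L.closed_Y by (rule borel_closed)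
  have "\<Theta> \<in> M \<rightarrow>\<^sub>M borel" unfolding \<Theta>_def by measurable
  then show ?thesis by (rule measurable_restrict_space2[rotated]) (auto simp: \<Theta>_def zero_in_Y)
qed

lemma space_N: "space N = L.Y" and sets_N: "sets N = sets YB"
  unfolding N_def by (auto simp: space_restrict_space)

lemma \<Theta>_in_Y: "\<Theta> x \<in> L.Y" unfolding \<Theta>_def using zero_in_Y by auto

text \<open>
  Only countably many elements of the group are involved for fixed \<open>g\<close>, namely the \<open>d i\<close> and the
  \<open>d i g\<close>. For almost every \<open>x\<close> the Lipschitz estimates between all of these hold, and they identify
  \<open>f n (T (d i g) x)\<close> as the value of the extension at \<open>d i g\<close>.
\<close>

lemma AE_\<Theta>_equivariant:
  assumes g: "g \<in> carrier G" shows "AE x in M. \<Theta> (T g x) = L.act g (\<Theta> x)"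
proof -
  have "AE x in M. \<forall>n i j. \<bar>f n (T (d i \<otimes> g) x) - f n (T (d j) x)\<bar> \<le> osc (f n) (d i \<otimes> g \<otimes> inv (d j))"
    unfolding AE_all_countable
    using AE_orbit_diff[OF m_closed[OF d_in_carrier g] d_in_carrier] by auto
  moreover have "AE x in M. \<forall>i. T (d i \<otimes> g) x = T (d i) (T g x)"
    unfolding AE_all_countable using T_mult[OF d_in_carrier g] by auto
  ultimately show ?thesis using AE_orbit_in_Y AE_T[OF g AE_orbit_in_Y]
  proof eventually_elim
    case (elim x)
    have "L.act g (orbit x) = orbit (T g x)"
    proof (rule L.ext_by_prod_encode)
      fix n i
      have "L.ext (orbit x) n (d i \<otimes> g) = f n (T (d i \<otimes> g) x)"
        using elim(1) d_in_carrier g by (intro L.ext_unique) auto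
      then show "L.act g (orbit x) (prod_encode (n, i)) = orbit (T g x) (prod_encode (n, i))"
        using elim(2) by simp
    qed
    then show ?case using elim(3,4) unfolding \<Theta>_def by simp
  qed
qed

lemma N_act_spatial: "spatial_action G \<tau> N L.act"
  unfolding spatial_action_def
proof (intro conjI ballI)
  show "standard_borel N" by (rule closed_subset_standard_borel[OF L.closed_Y space_N sets_N])
  show "prob_space N" unfolding N_def by (rule prob_space_distr[OF \<Theta>_measurable])
  show jm: "(\<lambda>(g, x). L.act g x) \<in> borel_measure_of \<tau> \<Otimes>\<^sub>M N \<rightarrow>\<^sub>M N"
    by (rule L.act_jointly_measurable[OF space_N sets_N])
  show "L.act \<one> y = y" if "y \<in> space N" for y using that L.act_one space_N by auto
  show "L.act g (L.act h y) = L.act (g \<otimes> h) y" if "g \<in> carrier G" "h \<in> carrier G" "y \<in> space N" for g h y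
    using that L.act_mult space_N by auto
  fix g assume g: "g \<in> carrier G"
  have am: "L.act g \<in> N \<rightarrow>\<^sub>M N"
  proof -
    have "(\<lambda>y. (g, y)) \<in> N \<rightarrow>\<^sub>M borel_measure_of \<tau> \<Otimes>\<^sub>M N" using g by (intro measurable_Pair1') simp
    from measurable_compose[OF this jm] show ?thesis by simp
  qed
  have amB: "L.act g \<in> YB \<rightarrow>\<^sub>M YB" using am measurable_cong_sets[OF sets_N sets_N] by auto
  have Tg: "T g \<in> M \<rightarrow>\<^sub>M M" by (rule T_measurable[OF g])
  have "distr N N (L.act g) = distr N YB (L.act g)" by (rule distr_cong) (auto simp: sets_N)
  also have "\<dots> = distr M YB (L.act g \<circ> \<Theta>)" unfolding N_def by (rule distr_distr[OF amB \<Theta>_measurable])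
  also have "\<dots> = distr M YB (\<Theta> \<circ> T g)"
    by (rule distr_cong_AE) (use AE_\<Theta>_equivariant[OF g] measurable_comp[OF Tg \<Theta>_measurable] measurable_comp[OF \<Theta>_measurable amB] in \<open>auto elim!: eventually_mono\<close>)
  also have "\<dots> = distr (distr M M (T g)) YB \<Theta>" by (rule distr_distr[OF \<Theta>_measurable Tg, symmetric])
  also have "\<dots> = N" unfolding T_distr[OF g] N_def ..
  finally show "distr N N (L.act g) = N" .
qed

sublocale S: spatial_system G \<tau> N L.act
  by unfold_locales (rule N_act_spatial)

lemma \<Theta>_measurable_N [measurable]: "\<Theta> \<in> M \<rightarrow>\<^sub>M N"
  unfolding measurable_cong_sets[OF refl sets_N] by (rule \<Theta>_measurable)

lemma distr_\<Theta>: "distr M N \<Theta> = N"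
  unfolding N_def by (rule distr_cong) auto

lemma eq_mod_null_N_iff:
  "eq_mod_null N B C \<longleftrightarrow> B \<in> sets N \<and> C \<in> sets N \<and> (AE x in M. \<Theta> x \<in> B \<longleftrightarrow> \<Theta> x \<in> C)"
proof -
  have "(AE y in N. y \<in> B \<longleftrightarrow> y \<in> C) \<longleftrightarrow> (AE x in M. \<Theta> x \<in> B \<longleftrightarrow> \<Theta> x \<in> C)"
    if [measurable]: "B \<in> sets N" "C \<in> sets N"
  proof -
    have "(AE y in distr M N \<Theta>. y \<in> B \<longleftrightarrow> y \<in> C) \<longleftrightarrow> (AE x in M. \<Theta> x \<in> B \<longleftrightarrow> \<Theta> x \<in> C)"
      by (rule AE_distr_iff[OF \<Theta>_measurable_N]) measurable
    then show ?thesis unfolding distr_\<Theta> .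
  qed
  then show ?thesis unfolding eq_mod_null_iff by auto
qed

text \<open>
  The sets of the form \<open>\<Theta>\<^sup>-\<^sup>1 B\<close> form a sigma-algebra modulo null sets. It makes every \<open>f n\<close> measurable, because
  \<open>f n\<close> is the coordinate of \<open>\<Theta>\<close> with index \<open>(n, 0)\<close>.
\<close>

lemma representable:
  assumes "A \<in> sets M" shows "\<exists>B. B \<in> sets N \<and> (AE x in M. \<Theta> x \<in> B \<longleftrightarrow> x \<in> A)"
proof -
  have "A \<in> sigma_sets (space M) ({f n -` B \<inter> space M |n B. B \<in> sets borel} \<union> null_sets M)"
    using assms f_generate by auto
  then show ?thesis
  proof (induction rule: sigma_sets.induct)
    case (Basic A)
    then show ?case
    proof
      assume "A \<in> {f n -` B \<inter> space M |n B. B \<in> sets borel}"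
      then obtain n B where nB: "A = f n -` B \<inter> space M" "B \<in> sets borel" by auto
      let ?C = "{y \<in> space N. y (prod_encode (n, 0)) \<in> B}"
      have "(\<lambda>y. y) \<in> N \<rightarrow>\<^sub>M borel"
        unfolding measurable_cong_sets[OF sets_N refl] by (rule measurable_restrict_space1) simp
      then have "(\<lambda>y. y (prod_encode (n, 0))) \<in> borel_measurable N" by (rule measurable_product_then_coordinatewise)
      from measurable_sets[OF this nB(2)] have "?C \<in> sets N" by (simp add: vimage_def Int_def conj_commute)
      moreover have "AE x in M. \<Theta> x \<in> ?C \<longleftrightarrow> x \<in> A"
        using AE_orbit_in_Y T_one AE_space
        by eventually_elim (simp add: \<Theta>_def space_N nB(1) d_zero)
      ultimately show ?thesis by blast
    next
      assume "A \<in> null_sets M"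
      then have "AE x in M. x \<notin> A" by (rule AE_not_in)
      then show ?thesis by (intro exI[of _ "{}"]) auto
    qed
  next
    case Empty
    then show ?case by (intro exI[of _ "{}"]) auto
  next
    case (Compl A)
    then obtain B where B: "B \<in> sets N" "AE x in M. \<Theta> x \<in> B \<longleftrightarrow> x \<in> A" by auto
    have "AE x in M. \<Theta> x \<in> space N - B \<longleftrightarrow> x \<in> space M - A"
      using B(2) AE_space by eventually_elim (use \<Theta>_in_Y space_N in auto)
    then show ?case using B(1) by (intro exI[of _ "space N - B"]) auto
  next
    case (Union A)
    then have "\<forall>i. \<exists>B. B \<in> sets N \<and> (AE x in M. \<Theta> x \<in> B \<longleftrightarrow> x \<in> A i)" by blast
    from choice[OF this] obtain B where "\<forall>i. B i \<in> sets N \<and> (AE x in M. \<Theta> x \<in> B i \<longleftrightarrow> x \<in> A i)" ..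
    then have B: "\<And>i. B i \<in> sets N" "\<And>i. AE x in M. \<Theta> x \<in> B i \<longleftrightarrow> x \<in> A i" by simp_all
    have "AE x in M. \<forall>i. \<Theta> x \<in> B i \<longleftrightarrow> x \<in> A i" unfolding AE_all_countable using B(2) by auto
    then have "AE x in M. \<Theta> x \<in> (\<Union>i. B i) \<longleftrightarrow> x \<in> (\<Union>i. A i)" by eventually_elim auto
    then show ?case using B(1) by (intro exI[of _ "\<Union>i. B i"]) auto
  qed
qed

text \<open>
  The inverse of the embedding \<open>B \<mapsto> \<Theta>\<^sup>-\<^sup>1 B\<close> of measure algebras, which is onto by
  \<open>representable\<close>.
\<close>

definition \<Phi> :: "'a set \<Rightarrow> (nat \<Rightarrow> real) set" where
  "\<Phi> A = (SOME B. B \<in> sets N \<and> (AE x in M. \<Theta> x \<in> B \<longleftrightarrow> x \<in> A))"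

lemma \<Phi>: assumes "A \<in> sets M" shows "\<Phi> A \<in> sets N" "AE x in M. \<Theta> x \<in> \<Phi> A \<longleftrightarrow> x \<in> A"
  using someI_ex[OF representable[OF assms]] unfolding \<Phi>_def by auto

lemma \<Phi>_iso: "measure_algebra_iso M N \<Phi>"
  unfolding measure_algebra_iso_def
proof (intro conjI ballI allI impI)
  show "\<Phi> \<in> sets M \<rightarrow> sets N" using \<Phi>(1) by auto
next
  fix A B assume AB: "A \<in> sets M" "B \<in> sets M"
  have "(AE x in M. \<Theta> x \<in> \<Phi> A \<longleftrightarrow> \<Theta> x \<in> \<Phi> B) \<longleftrightarrow> (AE x in M. x \<in> A \<longleftrightarrow> x \<in> B)"
  proof
    assume "AE x in M. \<Theta> x \<in> \<Phi> A \<longleftrightarrow> \<Theta> x \<in> \<Phi> B"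
    with \<Phi>(2)[OF AB(1)] \<Phi>(2)[OF AB(2)] show "AE x in M. x \<in> A \<longleftrightarrow> x \<in> B" by eventually_elim auto
  next
    assume "AE x in M. x \<in> A \<longleftrightarrow> x \<in> B"
    with \<Phi>(2)[OF AB(1)] \<Phi>(2)[OF AB(2)] show "AE x in M. \<Theta> x \<in> \<Phi> A \<longleftrightarrow> \<Theta> x \<in> \<Phi> B" by eventually_elim auto
  qed
  then show "eq_mod_null N (\<Phi> A) (\<Phi> B) \<longleftrightarrow> eq_mod_null M A B"
    unfolding eq_mod_null_N_iff eq_mod_null_iff[of M] using AB \<Phi>(1) by auto
next
  fix B assume B: "B \<in> sets N"
  have A: "\<Theta> -` B \<inter> space M \<in> sets M" by (rule measurable_sets[OF \<Theta>_measurable_N B])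
  have "AE x in M. \<Theta> x \<in> \<Phi> (\<Theta> -` B \<inter> space M) \<longleftrightarrow> \<Theta> x \<in> B"
    using \<Phi>(2)[OF A] AE_space by eventually_elim auto
  then show "\<exists>A\<in>sets M. eq_mod_null N (\<Phi> A) B"
    using A B \<Phi>(1)[OF A] unfolding eq_mod_null_N_iff by (intro bexI[of _ "\<Theta> -` B \<inter> space M"]) auto
next
  fix A assume A: "A \<in> sets M"
  have cA: "space M - A \<in> sets M" using A by auto
  have "AE x in M. \<Theta> x \<in> \<Phi> (space M - A) \<longleftrightarrow> \<Theta> x \<in> space N - \<Phi> A"
    using \<Phi>(2)[OF A] \<Phi>(2)[OF cA] AE_space by eventually_elim (use \<Theta>_in_Y space_N in auto)
  then show "eq_mod_null N (\<Phi> (space M - A)) (space N - \<Phi> A)"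
    unfolding eq_mod_null_N_iff using \<Phi>(1)[OF A] \<Phi>(1)[OF cA] by auto
next
  fix A :: "nat \<Rightarrow> 'a set" assume "range A \<subseteq> sets M"
  then have A: "A n \<in> sets M" for n by auto
  then have UA: "(\<Union>n. A n) \<in> sets M" by auto
  have "AE x in M. \<forall>n. \<Theta> x \<in> \<Phi> (A n) \<longleftrightarrow> x \<in> A n" unfolding AE_all_countable using \<Phi>(2)[OF A] by auto
  with \<Phi>(2)[OF UA] have "AE x in M. \<Theta> x \<in> \<Phi> (\<Union>n. A n) \<longleftrightarrow> \<Theta> x \<in> (\<Union>n. \<Phi> (A n))"
    by eventually_elim auto
  then show "eq_mod_null N (\<Phi> (\<Union>n. A n)) (\<Union>n. \<Phi> (A n))"
    unfolding eq_mod_null_N_iff using \<Phi>(1)[OF A] \<Phi>(1)[OF UA] by auto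
next
  fix A assume A: "A \<in> sets M"
  have "emeasure N (\<Phi> A) = emeasure M (\<Theta> -` \<Phi> A \<inter> space M)"
    using emeasure_distr[OF \<Theta>_measurable_N \<Phi>(1)[OF A]] unfolding distr_\<Theta> .
  also have "\<dots> = emeasure M A"
    using \<Phi>(2)[OF A] AE_space
    by (intro emeasure_eq_AE measurable_sets[OF \<Theta>_measurable_N \<Phi>(1)[OF A]] A) (auto elim!: eventually_elim2)
  finally show "emeasure N (\<Phi> A) = emeasure M A" .
qed

theorem spatial_model: "admits_spatial_model G \<tau> M \<phi>"
  unfolding admits_spatial_model_def boolean_isomorphic_def
proof (intro exI conjI ballI)
  show "spatial_action G \<tau> N L.act" by (rule N_act_spatial)
  show "measure_algebra_iso M N \<Phi>" by (rule \<Phi>_iso)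
  fix g A assume g: "g \<in> carrier G" and A: "A \<in> sets M"
  note gA = image_T_sets[OF g A]
  have "AE y in distr M N \<Theta>. y \<in> aut_image (aut_class N (L.act g)) (\<Phi> A) \<longleftrightarrow> L.act (inv g) y \<in> \<Phi> A"
    unfolding distr_\<Theta> by (rule S.image_class(2)[OF g \<Phi>(1)[OF A]])
  from AE_distrD[OF \<Theta>_measurable_N this] \<Phi>(2)[OF gA] AE_image_T[OF g A]
    AE_\<Theta>_equivariant[OF inv_closed[OF g]] AE_T[OF inv_closed[OF g] \<Phi>(2)[OF A]]
  have "AE x in M. \<Theta> x \<in> \<Phi> (aut_image (\<phi> g) A) \<longleftrightarrow> \<Theta> x \<in> aut_image (aut_class N (L.act g)) (\<Phi> A)"
    by eventually_elim auto
  then show "eq_mod_null N (\<Phi> (aut_image (\<phi> g) A)) (aut_image (aut_class N (L.act g)) (\<Phi> A))"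
    unfolding eq_mod_null_N_iff using \<Phi>(1)[OF gA] S.image_class(1)[OF g \<Phi>(1)[OF A]] by auto
qed

end

lemma (in near_action_nbhd) continuous_generation_imp_spatial_model:
  assumes sb: "standard_borel M" and gen: "sets M = continuous_algebra G \<tau> M \<phi>"
  shows "admits_spatial_model G \<tau> M \<phi>"
proof -
  obtain f :: "nat \<Rightarrow> 'a \<Rightarrow> real" where f: "\<And>n. G_continuous G \<tau> M \<phi> (f n)"
    "sets M \<subseteq> sigma_sets (space M) ({f n -` B \<inter> space M |n B. B \<in> sets borel} \<union> null_sets M)"
    by (rule countably_many_continuous_generators[OF sb gen], rule that)
  have oc: "openin \<tau> (carrier G)" using openin_topspace[of \<tau>] by simp
  let ?D = "countable_dense_subset \<tau> (carrier G)"
  note D = countable_dense_subset_of_open[OF polish oc]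
  \<comment> \<open>inserting the identity makes the set nonempty, so that it can be enumerated\<close>
  define D' where "D' = insert \<one> ?D"
  have D': "countable D'" "D' \<noteq> {}" "D' \<subseteq> carrier G" unfolding D'_def using D by auto
  define d where "d i = (case i of 0 \<Rightarrow> \<one> | Suc j \<Rightarrow> from_nat_into D' j)" for i
  have dense: "\<exists>i. d i \<in> O'" if O': "openin \<tau> O'" "O' \<noteq> {}" for O'
  proof -
    obtain g where g: "g \<in> O'" using O'(2) by auto
    then have "g \<in> \<tau> closure_of ?D" using D(3) openin_subset[OF O'(1)] by auto
    then obtain h where h: "h \<in> ?D" "h \<in> O'" using O'(1) g unfolding in_closure_of by blast
    then obtain j where "from_nat_into D' j = h" using from_nat_into_surj[OF D'(1), of h] unfolding D'_def by auto
    then show ?thesis using h by (intro exI[of _ "Suc j"]) (simp add: d_def)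
  qed
  have "d i \<in> carrier G" for i
    unfolding d_def using from_nat_into[OF D'(2)] D'(3) by (auto split: nat.split)
  then interpret generated_near_action M G \<tau> \<phi> U f d
    using f dense by unfold_locales (auto simp: d_def)
  show ?thesis by (rule spatial_model)
qed

section \<open>The theorem\<close>

theorem theorem2p9:
  fixes G :: "('g, 'r) monoid_scheme"
    and \<tau> :: "'g topology"
    and M :: "'a measure"
    and \<phi> :: "'g \<Rightarrow> ('a \<Rightarrow> 'a) set"
    and U :: "nat \<Rightarrow> 'g set"
  assumes "polish_group G \<tau>"
    and "standard_borel M" and "prob_space M"
    and "boolean_system G \<tau> M \<phi>"
    and "nbhd_sequence G \<tau> U"
    and "\<And>W. openin \<tau> W \<Longrightarrow> \<one>\<^bsub>G\<^esub> \<in> W \<Longrightarrow> \<exists>m\<ge>1. U m \<subseteq> W"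
  shows "continuous_algebra G \<tau> M \<phi> = stable_algebra \<tau> M \<phi> U \<and>
         (admits_spatial_model G \<tau> M \<phi> \<longleftrightarrow> sets M = stable_algebra \<tau> M \<phi> U)"
proof -
  interpret prob_space M by fact
  interpret group G using assms(1) unfolding polish_group_def by simp
  interpret near_action_nbhd M G \<tau> \<phi> U by unfold_locales (use assms in auto)
  have "sets M = stable_algebra \<tau> M \<phi> U" if model: "admits_spatial_model G \<tau> M \<phi>"
  proof -
    obtain N :: "(nat \<Rightarrow> real) measure" and a \<Phi> where "spatial_action G \<tau> N a" "measure_algebra_iso M N \<Phi>"
      "\<forall>g\<in>carrier G. \<forall>A\<in>sets M. eq_mod_null N (\<Phi> (aut_image (\<phi> g) A)) (aut_image (aut_class N (a g)) (\<Phi> A))"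
      using model unfolding admits_spatial_model_def boolean_isomorphic_def by blast
    then interpret spatial_model_iso M G \<tau> \<phi> U N a \<Phi> by unfold_locales auto
    show ?thesis by (rule spatial_model_imp_stable_generation)
  qed
  moreover have "admits_spatial_model G \<tau> M \<phi>" if "sets M = stable_algebra \<tau> M \<phi> U"
    using continuous_generation_imp_spatial_model[OF assms(2)] that
    unfolding continuous_algebra_eq_stable_algebra by simp
  ultimately show ?thesis using continuous_algebra_eq_stable_algebra by blast
qed

end
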